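(* Let $n\ge2$. Suppose that $p:\mathbb{R}^n\to[1,n]$ satisfies both the log-Hölder continuity condition and the log-Hölder decay condition, and let $q:\mathbb{R}^n\to(0,\infty)$ be any function. Let $$h(x,t)=t^{\,n-p(x)}\Big(\log\frac1t\Big)^{-p^+},\qquad \Phi(x,t)=t^{p(x)}\big(\log(e+t)\big)^{q(x)},$$ where $\Phi$ is considered as a generalized weak $\Phi$-function on $\mathbb{R}^n$. If $E\subset\mathbb{R}^n$ is any set with $C_{\Phi(\cdot,\cdot)}(E)=0$, then $\mathcal{H}^{h(\cdot)}(E)=0$.
   Context: Exponents: $p^+=\operatorname{ess\,sup}_{x\in\mathbb{R}^n}p(x)$. Log-Hölder continuity: there is $c_1>0$ with $|p(x)-p(y)|\le \dfrac{c_1}{\log(e+1/|x-y|)}$ for all $x\neq y$ in $\mathbb{R}^n$. Log-Hölder decay: there are $p_\infty\in\mathbb{R}$ and $c_2>0$ with $|p(x)-p_\infty|\le \dfrac{c_2}{\log(e+|x|)}$ for all $x\in\mathbb{R}^n$. Generalized weak $\Phi$-function: a function $\Phi:\mathbb{R}^n\times[0,\infty)\to[0,\infty]$ such that $x\mapsto\Phi(x,|f(x)|)$ is measurable for every measurable $f$; for a.e. $x$, $\Phi(x,\cdot)$ is a $\Phi$-prefunction (increasing, $\Phi(x,0)=0$, $\lim_{t\to0^+}\Phi(x,t)=0$, $\lim_{t\to\infty}\Phi(x,t)=\infty$); and $\Phi$ satisfies $(\mathrm{aInc})_1$: there is $a\ge1$ with $\Phi(x,s)/s\le a\,\Phi(x,t)/t$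 for all $0<s<t$ and a.e. $x$. Musielak–Orlicz(-Sobolev) spaces: $L^{\Phi(\cdot,\cdot)}(\mathbb{R}^n)$ is the set of measurable $f$ with $\int_{\mathbb{R}^n}\Phi(x,\lambda|f(x)|)\,dx<\infty$ for some $\lambda>0$; $W^{1,\Phi(\cdot,\cdot)}(\mathbb{R}^n)$ is the set of $u\in L^{\Phi(\cdot,\cdot)}(\mathbb{R}^n)\cap L^1_{\mathrm{loc}}(\mathbb{R}^n)$ whose first-order weak partial derivatives exist and belong to $L^{\Phi(\cdot,\cdot)}(\mathbb{R}^n)$. Capacity: the Musielak–Orlicz–Sobolev $\Phi(\cdot,\cdot)$-capacity of $E\subset\mathbb{R}^n$ is $$C_{\Phi(\cdot,\cdot)}(E)=\inf_{u\in S_{\Phi(\cdot,\cdot)}(E)}\int_{\mathbb{R}^n}\big(\Phi(x,|u|)+\Phi(x,|\nabla u|)\big)\,dx,$$ where $S_{\Phi(\cdot,\cdot)}(E)=\{u\in W^{1,\Phi(\cdot,\cdot)}(\mathbb{R}^n): u\ge1\text{ in an open set containing }E\text{ and }u\ge0\}$. Generalized Hausdorff measure: for a gauge function $h(x,t)>0$ that is non-decreasing in $t$ with $\lim_{t\to0}h(x,t)=0$, $$\mathcal{H}^{h(\cdot)}(E)=\lim_{\eta\to0}\mathcal{H}^{h(\cdot)}_\eta(E),\qquad \mathcal{H}^{h(\cdot)}_\eta(E)=\inf\Big\{\sum_i h(x_i,\operatorname{diam}(B_i)): E\subset\bigcup_i B_i,\ 0<\operatorname{diam}(B_i)\le\eta\Big\},$$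 where the infimum is over countable families of balls $B_i$ and $x_i$ is the center of $B_i$. The formula for $h$ is used for $0<t<1$; only arbitrarily small values of $t$ matter for $\mathcal{H}^{h(\cdot)}$. *)

theory Defs
  imports "HOL-Analysis.Analysis" "HOL-Probability.Essential_Supremum"
begin

section \<open>Variable exponents\<close>

definition log_holder_continuous :: "('a::real_normed_vector \<Rightarrow> real) \<Rightarrow> bool" where
  "log_holder_continuous p \<longleftrightarrow>
     (\<exists>c>0. \<forall>x y. x \<noteq> y \<longrightarrow> \<bar>p x - p y\<bar> \<le> c / ln (exp 1 + 1 / norm (x - y)))"

definition log_holder_decay :: "('a::real_normed_vector \<Rightarrow> real) \<Rightarrow> bool" where
  "log_holder_decay p \<longleftrightarrow>
     (\<exists>p_inf. \<exists>c>0. \<forall>x. \<bar>p x - p_inf\<bar> \<le> c / ln (exp 1 + norm x))"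

text \<open>The library's essential supremum lives in a complete linear order, hence the detour
  through \<^typ>\<open>ereal\<close>; for a bounded measurable exponent it is a real number.\<close>

definition exponent_sup :: "('a::euclidean_space \<Rightarrow> real) \<Rightarrow> real" where
  "exponent_sup p = real_of_ereal (esssup lebesgue (\<lambda>x. ereal (p x)))"


section \<open>Generalized weak \<open>\<Phi>\<close>-functions\<close>

text \<open>Functions on \<open>[0, \<infinity>)\<close> are represented by functions on \<^typ>\<open>real\<close> whose values at
  negative arguments are never used. ``Increasing'' is meant in the non-strict sense.\<close>

definition Phi_prefunction :: "(real \<Rightarrow> ennreal) \<Rightarrow> bool" where
  "Phi_prefunction f \<longleftrightarrow>
     mono_on {0..} f \<and> f 0 = 0 \<and> (f \<longlongrightarrow> 0) (at_right 0) \<and> (f \<longlongrightarrow> \<infinity>) at_top"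

definition aInc1 :: "('a::euclidean_space \<Rightarrow> real \<Rightarrow> ennreal) \<Rightarrow> bool" where
  "aInc1 \<Phi> \<longleftrightarrow>
     (\<exists>a::real. a \<ge> 1 \<and> (AE x in lebesgue. \<forall>s t. 0 < s \<and> s < t \<longrightarrow>
        \<Phi> x s / ennreal s \<le> ennreal a * (\<Phi> x t / ennreal t)))"

definition generalized_weak_Phi_function :: "('a::euclidean_space \<Rightarrow> real \<Rightarrow> ennreal) \<Rightarrow> bool" where
  "generalized_weak_Phi_function \<Phi> \<longleftrightarrow>
     (\<forall>f::'a \<Rightarrow> real. f \<in> borel_measurable lebesgue \<longrightarrow>
        (\<lambda>x. \<Phi> x \<bar>f x\<bar>) \<in> borel_measurable lebesgue) \<and>
     (AE x in lebesgue. Phi_prefunction (\<Phi> x)) \<and>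
     aInc1 \<Phi>"


section \<open>Weak derivatives\<close>

definition partial_deriv :: "'n \<Rightarrow> (real ^ 'n \<Rightarrow> real) \<Rightarrow> real ^ 'n \<Rightarrow> real" where
  "partial_deriv i f x = frechet_derivative f (at x) (axis i 1)"

primrec times_differentiable :: "nat \<Rightarrow> (real ^ 'n \<Rightarrow> real) \<Rightarrow> bool" where
  "times_differentiable 0 f \<longleftrightarrow> continuous_on UNIV f"
| "times_differentiable (Suc k) f \<longleftrightarrow>
     (\<forall>x. f differentiable (at x)) \<and> (\<forall>i. times_differentiable k (partial_deriv i f))"

text \<open>Smooth functions with compact support.\<close>

definition test_function :: "(real ^ 'n \<Rightarrow> real) \<Rightarrow> bool" where
  "test_function \<phi> \<longleftrightarrow> (\<forall>k. times_differentiable k \<phi>) \<and> compact (closure {x. \<phi> x \<noteq> 0})"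

definition locally_integrable :: "('a::euclidean_space \<Rightarrow> real) \<Rightarrow> bool" where
  "locally_integrable u \<longleftrightarrow>
     u \<in> borel_measurable lebesgue \<and> (\<forall>K. compact K \<longrightarrow> set_integrable lebesgue K u)"

definition is_weak_partial :: "'n \<Rightarrow> (real ^ 'n \<Rightarrow> real) \<Rightarrow> (real ^ 'n \<Rightarrow> real) \<Rightarrow> bool" where
  "is_weak_partial i u v \<longleftrightarrow> locally_integrable u \<and> locally_integrable v \<and>
     (\<forall>\<phi>. test_function \<phi> \<longrightarrow>
        (LINT x|lebesgue. u x * partial_deriv i \<phi> x) = - (LINT x|lebesgue. v x * \<phi> x))"

text \<open>Weak partial derivatives are only determined almost everywhere; the choice of a
  representative affects neither membership in the spaces nor the integrals below.\<close>

definition weak_partial :: "'n \<Rightarrow> (real ^ 'n \<Rightarrow> real) \<Rightarrow> real ^ 'n \<Rightarrow> real" where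
  "weak_partial i u = (SOME v. is_weak_partial i u v)"

definition weak_gradient :: "(real ^ 'n \<Rightarrow> real) \<Rightarrow> real ^ 'n \<Rightarrow> real ^ 'n" where
  "weak_gradient u x = (\<chi> i. weak_partial i u x)"


section \<open>Musielak--Orlicz--Sobolev spaces and capacity\<close>

definition musielak_orlicz :: "('a::euclidean_space \<Rightarrow> real \<Rightarrow> ennreal) \<Rightarrow> ('a \<Rightarrow> real) set" where
  "musielak_orlicz \<Phi> = {f. f \<in> borel_measurable lebesgue \<and>
     (\<exists>l>0. (\<integral>\<^sup>+x. \<Phi> x (l * \<bar>f x\<bar>) \<partial>lebesgue) < \<infinity>)}"

definition musielak_orlicz_sobolev ::
    "(real ^ 'n \<Rightarrow> real \<Rightarrow> ennreal) \<Rightarrow> (real ^ 'n \<Rightarrow> real) set" where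
  "musielak_orlicz_sobolev \<Phi> = {u. u \<in> musielak_orlicz \<Phi> \<and> locally_integrable u \<and>
     (\<forall>i. (\<exists>v. is_weak_partial i u v) \<and> weak_partial i u \<in> musielak_orlicz \<Phi>)}"

text \<open>Elements of the Sobolev space are functions rather than classes, so the inequalities are
  required pointwise; asking for them almost everywhere only adds functions that agree almost
  everywhere with an admissible one, and yields the same capacity.\<close>

definition capacity_admissible ::
    "(real ^ 'n \<Rightarrow> real \<Rightarrow> ennreal) \<Rightarrow> (real ^ 'n) set \<Rightarrow> (real ^ 'n \<Rightarrow> real) set" where
  "capacity_admissible \<Phi> E = {u \<in> musielak_orlicz_sobolev \<Phi>.
     (\<exists>U. open U \<and> E \<subseteq> U \<and> (\<forall>x\<in>U. u x \<ge> 1)) \<and> (\<forall>x. u x \<ge> 0)}"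

definition mos_capacity :: "(real ^ 'n \<Rightarrow> real \<Rightarrow> ennreal) \<Rightarrow> (real ^ 'n) set \<Rightarrow> ennreal" where
  "mos_capacity \<Phi> E = (INF u \<in> capacity_admissible \<Phi> E.
     \<integral>\<^sup>+x. (\<Phi> x \<bar>u x\<bar> + \<Phi> x (norm (weak_gradient u x))) \<partial>lebesgue)"


section \<open>Generalized Hausdorff measure\<close>

text \<open>Countable families of balls are indexed by arbitrary (finite or infinite) sets of natural
  numbers.\<close>

definition gen_hausdorff_content ::
    "('a::euclidean_space \<Rightarrow> real \<Rightarrow> real) \<Rightarrow> real \<Rightarrow> 'a set \<Rightarrow> ennreal" where
  "gen_hausdorff_content h \<eta> E =
     Inf {\<Sum>\<^sub>\<infinity>i\<in>I. ennreal (h (c i) (diameter (ball (c i) (r i)))) | (I::nat set) c r.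
       E \<subseteq> (\<Union>i\<in>I. ball (c i) (r i)) \<and>
       (\<forall>i\<in>I. 0 < diameter (ball (c i) (r i)) \<and> diameter (ball (c i) (r i)) \<le> \<eta>)}"

definition gen_hausdorff_measure ::
    "('a::euclidean_space \<Rightarrow> real \<Rightarrow> real) \<Rightarrow> 'a set \<Rightarrow> ennreal" where
  "gen_hausdorff_measure h E = Lim (at_right 0) (\<lambda>\<eta>. gen_hausdorff_content h \<eta> E)"

lemma gen_hausdorff_content_antimono:
  assumes "\<eta> \<le> \<eta>'"
  shows "gen_hausdorff_content h \<eta>' E \<le> gen_hausdorff_content h \<eta> E"
  unfolding gen_hausdorff_content_def
proof (rule Inf_superset_mono, clarify, goal_cases)
  case (1 x I c r)
  then have "\<forall>i\<in>I. 0 < diameter (ball (c i) (r i)) \<and> diameter (ball (c i) (r i)) \<le> \<eta>'"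
    using assms by (meson order_trans)
  with 1(1) show ?case
    by blast
qed

lemma gen_hausdorff_content_tendsto:
  "((\<lambda>\<eta>. gen_hausdorff_content h \<eta> E) \<longlongrightarrow> gen_hausdorff_measure h E) (at_right 0)"
proof -
  let ?S = "SUP \<eta>\<in>{0<..}. gen_hausdorff_content h \<eta> E"
  have "((\<lambda>\<eta>. gen_hausdorff_content h \<eta> E) \<longlongrightarrow> ?S) (at_right 0)"
  proof (rule order_tendstoI)
    fix a assume "a < ?S"
    then obtain \<eta> where \<eta>: "\<eta> > 0" "a < gen_hausdorff_content h \<eta> E"
      by (auto simp: less_SUP_iff)
    have "\<forall>\<^sub>F x in at_right 0. 0 < x \<and> x < \<eta>"
      using \<eta>(1) by (auto simp: eventually_at_right)
    then show "\<forall>\<^sub>F x in at_right 0. a < gen_hausdorff_content h x E"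
    proof eventually_elim
      case (elim x)
      then have "gen_hausdorff_content h \<eta> E \<le> gen_hausdorff_content h x E"
        by (intro gen_hausdorff_content_antimono) simp
      with \<eta>(2) show ?case
        by (rule less_le_trans)
    qed
  next
    fix a assume a: "?S < a"
    have "\<forall>\<^sub>F x::real in at_right 0. 0 < x"
      by (rule eventually_at_right_less)
    then show "\<forall>\<^sub>F x in at_right 0. gen_hausdorff_content h x E < a"
    proof eventually_elim
      case (elim x)
      then have "gen_hausdorff_content h x E \<le> ?S"
        by (intro SUP_upper) simp
      then show ?case
        using a by (rule le_less_trans)
    qed
  qed
  then show ?thesis
    unfolding gen_hausdorff_measure_def
    using tendsto_Lim[OF trivial_limit_at_right_real] by fastforce
qed


section \<open>The specific gauge and \<open>\<Phi>\<close>-function\<close>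

text \<open>The formula for the gauge is meaningful for \<open>0 < t < 1\<close>; its values for \<open>t \<ge> 1\<close> have no
  influence on \<^const>\<open>gen_hausdorff_measure\<close>, which is a limit as \<open>\<eta>\<close> tends to 0.\<close>

definition log_gauge :: "(real ^ 'n \<Rightarrow> real) \<Rightarrow> real ^ 'n \<Rightarrow> real \<Rightarrow> real" where
  "log_gauge p x t = t powr (real CARD('n) - p x) * ln (1 / t) powr (- exponent_sup p)"

definition Phi_log :: "('a \<Rightarrow> real) \<Rightarrow> ('a \<Rightarrow> real) \<Rightarrow> 'a \<Rightarrow> real \<Rightarrow> ennreal" where
  "Phi_log p q x t = ennreal (t powr p x * ln (exp 1 + t) powr q x)"

end

theory Submission
  imports Defs "HOL-Real_Asymp.Real_Asymp"
begin

text \<open>Only \<open>\<Phi>(x, t) \<ge> t powr p x\<close> matters.  For an admissible \<open>u\<close> of small energy, follow through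
  the dyadic cells around \<open>x \<in> E\<close> the running maximum of the levels \<open>t\<close> for which \<open>{u \<ge> t}\<close> occupies
  a fixed fraction of the cell.  It climbs from 1/2 to 1, and a Poincare inequality for truncations
  bounds each jump by the gradient restricted to the values of \<open>u\<close> inside the jump.  Nested cells have
  disjoint jumps, so no gradient energy is counted twice.  Jumps smaller than \<open>j powr (- (1 + 1/n))\<close>
  at scale \<open>2 powr (- j)\<close> add up to at most 1/4.  For a larger jump \<open>c\<close>, the energy bounds
  \<open>c powr p x\<close>, hence \<open>c\<close> times the gauge, since the resulting factor \<open>c powr (1 - p x)\<close> is absorbed
  by the logarithm in the gauge; log-Hoelder continuity makes \<open>p\<close> constant on the cell for this
  purpose.  The large jumps thus form a cheap fractional covering of \<open>E\<close>, which is made a genuine one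
  by choosing a random threshold.\<close>

section \<open>Smooth kernels with compact support\<close>

text \<open>Differences of cell averages of \<open>u\<close> would telescope as well, but every
  scale would then be charged with the full gradient energy of its cells, and the sum over
  infinitely many scales is out of control; hence the jumps are tied to ranges of values of
  \<open>u\<close>. The Poincare inequality is used with exponent 1, so the variable exponent enters
  only inside a single cell: there the mean gradient forced by a large jump lies, up to constants,
  between 1 and 2^j, and an oscillation of \<open>p\<close> of order 1/j changes its power only by a
  bounded factor. The exponent 1 + 1/n balances two demands. Being above 1, it makes the small jumps
  summable; and (1 + 1/n) * (s - 1) \<le> s for s = p x \<le> n, so that c powr (1 - s) is at most j
  powr s, which the factor j powr (- p^+) of the gauge pays for. The order of choices matters: the
  first scale \<open>j0\<close> is fixed from n and \<eta> alone, and only then is \<open>u\<close>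
  taken with an energy so small that {u \<ge> 1/2} fills at most half of any cell at scale
  \<open>j0\<close>.\<close>

lemma DERIV_zero_of_quadratic_bound:
  fixes f :: "real \<Rightarrow> real"
  assumes "f a = 0" "\<And>y. \<bar>f y\<bar> \<le> C * (y - a)^2"
  shows "(f has_real_derivative 0) (at a)"
proof -
  have "((\<lambda>y. C * \<bar>y - a\<bar>) \<longlongrightarrow> C * \<bar>a - a\<bar>) (at a)"
    by (intro tendsto_intros)
  then have lim: "((\<lambda>y. C * \<bar>y - a\<bar>) \<longlongrightarrow> 0) (at a)"
    by simp
  have "\<forall>\<^sub>F y in at a. norm ((f y - f a) / (y - a)) \<le> C * \<bar>y - a\<bar>"
  proof (unfold eventually_at_filter, intro always_eventually allI impI)
    fix y assume "y \<noteq> a"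
    then have "\<bar>f y\<bar> / \<bar>y - a\<bar> \<le> C * (y - a)^2 / \<bar>y - a\<bar>"
      by (intro divide_right_mono assms) auto
    also have "C * (y - a)^2 / \<bar>y - a\<bar> = C * \<bar>y - a\<bar>"
      using \<open>y \<noteq> a\<close> by (simp add: power2_eq_square field_simps flip: abs_mult)
    finally show "norm ((f y - f a) / (y - a)) \<le> C * \<bar>y - a\<bar>"
      using assms(1) by simp
  qed
  then have "((\<lambda>y. (f y - f a) / (y - a)) \<longlongrightarrow> 0) (at a)"
    by (rule Lim_null_comparison) (rule lim)
  then show ?thesis
    by (simp add: has_field_derivative_iff)
qed

text \<open>With R = 1 / (t * (1 - t)), this is the family P * R^m * exp (- R), extended by 0. It
  contains the standard bump exp (- R) and is closed under differentiation, so smoothness at the end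
  points has to be checked only once.\<close>

definition bump_term :: "real poly \<Rightarrow> nat \<Rightarrow> real \<Rightarrow> real" where
  "bump_term P m t = (if 0 < t \<and> t < 1
     then poly P t * (1 / (t * (1 - t))) ^ m * exp (- (1 / (t * (1 - t)))) else 0)"

lemma power_div_fact_le_exp:
  fixes r :: real
  assumes "r \<ge> 0"
  shows "r ^ k / fact k \<le> exp r"
proof -
  obtain t where "exp r = (\<Sum>m<Suc k. r ^ m / fact m) + exp t / fact (Suc k) * r ^ Suc k"
    using Maclaurin_exp_le by blast
  moreover have "exp t / fact (Suc k) * r ^ Suc k \<ge> 0" "(\<Sum>m<k. r ^ m / fact m) \<ge> 0"
    using assms by (auto intro!: sum_nonneg)
  ultimately show ?thesis
    by simp
qed

text \<open>The exponential beats two more powers of r = 1/s than needed, where s = t * (1 - t):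
  r^(m+2) * exp (- r) is bounded by a factorial, and the two spare powers turn into s^2 \<le> (t -
  a)^2.\<close>

lemma bump_term_quadratic_bound:
  assumes "a = 0 \<or> a = 1"
  obtains C where "\<And>t. \<bar>bump_term P m t\<bar> \<le> C * (t - a)^2"
proof -
  have "bounded (poly P ` {0..1})"
    by (intro compact_imp_bounded compact_continuous_image continuous_intros) auto
  then obtain B where B: "\<And>t. t \<in> {0..1} \<Longrightarrow> \<bar>poly P t\<bar> \<le> B"
    unfolding bounded_iff by (metis imageI real_norm_def)
  have "B \<ge> 0"
    using B[of 0] by auto
  have "\<bar>bump_term P m t\<bar> \<le> B * fact (m + 2) * (t - a)^2" for t
  proof (cases "0 < t \<and> t < 1")
    case True
    define s where "s = t * (1 - t)"
    define r where "r = 1 / s"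
    have s: "s > 0" "s \<le> \<bar>t - a\<bar>"
      using True assms by (auto simp: s_def mult_le_cancel_left1 mult_le_cancel_right1)
    have r: "r > 0"
      using s by (simp add: r_def)
    have "r ^ (m + 2) * exp (- r) \<le> fact (m + 2)"
      using power_div_fact_le_exp[of r "m + 2"] r
      by (simp add: exp_minus divide_simps mult.commute del: fact_Suc power_Suc add_2_eq_Suc')
    then have "s^2 * (r ^ (m + 2) * exp (- r)) \<le> (t - a)^2 * fact (m + 2)"
      using s r by (intro mult_mono) (auto simp: abs_le_square_iff[symmetric])
    moreover have "s^2 * r ^ (m + 2) = r ^ m"
      using s by (simp add: r_def power_add power_divide power2_eq_square)
    ultimately have "r ^ m * exp (- r) \<le> (t - a)^2 * fact (m + 2)"
      by (metis mult.assoc)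
    then have "\<bar>poly P t\<bar> * (r ^ m * exp (- r)) \<le> B * ((t - a)^2 * fact (m + 2))"
      using B[of t] True r by (intro mult_mono[of "\<bar>poly P t\<bar>"]) auto
    moreover have "\<bar>bump_term P m t\<bar> = \<bar>poly P t\<bar> * (r ^ m * exp (- r))"
      using True r unfolding bump_term_def r_def s_def by (simp add: abs_mult)
    ultimately show ?thesis
      by (simp only: mult_ac)
  qed (use \<open>B \<ge> 0\<close> in \<open>auto simp: bump_term_def\<close>)
  then show thesis
    by (rule that)
qed

text \<open>With s = t * (1 - t) and R = 1/s one has R' = - (1 - 2t) * R^2. The three summands of
  the new polynomial come from P, R^m and exp (- R), raised to the common power m + 2 of R by means
  of s * R = 1.\<close>

lemma DERIV_bump_term:
  "(bump_term P m has_real_derivative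
      bump_term (pderiv P * [:0, 1, -1:]^2 - smult (real m) (P * [:0, 1, -1:] * [:1, -2:]) + P * [:1, -2:])
        (m + 2) t) (at t)" (is "(_ has_real_derivative bump_term ?Q _ t) _")
proof -
  consider "0 < t" "t < 1" | "t < 0 \<or> t > 1" | "t = 0 \<or> t = 1"
    by fastforce
  then show ?thesis
  proof cases
    case 1
    let ?s = "\<lambda>t::real. t * (1 - t)"
    have s: "?s t > 0"
      using 1 by simp
    have poly_s: "poly [:0, 1, -1:] t = ?s t"
      by (simp add: algebra_simps)
    define R where "R = 1 / ?s t"
    define e where "e = exp (- R)"
    have dR: "((\<lambda>t. 1 / ?s t) has_real_derivative - (1 - 2 * t) * R^2) (at t)"
      using s unfolding R_def
      by (auto intro!: derivative_eq_intros simp: power2_eq_square divide_simps)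
    have sR: "?s t * R = 1"
      using 1 by (simp add: R_def)
    have "((\<lambda>t. poly P t * (1 / ?s t) ^ m * exp (- (1 / ?s t))) has_real_derivative
        bump_term ?Q (m + 2) t) (at t)"
    proof (rule DERIV_cong)
      show "((\<lambda>t. poly P t * (1 / ?s t) ^ m * exp (- (1 / ?s t))) has_real_derivative
        poly (pderiv P) t * R ^ m * e + poly P t * (real m * R ^ (m - 1) * (- (1 - 2 * t) * R^2)) * e +
        poly P t * R ^ m * (e * ((1 - 2 * t) * R^2))) (at t)"
        using DERIV_mult[OF DERIV_mult[OF poly_DERIV DERIV_power[OF dR]]
            DERIV_chain2[OF DERIV_exp DERIV_minus[OF dR]], of P m]
        unfolding R_def[symmetric] e_def[symmetric]
        by (rule DERIV_cong) (simp add: algebra_simps)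
      \<comment> \<open>Inserting s * R = 1 removes the truncated difference m - 1; for m = 0 both
        sides vanish.\<close>
      have "real m * R ^ (m - 1) = real m * R ^ (m - 1) * (?s t * R)"
        using sR by simp
      also have "\<dots> = real m * ?s t * R ^ m"
        by (cases m) auto
      finally have m: "real m * R ^ (m - 1) = real m * ?s t * R ^ m" .
      have "bump_term ?Q (m + 2) t = (poly (pderiv P) t * (?s t * R)^2 * R ^ m
          - real m * poly P t * ?s t * (1 - 2 * t) * R^2 * R ^ m + poly P t * (1 - 2 * t) * R^2 * R ^ m) * e"
        using 1 by (simp add: bump_term_def e_def R_def[symmetric] poly_s power_add power_mult_distrib)
          (simp add: algebra_simps power2_eq_square)
      also have "\<dots> = poly (pderiv P) t * R ^ m * e
        + poly P t * (real m * ?s t * R ^ m * (- (1 - 2 * t) * R^2)) * e +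
        poly P t * R ^ m * (e * ((1 - 2 * t) * R^2))"
        unfolding sR by (simp add: algebra_simps)
      finally show "poly (pderiv P) t * R ^ m * e
        + poly P t * (real m * R ^ (m - 1) * (- (1 - 2 * t) * R^2)) * e +
        poly P t * R ^ m * (e * ((1 - 2 * t) * R^2)) = bump_term ?Q (m + 2) t"
        unfolding m by simp
    qed
    then show ?thesis
      by (rule has_field_derivative_transform_within_open[of _ _ _ "{0<..<1}"])
        (use 1 in \<open>auto simp: bump_term_def\<close>)
  next
    case 2
    have "((\<lambda>_. 0) has_real_derivative bump_term ?Q (m + 2) t) (at t)"
      using 2 by (auto simp: bump_term_def)
    then show ?thesis
      by (rule has_field_derivative_transform_within_open[of _ _ _ "-{0..1}"])
        (use 2 in \<open>auto simp: bump_term_def\<close>)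
  next
    case 3
    then obtain C where "\<And>y. \<bar>bump_term P m y\<bar> \<le> C * (y - t)^2"
      using bump_term_quadratic_bound by metis
    then have "(bump_term P m has_real_derivative 0) (at t)"
      by (rule DERIV_zero_of_quadratic_bound[rotated]) (use 3 in \<open>auto simp: bump_term_def\<close>)
    then show ?thesis
      using 3 by (auto simp: bump_term_def)
  qed
qed

text \<open>All derivatives are produced together as a sequence \<open>D\<close>, because
  \<open>times_differentiable\<close> asks for them at every order.\<close>

lemma smooth_bump_exists:
  obtains D :: "nat \<Rightarrow> real \<Rightarrow> real"
  where "\<And>m t. (D m has_real_derivative D (Suc m) t) (at t)"
    and "\<And>m t. t \<notin> {0<..<1} \<Longrightarrow> D m t = 0"
    and "\<And>t. D 0 t \<ge> 0"
    and "\<And>t. t \<in> {0<..<1} \<Longrightarrow> D 0 t > 0"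
proof -
  define Q where "Q = rec_nat (1 :: real poly, 0 :: nat) (\<lambda>_ (P, m).
    (pderiv P * [:0, 1, -1:]^2 - smult (real m) (P * [:0, 1, -1:] * [:1, -2:]) + P * [:1, -2:], m + 2))"
  define D where "D = (\<lambda>m. bump_term (fst (Q m)) (snd (Q m)))"
  have "(D m has_real_derivative D (Suc m) t) (at t)" for m t
    unfolding D_def using DERIV_bump_term[of "fst (Q m)" "snd (Q m)" t]
    by (simp add: Q_def case_prod_unfold)
  moreover have "D m t = 0" if "t \<notin> {0<..<1}" for m t
    using that by (auto simp: D_def bump_term_def)
  moreover have "D 0 t \<ge> 0" for t
    by (simp add: D_def bump_term_def Q_def)
  moreover have "D 0 t > 0" if "t \<in> {0<..<1}" for t
    using that by (simp add: D_def bump_term_def Q_def)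
  ultimately show thesis
    by (rule that)
qed

text \<open>Tensor products indexed by a multi-index \<open>m\<close> of derivative orders are
  closed under partial differentiation: the i-th one only raises \<open>m i\<close>. This makes an
  induction for \<open>times_differentiable\<close> possible.\<close>

lemma has_derivative_prod_coordinates:
  fixes G :: "'n::finite \<Rightarrow> nat \<Rightarrow> real \<Rightarrow> real"
  assumes G: "\<And>i m t. (G i m has_real_derivative G i (Suc m) t) (at t)"
  shows "((\<lambda>x::real^'n. \<Prod>i\<in>UNIV. G i (m i) (x $ i)) has_derivative
    (\<lambda>h. \<Sum>i\<in>UNIV. h $ i * (\<Prod>j\<in>UNIV. G j ((m(i := Suc (m i))) j) (x $ j)))) (at x)"
proof -
  have "((\<lambda>x::real^'n. G i (m i) (x $ i)) has_derivative (\<lambda>h. h $ i * G i (Suc (m i)) (x $ i))) (at x)" for i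
    using has_derivative_compose[of "\<lambda>x::real^'n. x $ i" "\<lambda>h. h $ i" x UNIV, OF _
        G[unfolded has_field_derivative_def]]
    by (auto simp: mult.commute intro!: bounded_linear_imp_has_derivative bounded_linear_vec_nth)
  then have "((\<lambda>x::real^'n. \<Prod>i\<in>UNIV. G i (m i) (x $ i)) has_derivative
    (\<lambda>h. \<Sum>i\<in>UNIV. (h $ i * G i (Suc (m i)) (x $ i)) * (\<Prod>j\<in>UNIV - {i}. G j (m j) (x $ j)))) (at x)"
    by (intro has_derivative_prod) auto
  moreover have "G i (Suc (m i)) (x $ i) * (\<Prod>j\<in>UNIV - {i}. G j (m j) (x $ j)) =
    (\<Prod>j\<in>UNIV. G j ((m(i := Suc (m i))) j) (x $ j))" for i
    by (subst prod.remove[of UNIV i]) (auto intro!: prod.cong)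
  ultimately show ?thesis
    by (simp add: mult.assoc)
qed

lemma sum_axis_mult: "(\<Sum>i\<in>UNIV. axis k (1::real) $ i * f i) = f k"
  for k :: "'n::finite"
proof -
  have "(\<Sum>i\<in>UNIV. axis k (1::real) $ i * f i) = (\<Sum>i\<in>UNIV. if i = k then f i else 0)"
    by (intro sum.cong) (auto simp: axis_def)
  then show ?thesis
    by simp
qed

lemma times_differentiable_prod_coordinates:
  fixes G :: "'n::finite \<Rightarrow> nat \<Rightarrow> real \<Rightarrow> real"
  assumes G: "\<And>i m t. (G i m has_real_derivative G i (Suc m) t) (at t)"
  shows "times_differentiable k (\<lambda>x::real^'n. \<Prod>i\<in>UNIV. G i (m i) (x $ i))"
proof (induction k arbitrary: m)
  case 0
  have G_cont: "continuous_on UNIV (G i (m i))" for i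
    by (meson G DERIV_continuous_on has_field_derivative_at_within)
  have "continuous_on UNIV (\<lambda>x::real^'n. G i (m i) (x $ i))" for i
    by (rule continuous_on_compose2[OF G_cont]) (auto intro: continuous_intros)
  then show ?case
    unfolding times_differentiable.simps by (rule continuous_on_prod)
next
  case (Suc k)
  note D = has_derivative_prod_coordinates[of G, OF G]
  note frechet = frechet_derivative_at[OF D, symmetric]
  have "partial_deriv i (\<lambda>x::real^'n. \<Prod>i\<in>UNIV. G i (m i) (x $ i)) =
      (\<lambda>x. \<Prod>j\<in>UNIV. G j ((m(i := Suc (m i))) j) (x $ j))" for i
    unfolding partial_deriv_def frechet sum_axis_mult ..
  then have "times_differentiable k (partial_deriv i (\<lambda>x::real^'n. \<Prod>i\<in>UNIV. G i (m i) (x $ i)))" for i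
    by (simp only: Suc.IH)
  moreover have "(\<lambda>x::real^'n. \<Prod>i\<in>UNIV. G i (m i) (x $ i)) differentiable (at x)" for x
    using D[of m] by (rule differentiableI)
  ultimately show ?case
    by (simp only: times_differentiable.simps simp_thms)
qed

lemma emeasure_lborel_open_nonzero:
  fixes S :: "'a::euclidean_space set"
  assumes "open S" "S \<noteq> {}"
  shows "emeasure lborel S \<noteq> 0"
proof
  assume "emeasure lborel S = 0"
  then have "S \<in> null_sets lborel"
    using assms by (simp add: null_sets_def)
  then have "negligible S"
    by (auto simp: negligible_iff_null_sets intro: null_sets_completionI)
  then show False
    using open_not_negligible assms by blast
qed

lemma smoothing_kernel_exists:
  obtains \<rho> :: "real^'n \<Rightarrow> real" and \<rho>' :: "'n \<Rightarrow> real^'n \<Rightarrow> real"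
  where "\<And>x. (\<rho> has_derivative (\<lambda>h. \<Sum>i\<in>UNIV. h $ i * \<rho>' i x)) (at x)"
    and "\<And>i. continuous_on UNIV (\<rho>' i)"
    and "\<And>x. x \<notin> cbox 0 1 \<Longrightarrow> \<rho> x = 0"
    and "\<And>i x. x \<notin> cbox 0 1 \<Longrightarrow> \<rho>' i x = 0"
    and "\<And>x. \<rho> x \<ge> 0"
    and "(\<integral>\<^sup>+x. \<rho> x \<partial>lborel) = 1"
    and "\<And>s x. s > 0 \<Longrightarrow> test_function (\<lambda>z. \<rho> (s *\<^sub>R (x - z)))"
proof -
  obtain D :: "nat \<Rightarrow> real \<Rightarrow> real" where
    D: "\<And>m t. (D m has_real_derivative D (Suc m) t) (at t)"
    and D0: "\<And>m t. t \<notin> {0<..<1} \<Longrightarrow> D m t = 0"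
    and Dnn: "\<And>t. D 0 t \<ge> 0"
    and Dpos: "\<And>t. t \<in> {0<..<1} \<Longrightarrow> D 0 t > 0"
    using smooth_bump_exists by metis
  define \<tau> where "\<tau> = (\<lambda>x::real^'n. \<Prod>i\<in>UNIV. D 0 (x $ i))"
  have D_cont: "continuous_on UNIV (D m)" for m
    by (meson D DERIV_continuous_on has_field_derivative_at_within)
  have \<tau>_cont: "continuous_on UNIV \<tau>"
    unfolding \<tau>_def
    by (intro continuous_on_prod continuous_on_compose2[OF D_cont] continuous_intros) auto
  have prod0: "(\<Prod>i\<in>UNIV. D (m i) (x $ i)) = 0" if x: "x \<notin> cbox 0 1" for x :: "real^'n" and m
  proof -
    obtain i where "x $ i \<notin> {0..1}"
      using x by (force simp: mem_box_cart)
    then have "D (m i) (x $ i) = 0"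
      by (intro D0) auto
    then show ?thesis
      by auto
  qed
  have \<tau>0: "\<tau> x = 0" if "x \<notin> cbox 0 1" for x
    using prod0[OF that, of "\<lambda>_. 0"] by (simp add: \<tau>_def)
  have \<tau>nn: "\<tau> x \<ge> 0" for x
    using Dnn by (auto simp: \<tau>_def intro!: prod_nonneg)
  have [measurable]: "\<tau> \<in> borel_measurable borel"
    using \<tau>_cont by (rule borel_measurable_continuous_onI)
  obtain B where B: "\<And>x. x \<in> cbox 0 1 \<Longrightarrow> \<bar>\<tau> x\<bar> \<le> B"
  proof -
    have "bounded (\<tau> ` cbox 0 1)"
      by (intro compact_imp_bounded compact_continuous_image continuous_on_subset[OF \<tau>_cont]) auto
    then show thesis
      using that unfolding bounded_iff by (metis imageI real_norm_def)
  qed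
  define c where "c = (\<integral>\<^sup>+x. \<tau> x \<partial>lborel)"
  have "c \<le> (\<integral>\<^sup>+x. ennreal B * indicator (cbox 0 1 :: (real^'n) set) x \<partial>lborel)"
    unfolding c_def
  proof (intro nn_integral_mono)
    show "ennreal (\<tau> x) \<le> ennreal B * indicator (cbox 0 1) x" for x
      using B[of x] \<tau>0[of x] by (cases "x \<in> cbox 0 1") (auto intro!: ennreal_leI)
  qed
  also have "\<dots> < \<infinity>"
    using emeasure_lborel_cbox_finite[of 0 "1 :: real^'n"]
    by (simp add: nn_integral_cmult_indicator ennreal_mult_less_top)
  finally have "c < \<infinity>" .
  have "c \<noteq> 0"
  proof
    assume "c = 0"
    then have "AE x in lborel. \<tau> x = 0"
      unfolding c_def using \<tau>nn by (subst (asm) nn_integral_0_iff_AE) (auto simp: ennreal_eq_0_iff order_antisym)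
    then have "AE x in lborel. x \<notin> box 0 (1 :: real^'n)"
    proof eventually_elim
      case (elim x)
      have "\<tau> x > 0" if "x \<in> box 0 1"
        using that Dpos by (auto simp: \<tau>_def mem_box_cart intro!: prod_pos)
      then show ?case
        using elim by auto
    qed
    then have "emeasure lborel (box 0 (1 :: real^'n)) = 0"
      by (subst (asm) AE_iff_measurable[OF _ refl]) (auto simp: box_def)
    moreover have "(\<chi> i. 1/2) \<in> box 0 (1 :: real^'n)"
      by (auto simp: mem_box_cart)
    ultimately show False
      using emeasure_lborel_open_nonzero[of "box 0 (1 :: real^'n)"] by auto
  qed
  \<comment> \<open>The normalisation is spread over the factors, hence the CARD('n)-th root of the
    total mass: the normalised kernel stays a product of one-variable functions.\<close>
  define c' where "c' = root CARD('n) (enn2real c)"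
  have c': "c' > 0" "ennreal (c' ^ CARD('n)) = c"
    using \<open>c < \<infinity>\<close> \<open>c \<noteq> 0\<close> by (auto simp: c'_def enn2real_positive_iff less_top zero_less_iff_neq_zero)
  define E where "E = (\<lambda>m t. D m t / c')"
  have E: "(E m has_real_derivative E (Suc m) t) (at t)" for m t
    unfolding E_def by (intro DERIV_cdivide D)
  have E_cont: "continuous_on UNIV (E m)" for m
    by (meson E DERIV_continuous_on has_field_derivative_at_within)
  define \<rho> where "\<rho> = (\<lambda>x::real^'n. \<Prod>i\<in>UNIV. E 0 (x $ i))"
  define \<rho>' where "\<rho>' = (\<lambda>i (x::real^'n). \<Prod>j\<in>UNIV. E (((\<lambda>_. 0)(i := Suc 0)) j) (x $ j))"
  have \<rho>_eq: "\<rho> x = \<tau> x / c' ^ CARD('n)" for x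
    by (simp add: \<rho>_def \<tau>_def E_def prod_dividef)
  have E0: "(\<Prod>i\<in>UNIV. E (m i) (x $ i)) = 0" if "x \<notin> cbox 0 1" for x :: "real^'n" and m
    using prod0[OF that, of m] by (simp add: E_def prod_dividef)
  show thesis
  proof (rule that[of \<rho> \<rho>'])
    show "(\<rho> has_derivative (\<lambda>h. \<Sum>i\<in>UNIV. h $ i * \<rho>' i x)) (at x)" for x
      unfolding \<rho>_def \<rho>'_def
      using has_derivative_prod_coordinates[of "\<lambda>_. E" "\<lambda>_. 0" x] E by simp
    show "continuous_on UNIV (\<rho>' i)" for i
      unfolding \<rho>'_def
      by (intro continuous_on_prod continuous_on_compose2[OF E_cont] continuous_intros) auto
    show "\<rho> x = 0" if "x \<notin> cbox 0 1" for x
      using E0[OF that, of "\<lambda>_. 0"] by (simp add: \<rho>_def)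
    show "\<rho>' i x = 0" if "x \<notin> cbox 0 1" for i x
      using E0[OF that] by (simp add: \<rho>'_def)
    show "\<rho> x \<ge> 0" for x
      using \<tau>nn c' by (simp add: \<rho>_eq)
    have "(\<integral>\<^sup>+x. \<rho> x \<partial>lborel) = (\<integral>\<^sup>+x. ennreal (\<tau> x) / c \<partial>lborel)"
      using c' \<tau>nn by (intro nn_integral_cong) (simp add: \<rho>_eq divide_ennreal flip: c'(2))
    also have "\<dots> = 1"
      using \<open>c < \<infinity>\<close> \<open>c \<noteq> 0\<close> by (subst nn_integral_divide) (auto simp: c_def[symmetric])
    finally show "(\<integral>\<^sup>+x. \<rho> x \<partial>lborel) = 1" .
    fix s :: real and x :: "real^'n"
    assume s: "s > 0"
    \<comment> \<open>\<open>G i m\<close> is the m-th derivative in t of the factor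
      \<open>E 0 (s * (x $ i - t))\<close>; each inner derivative contributes - s.\<close>
    define G where "G = (\<lambda>(i::'n) m t. (- s) ^ m * E m (s * (x $ i - t)))"
    have "(G i m has_real_derivative G i (Suc m) t) (at t)" for i m t
    proof -
      have "((\<lambda>t. s * (x $ i - t)) has_real_derivative - s) (at t)"
        by (auto intro!: derivative_eq_intros)
      from DERIV_cmult[OF DERIV_chain2[OF E this], of "(- s) ^ m" m] show ?thesis
        unfolding G_def by (rule DERIV_cong) simp
    qed
    then have "times_differentiable k (\<lambda>z::real^'n. \<Prod>i\<in>UNIV. G i 0 (z $ i))" for k
      using times_differentiable_prod_coordinates[of G k "\<lambda>_. 0"] by simp
    moreover have "(\<Prod>i\<in>UNIV. G i 0 (z $ i)) = \<rho> (s *\<^sub>R (x - z))" for z :: "real^'n"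
      by (simp add: G_def \<rho>_def)
    ultimately have "times_differentiable k (\<lambda>z. \<rho> (s *\<^sub>R (x - z)))" for k
      by simp
    moreover have "{z. \<rho> (s *\<^sub>R (x - z)) \<noteq> 0} \<subseteq> (\<lambda>y. x - y /\<^sub>R s) ` cbox 0 1"
    proof clarify
      fix z assume "\<rho> (s *\<^sub>R (x - z)) \<noteq> 0"
      then have "s *\<^sub>R (x - z) \<in> cbox 0 1"
        using E0[of "s *\<^sub>R (x - z)" "\<lambda>_. 0"] by (auto simp: \<rho>_def)
      moreover have "z = x - (s *\<^sub>R (x - z)) /\<^sub>R s"
        using s by simp
      ultimately show "z \<in> (\<lambda>y. x - y /\<^sub>R s) ` cbox 0 1"
        by blast
    qed
    then have "bounded {z. \<rho> (s *\<^sub>R (x - z)) \<noteq> 0}"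
      by (rule bounded_subset[rotated])
        (intro compact_imp_bounded compact_continuous_image continuous_intros compact_cbox)
    ultimately show "test_function (\<lambda>z. \<rho> (s *\<^sub>R (x - z)))"
      by (auto simp: test_function_def)
  qed
qed

section \<open>Mollification\<close>

text \<open>Truncating the values of \<open>f\<close> costs little in L1. The truncated function is
  an almost everywhere limit of continuous functions, and clamping these as well provides the
  constant majorant for dominated convergence on the set \<open>S\<close> of finite measure.\<close>

lemma L1_approx_continuous:
  fixes f :: "'a::euclidean_space \<Rightarrow> real"
  assumes [measurable]: "f \<in> borel_measurable borel" "S \<in> sets borel"
    and fin: "(\<integral>\<^sup>+x\<in>S. \<bar>f x\<bar> \<partial>lborel) < \<infinity>" and S: "emeasure lborel S < \<infinity>" and "e > 0"
  obtains g where "continuous_on UNIV g" "(\<integral>\<^sup>+x\<in>S. \<bar>f x - g x\<bar> \<partial>lborel) \<le> ennreal e"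
proof -
  define clamp where "clamp = (\<lambda>(m::nat) t::real. max (- real m) (min (real m) t))"
  have clamp_cont: "continuous_on UNIV (clamp m)" for m
    unfolding clamp_def by (intro continuous_intros)
  then have [measurable]: "clamp m \<in> borel_measurable borel" for m
    by (rule borel_measurable_continuous_onI)
  have "(\<lambda>m. \<integral>\<^sup>+x. ennreal \<bar>f x - clamp m (f x)\<bar> * indicator S x \<partial>lborel) \<longlonglongrightarrow> (\<integral>\<^sup>+(x::'a). 0 \<partial>lborel)"
  proof (rule nn_integral_dominated_convergence[where w = "\<lambda>x. ennreal \<bar>f x\<bar> * indicator S x"])
    show "AE x in lborel. ennreal \<bar>f x - clamp m (f x)\<bar> * indicator S x \<le> ennreal \<bar>f x\<bar> * indicator S x" for m
      by (intro AE_I2 mult_right_mono ennreal_leI) (auto simp: clamp_def)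
    have "(\<lambda>m. ennreal \<bar>f x - clamp m (f x)\<bar> * indicator S x) \<longlonglongrightarrow> 0" for x
    proof (rule tendsto_eventually)
      obtain N where "\<bar>f x\<bar> \<le> real N"
        using real_arch_simple by blast
      then show "\<forall>\<^sub>F m in sequentially. ennreal \<bar>f x - clamp m (f x)\<bar> * indicator S x = 0"
        unfolding eventually_sequentially by (intro exI[of _ N]) (auto simp: clamp_def)
    qed
    then show "AE x in lborel. (\<lambda>m. ennreal \<bar>f x - clamp m (f x)\<bar> * indicator S x) \<longlonglongrightarrow> 0"
      by simp
  qed (use fin in auto)
  then have "\<forall>\<^sub>F m in sequentially. (\<integral>\<^sup>+x. ennreal \<bar>f x - clamp m (f x)\<bar> * indicator S x \<partial>lborel) < ennreal (e / 2)"
    using \<open>e > 0\<close> by (intro order_tendstoD) (auto simp: ennreal_zero_less_divide)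
  then obtain m where m: "(\<integral>\<^sup>+x. ennreal \<bar>f x - clamp m (f x)\<bar> * indicator S x \<partial>lborel) < ennreal (e / 2)"
    by (auto simp: eventually_sequentially)
  have "(\<lambda>x. clamp m (f x)) \<in> borel_measurable lebesgue"
    by (rule measurable_completion) simp
  then have "(\<lambda>x. clamp m (f x)) measurable_on UNIV"
    by (intro lebesgue_measurable_imp_measurable_on) auto
  then obtain N g where N: "negligible N" "\<And>n. continuous_on UNIV (g n)"
    "\<And>x. x \<notin> N \<Longrightarrow> (\<lambda>n. g n x) \<longlonglongrightarrow> clamp m (f x)"
    unfolding measurable_on_def by auto
  have [measurable]: "g n \<in> borel_measurable borel" for n
    using N(2) by (rule borel_measurable_continuous_onI)
  have "N \<in> null_sets lebesgue"
    using N(1) by (simp add: negligible_iff_null_sets)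
  then have AE_N: "AE x in lborel. x \<notin> N"
    using AE_not_in AE_completion_iff by blast
  have "(\<lambda>n. \<integral>\<^sup>+x. ennreal \<bar>clamp m (f x) - clamp m (g n x)\<bar> * indicator S x \<partial>lborel) \<longlonglongrightarrow> (\<integral>\<^sup>+(x::'a). 0 \<partial>lborel)"
  proof (rule nn_integral_dominated_convergence[where w = "\<lambda>x. ennreal (2 * m) * indicator S x"])
    show "AE x in lborel. ennreal \<bar>clamp m (f x) - clamp m (g n x)\<bar> * indicator S x \<le> ennreal (2 * m) * indicator S x" for n
      by (intro AE_I2 mult_right_mono ennreal_leI) (auto simp: clamp_def)
    show "(\<integral>\<^sup>+x. ennreal (2 * m) * indicator S x \<partial>lborel) < \<infinity>"
      using S by (simp add: nn_integral_cmult_indicator ennreal_mult_less_top)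
    have clamp_clamp: "clamp m (clamp m t) = clamp m t" for t
      by (auto simp: clamp_def)
    show "AE x in lborel. (\<lambda>n. ennreal \<bar>clamp m (f x) - clamp m (g n x)\<bar> * indicator S x) \<longlonglongrightarrow> 0"
      using AE_N
    proof eventually_elim
      case (elim x)
      have "(\<lambda>n. clamp m (g n x)) \<longlonglongrightarrow> clamp m (clamp m (f x))"
        by (rule continuous_on_tendsto_compose[OF clamp_cont N(3)[OF elim]]) auto
      then have "(\<lambda>n. ennreal \<bar>clamp m (f x) - clamp m (g n x)\<bar> * indicator S x) \<longlonglongrightarrow>
          ennreal \<bar>clamp m (f x) - clamp m (clamp m (f x))\<bar> * indicator S x"
        by (intro ennreal_tendsto_cmult[THEN tendsto_eq_rhs] tendsto_mult_ennreal tendsto_ennrealI tendsto_intros)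
          (auto simp: indicator_def)
      then show ?case
        by (simp add: clamp_clamp)
    qed
  qed auto
  then have "\<forall>\<^sub>F n in sequentially. (\<integral>\<^sup>+x. ennreal \<bar>clamp m (f x) - clamp m (g n x)\<bar> * indicator S x \<partial>lborel) < ennreal (e / 2)"
    using \<open>e > 0\<close> by (intro order_tendstoD) (auto simp: ennreal_zero_less_divide)
  then obtain n where n: "(\<integral>\<^sup>+x. ennreal \<bar>clamp m (f x) - clamp m (g n x)\<bar> * indicator S x \<partial>lborel) < ennreal (e / 2)"
    by (auto simp: eventually_sequentially)
  show thesis
  proof (rule that[of "\<lambda>x. clamp m (g n x)"])
    show "continuous_on UNIV (\<lambda>x. clamp m (g n x))"
      by (rule continuous_on_compose2[OF clamp_cont N(2)]) auto
    have "(\<integral>\<^sup>+x\<in>S. \<bar>f x - clamp m (g n x)\<bar> \<partial>lborel) \<le>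
      (\<integral>\<^sup>+x. ennreal \<bar>f x - clamp m (f x)\<bar> * indicator S x + ennreal \<bar>clamp m (f x) - clamp m (g n x)\<bar> * indicator S x \<partial>lborel)"
      by (intro nn_integral_mono)
        (auto simp flip: ennreal_plus distrib_right simp: indicator_def intro!: ennreal_leI)
    also have "\<dots> = (\<integral>\<^sup>+x. ennreal \<bar>f x - clamp m (f x)\<bar> * indicator S x \<partial>lborel) +
        (\<integral>\<^sup>+x. ennreal \<bar>clamp m (f x) - clamp m (g n x)\<bar> * indicator S x \<partial>lborel)"
      by (rule nn_integral_add) auto
    also have "\<dots> \<le> ennreal (e / 2) + ennreal (e / 2)"
      using m n by (intro add_mono) auto
    also have "\<dots> = ennreal e"
      using \<open>e > 0\<close> by (simp flip: ennreal_plus)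
    finally show "(\<integral>\<^sup>+x\<in>S. \<bar>f x - clamp m (g n x)\<bar> \<partial>lborel) \<le> ennreal e" .
  qed
qed

lemma cball_sets_borel [measurable]: "cball (a :: 'a::euclidean_space) r \<in> sets borel"
  by (rule borel_closed) simp

lemma nn_integral_lborel_affine:
  fixes f :: "'a::euclidean_space \<Rightarrow> ennreal"
  assumes [measurable]: "f \<in> borel_measurable borel" and "c \<noteq> 0"
  shows "(\<integral>\<^sup>+x. f x \<partial>lborel) = ennreal (\<bar>c\<bar> ^ DIM('a)) * (\<integral>\<^sup>+x. f (t + c *\<^sub>R x) \<partial>lborel)"
  by (subst lborel_affine[OF \<open>c \<noteq> 0\<close>, of t])
    (simp add: nn_integral_density nn_integral_distr nn_integral_cmult)

text \<open>Local integrability over balls about the origin, for Borel functions: Fubini's theorem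
  and the substitutions below are carried out over \<open>lborel\<close>.\<close>

definition borel_locally_integrable :: "('a::euclidean_space \<Rightarrow> real) \<Rightarrow> bool" where
  "borel_locally_integrable f \<longleftrightarrow> f \<in> borel_measurable borel \<and>
     (\<forall>r. integrable lborel (\<lambda>x. indicator (cball 0 r) x * f x))"

lemma borel_locally_integrable_nn_integral:
  assumes "borel_locally_integrable f"
  shows "(\<integral>\<^sup>+x\<in>cball 0 r. \<bar>f x\<bar> \<partial>lborel) < \<infinity>"
proof -
  have "integrable lborel (\<lambda>x. indicator (cball 0 r) x * f x)"
    using assms by (simp add: borel_locally_integrable_def)
  then have "(\<integral>\<^sup>+x. norm (indicator (cball 0 r) x * f x) \<partial>lborel) < \<infinity>"
    by (simp add: integrable_iff_bounded)
  also have "(\<integral>\<^sup>+x. norm (indicator (cball 0 r) x * f x) \<partial>lborel) = (\<integral>\<^sup>+x\<in>cball 0 r. \<bar>f x\<bar> \<partial>lborel)"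
    by (intro nn_integral_cong) (auto simp: indicator_def)
  finally show ?thesis .
qed

text \<open>Three-term comparison with a continuous \<open>g\<close>, which is uniformly continuous
  on a compact ball. The radius r + 1 is there because shifts of length below 1 move points of the
  ball of radius r into it.\<close>

lemma L1_translation_continuous:
  fixes f :: "'a::euclidean_space \<Rightarrow> real"
  assumes f: "borel_locally_integrable f" and "e > 0"
  obtains d where "d > 0"
    "\<And>h. norm h < d \<Longrightarrow> (\<integral>\<^sup>+x\<in>cball 0 r. \<bar>f (x - h) - f x\<bar> \<partial>lborel) \<le> ennreal e"
proof -
  have [measurable]: "f \<in> borel_measurable borel"
    using f by (simp add: borel_locally_integrable_def)
  have "e / 3 > 0"
    using \<open>e > 0\<close> by simp
  obtain g where g: "continuous_on UNIV g" "(\<integral>\<^sup>+x\<in>cball 0 (r + 1). \<bar>f x - g x\<bar> \<partial>lborel) \<le> ennreal (e / 3)"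
    by (rule L1_approx_continuous[of f "cball 0 (r + 1)", OF _ _ _ _ \<open>e / 3 > 0\<close>])
      (use f borel_locally_integrable_nn_integral emeasure_bounded_finite[OF bounded_cball] in auto)
  have [measurable]: "g \<in> borel_measurable borel"
    using g(1) by (rule borel_measurable_continuous_onI)
  define V where "V = measure lborel (cball (0::'a) r)"
  have V: "V \<ge> 0" "emeasure lborel (cball (0::'a) r) = ennreal V"
    using emeasure_bounded_finite[OF bounded_cball, of "0::'a" r]
    by (auto simp: V_def emeasure_eq_ennreal_measure)
  have "uniformly_continuous_on (cball 0 (r + 1)) g"
    by (intro compact_uniformly_continuous continuous_on_subset[OF g(1)]) auto
  moreover have "e / 3 / (V + 1) > 0"
    using \<open>e > 0\<close> V by simp
  ultimately obtain d where d: "d > 0"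
    "\<And>x y. x \<in> cball 0 (r + 1) \<Longrightarrow> y \<in> cball 0 (r + 1) \<Longrightarrow> dist y x < d \<Longrightarrow> dist (g y) (g x) < e / 3 / (V + 1)"
    unfolding uniformly_continuous_on_def by metis
  show thesis
  proof (rule that[of "min d 1"])
    fix h :: 'a assume h: "norm h < min d 1"
    have sub: "x - h \<in> cball 0 (r + 1)" if "x \<in> cball 0 r" for x
      using that h norm_triangle_ineq4[of x h] by auto
    let ?A = "\<lambda>x. ennreal \<bar>f x - g x\<bar> * indicator (cball 0 (r + 1)) x"
    have "(\<integral>\<^sup>+x\<in>cball 0 r. \<bar>f (x - h) - f x\<bar> \<partial>lborel) \<le>
      (\<integral>\<^sup>+x. ?A (- h + 1 *\<^sub>R x) + (ennreal (e / 3 / (V + 1)) * indicator (cball 0 r) x + ?A x) \<partial>lborel)"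
    proof (intro nn_integral_mono)
      fix x
      show "ennreal \<bar>f (x - h) - f x\<bar> * indicator (cball 0 r) x \<le>
        ?A (- h + 1 *\<^sub>R x) + (ennreal (e / 3 / (V + 1)) * indicator (cball 0 r) x + ?A x)"
      proof (cases "x \<in> cball 0 r")
        case True
        have "\<bar>g (x - h) - g x\<bar> \<le> e / 3 / (V + 1)"
          using d(2)[of x "x - h"] sub[OF True] True h by (auto simp: dist_norm)
        then have "\<bar>f (x - h) - f x\<bar> \<le> \<bar>f (x - h) - g (x - h)\<bar> + (e / 3 / (V + 1) + \<bar>f x - g x\<bar>)"
          by linarith
        then have "ennreal \<bar>f (x - h) - f x\<bar> \<le> ennreal (\<bar>f (x - h) - g (x - h)\<bar> + (e / 3 / (V + 1) + \<bar>f x - g x\<bar>))"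
          by (rule ennreal_leI)
        then show ?thesis
          using True sub[OF True] V \<open>e > 0\<close> by (simp add: ennreal_plus)
      qed simp
    qed
    also have "\<dots> = (\<integral>\<^sup>+x. ?A (- h + 1 *\<^sub>R x) \<partial>lborel) +
        ((\<integral>\<^sup>+x. ennreal (e / 3 / (V + 1)) * indicator (cball (0::'a) r) x \<partial>lborel) + (\<integral>\<^sup>+x. ?A x \<partial>lborel))"
    proof -
      have A: "?A \<in> borel_measurable lborel" "(\<lambda>x. ?A (- h + 1 *\<^sub>R x)) \<in> borel_measurable lborel"
        "(\<lambda>x. ennreal (e / 3 / (V + 1)) * indicator (cball (0::'a) r) x) \<in> borel_measurable lborel"
        by measurable
      show ?thesis
        by (subst nn_integral_add[OF A(2)]) (use A nn_integral_add[OF A(3) A(1)] in auto)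
    qed
    also have "(\<integral>\<^sup>+x. ?A (- h + 1 *\<^sub>R x) \<partial>lborel) = (\<integral>\<^sup>+x. ?A x \<partial>lborel)"
      using nn_integral_lborel_affine[of ?A 1 "- h"] by simp
    also have "(\<integral>\<^sup>+x. ennreal (e / 3 / (V + 1)) * indicator (cball (0::'a) r) x \<partial>lborel) = ennreal (e / 3 / (V + 1) * V)"
      using V \<open>e > 0\<close> by (simp add: nn_integral_cmult_indicator ennreal_mult''[symmetric])
    also have "(\<integral>\<^sup>+x. ?A x \<partial>lborel) + (ennreal (e / 3 / (V + 1) * V) + (\<integral>\<^sup>+x. ?A x \<partial>lborel)) \<le>
      ennreal (e / 3) + (ennreal (e / 3) + ennreal (e / 3))"
      using g(2) V \<open>e > 0\<close> by (intro add_mono ennreal_leI) (auto simp: divide_simps)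
    also have "\<dots> = ennreal e"
      using \<open>e > 0\<close> by (simp flip: ennreal_plus)
    finally show "(\<integral>\<^sup>+x\<in>cball 0 r. \<bar>f (x - h) - f x\<bar> \<partial>lborel) \<le> ennreal e" .
  qed (use d in auto)
qed

locale smoothing_kernel =
  fixes \<rho> :: "real^'n \<Rightarrow> real" and \<rho>' :: "'n \<Rightarrow> real^'n \<Rightarrow> real"
  assumes kernel_derivative: "\<And>x. (\<rho> has_derivative (\<lambda>h. \<Sum>i\<in>UNIV. h $ i * \<rho>' i x)) (at x)"
    and kernel_derivative_continuous: "\<And>i. continuous_on UNIV (\<rho>' i)"
    and kernel_outside: "\<And>x. x \<notin> cbox 0 1 \<Longrightarrow> \<rho> x = 0"
    and kernel_derivative_outside: "\<And>i x. x \<notin> cbox 0 1 \<Longrightarrow> \<rho>' i x = 0"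
    and kernel_nonneg: "\<And>x. \<rho> x \<ge> 0"
    and kernel_integral: "(\<integral>\<^sup>+x. \<rho> x \<partial>lborel) = 1"
    and kernel_test_function: "\<And>s x. s > 0 \<Longrightarrow> test_function (\<lambda>z. \<rho> (s *\<^sub>R (x - z)))"

lemma norm_cbox_0_1: "x \<in> cbox 0 1 \<Longrightarrow> norm x \<le> real CARD('n)"
  for x :: "real^'n"
proof -
  assume "x \<in> cbox 0 1"
  then have "(\<Sum>i\<in>UNIV. \<bar>x $ i\<bar>) \<le> (\<Sum>i\<in>(UNIV::'n set). 1)"
    by (intro sum_mono) (auto simp: mem_box_cart)
  then show ?thesis
    using norm_le_l1_cart[of x] by simp
qed

lemma compactly_supported_bounded:
  fixes \<phi> :: "real^'n \<Rightarrow> real"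
  assumes "continuous_on UNIV \<phi>" "\<And>x. x \<notin> cbox 0 1 \<Longrightarrow> \<phi> x = 0"
  obtains M where "M \<ge> 0" "\<And>x. \<bar>\<phi> x\<bar> \<le> M"
proof -
  have "bounded (\<phi> ` cbox 0 1)"
    by (intro compact_imp_bounded compact_continuous_image continuous_on_subset[OF assms(1)]) auto
  then obtain M where "\<And>x. x \<in> cbox 0 1 \<Longrightarrow> \<bar>\<phi> x\<bar> \<le> M"
    unfolding bounded_iff by (metis imageI real_norm_def)
  then have "\<bar>\<phi> x\<bar> \<le> max M 0" for x
    using assms(2)[of x] by (cases "x \<in> cbox 0 1") (force simp: max_def)+
  then show thesis
    by (rule that[rotated]) simp
qed

lemma rescaled_support_norm:
  fixes x z :: "real^'n"
  assumes "s > 0" "s *\<^sub>R (x - z) \<in> cbox 0 1"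
  shows "norm (x - z) \<le> real CARD('n) / s"
  using norm_cbox_0_1[OF assms(2)] assms(1)
  by (simp add: pos_le_divide_eq mult.commute del: scaleR_right_diff_distrib)

text \<open>The integrand lives on a ball whose radius exceeds |x| by at most n / s, and there a
  multiple of |f| dominates it. The two facts are stated for a general \<open>\<phi>\<close> since
  integrability is needed for the kernel and for its partial derivatives.\<close>

lemma
  fixes f :: "real^'n \<Rightarrow> real"
  assumes f: "borel_locally_integrable f" and \<phi>: "continuous_on UNIV \<phi>" "\<And>x. x \<notin> cbox 0 1 \<Longrightarrow> \<phi> x = 0"
    and s: "s > 0"
  shows integrable_convolution: "integrable lborel (\<lambda>z. f z * \<phi> (s *\<^sub>R (x - z)))"
    and continuous_on_convolution: "continuous_on UNIV (\<lambda>x. \<integral>z. f z * \<phi> (s *\<^sub>R (x - z)) \<partial>lborel)"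
proof -
  have [measurable]: "f \<in> borel_measurable borel" "\<phi> \<in> borel_measurable borel"
    using f \<phi>(1) by (auto simp: borel_locally_integrable_def intro: borel_measurable_continuous_onI)
  obtain M where M: "M \<ge> 0" "\<And>x. \<bar>\<phi> x\<bar> \<le> M"
    using compactly_supported_bounded[OF \<phi>] by metis
  have bound: "norm (f z * \<phi> (s *\<^sub>R (x - z))) \<le> M * norm (indicator (cball 0 (B + CARD('n) / s)) z * f z)"
    if "norm x \<le> B" for x z B
  proof (cases "s *\<^sub>R (x - z) \<in> cbox 0 1")
    case True
    have "norm z \<le> B + CARD('n) / s"
      using rescaled_support_norm[OF s True] that norm_triangle_sub[of z x]
      by (simp add: norm_minus_commute)
    then show ?thesis
      using M(2)[of "s *\<^sub>R (x - z)"] by (auto simp: abs_mult mult.commute[of M] intro!: mult_left_mono)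
  qed (use \<phi>(2) M(1) in auto)
  have dom: "integrable lborel (\<lambda>z. M * norm (indicator (cball 0 r) z * f z))" for r
    using f by (intro integrable_mult_right integrable_norm) (auto simp: borel_locally_integrable_def)
  show "integrable lborel (\<lambda>z. f z * \<phi> (s *\<^sub>R (x - z)))" for x
    by (rule Bochner_Integration.integrable_bound[OF dom[of "norm x + CARD('n) / s"]])
      (use bound[of x "norm x"] in \<open>auto intro!: AE_I2 simp: order_trans[OF _ abs_ge_self]\<close>)
  show "continuous_on UNIV (\<lambda>x. \<integral>z. f z * \<phi> (s *\<^sub>R (x - z)) \<partial>lborel)"
    unfolding continuous_on_sequentially
  proof (intro ballI allI impI, elim conjE)
    fix X and x :: "real^'n"
    assume X: "X \<longlonglongrightarrow> x"
    then obtain B where B: "\<And>k. norm (X k) \<le> B"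
      using convergent_imp_Bseq[of X] by (auto simp: convergent_def Bseq_def)
    have "(\<lambda>k. \<integral>z. f z * \<phi> (s *\<^sub>R (X k - z)) \<partial>lborel) \<longlonglongrightarrow> (\<integral>z. f z * \<phi> (s *\<^sub>R (x - z)) \<partial>lborel)"
    proof (rule integral_dominated_convergence[OF _ _ dom[of "B + CARD('n) / s"]])
      show "AE z in lborel. (\<lambda>k. f z * \<phi> (s *\<^sub>R (X k - z))) \<longlonglongrightarrow> f z * \<phi> (s *\<^sub>R (x - z))"
        by (intro AE_I2 tendsto_intros continuous_on_tendsto_compose[OF \<phi>(1)] X) auto
      show "AE z in lborel. norm (f z * \<phi> (s *\<^sub>R (X k - z))) \<le>
          M * norm (indicator (cball 0 (B + CARD('n) / s)) z * f z)" for k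
        using bound[OF B] by (intro AE_I2) auto
    qed auto
    then show "((\<lambda>x. \<integral>z. f z * \<phi> (s *\<^sub>R (x - z)) \<partial>lborel) \<circ> X) \<longlonglongrightarrow> (\<integral>z. f z * \<phi> (s *\<^sub>R (x - z)) \<partial>lborel)"
      by (simp add: o_def)
  qed
qed

context smoothing_kernel
begin

definition mollify :: "real \<Rightarrow> (real^'n \<Rightarrow> real) \<Rightarrow> real^'n \<Rightarrow> real" where
  "mollify s f x = (\<integral>z. f z * (s ^ CARD('n) * \<rho> (s *\<^sub>R (x - z))) \<partial>lborel)"

lemma kernel_continuous: "continuous_on UNIV \<rho>"
  using kernel_derivative
  by (meson has_derivative_continuous continuous_at_imp_continuous_on)

lemma kernel_measurable [measurable]: "\<rho> \<in> borel_measurable borel"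
  by (rule borel_measurable_continuous_onI[OF kernel_continuous])

lemma mollify_eq: "mollify s f x = s ^ CARD('n) * (\<integral>z. f z * \<rho> (s *\<^sub>R (x - z)) \<partial>lborel)"
  unfolding mollify_def
  by (subst integral_mult_right_zero[symmetric]) (simp add: mult_ac)

lemma continuous_on_mollify:
  assumes "borel_locally_integrable f" "s > 0"
  shows "continuous_on UNIV (mollify s f)"
  unfolding mollify_eq[abs_def]
  by (intro continuous_on_mult_left continuous_on_convolution assms kernel_continuous kernel_outside)

lemma has_derivative_rescaled_kernel:
  "((\<lambda>x. \<rho> (s *\<^sub>R (x - z))) has_derivative (\<lambda>h. s * (\<Sum>i\<in>UNIV. h $ i * \<rho>' i (s *\<^sub>R (x - z))))) (at x)"
proof -
  have "((\<lambda>x. s *\<^sub>R (x - z)) has_derivative (\<lambda>h. s *\<^sub>R h)) (at x)"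
    by (auto intro!: derivative_eq_intros)
  from has_derivative_compose[OF this kernel_derivative] show ?thesis
    by (simp add: sum_distrib_left mult.assoc)
qed

lemma partial_deriv_kernel:
  "partial_deriv i (\<lambda>z. \<rho> (s *\<^sub>R (x - z))) z = - s * \<rho>' i (s *\<^sub>R (x - z))"
proof -
  have "((\<lambda>z. s *\<^sub>R (x - z)) has_derivative (\<lambda>h. s *\<^sub>R (- h))) (at z)"
    by (auto intro!: derivative_eq_intros)
  from frechet_derivative_at[OF has_derivative_compose[OF this kernel_derivative], symmetric]
  show ?thesis
    by (simp add: partial_deriv_def sum_negf mult.assoc sum_axis_mult flip: sum_distrib_left)
qed

lemma line_kernel_derivative:
  "((\<lambda>t. \<rho> (s *\<^sub>R (y + t *\<^sub>R d - z))) has_real_derivative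
    s * (\<Sum>i\<in>UNIV. d $ i * \<rho>' i (s *\<^sub>R (y + t *\<^sub>R d - z)))) (at t)"
proof -
  have "((\<lambda>t. y + t *\<^sub>R d) has_derivative (\<lambda>h. h *\<^sub>R d)) (at t)"
    by (auto intro!: derivative_eq_intros)
  from has_derivative_compose[OF this has_derivative_rescaled_kernel] show ?thesis
    unfolding has_field_derivative_def
    by (rule has_derivative_eq_rhs) (auto simp: fun_eq_iff sum_distrib_left sum_distrib_right mult_ac)
qed

lemma line_kernel_bound:
  obtains M where "M \<ge> 0"
    "\<And>t h z. \<bar>\<rho> (s *\<^sub>R (y + (t + h) *\<^sub>R d - z)) - \<rho> (s *\<^sub>R (y + t *\<^sub>R d - z))\<bar> \<le> M * \<bar>h\<bar>"
proof -
  have "\<exists>M\<ge>0. \<forall>x. \<bar>\<rho>' i x\<bar> \<le> M" for i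
    using compactly_supported_bounded[OF kernel_derivative_continuous kernel_derivative_outside] by metis
  then obtain m where m: "\<And>i. m i \<ge> 0" "\<And>i x. \<bar>\<rho>' i x\<bar> \<le> m i"
    by metis
  define M where "M = \<bar>s\<bar> * (\<Sum>i\<in>UNIV. \<bar>d $ i\<bar> * m i)"
  have "\<bar>\<rho> (s *\<^sub>R (y + (t + h) *\<^sub>R d - z)) - \<rho> (s *\<^sub>R (y + t *\<^sub>R d - z))\<bar> \<le> M * \<bar>h\<bar>" for t h z
  proof -
    have "norm (\<rho> (s *\<^sub>R (y + (t + h) *\<^sub>R d - z)) - \<rho> (s *\<^sub>R (y + t *\<^sub>R d - z))) \<le> M * norm (t + h - t)"
    proof (rule field_differentiable_bound[of UNIV _
          "\<lambda>t. s * (\<Sum>i\<in>UNIV. d $ i * \<rho>' i (s *\<^sub>R (y + t *\<^sub>R d - z)))"])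
      fix t :: real
      show "((\<lambda>t. \<rho> (s *\<^sub>R (y + t *\<^sub>R d - z))) has_field_derivative
        s * (\<Sum>i\<in>UNIV. d $ i * \<rho>' i (s *\<^sub>R (y + t *\<^sub>R d - z)))) (at t within UNIV)"
        using line_kernel_derivative by simp
      have "\<bar>\<Sum>i\<in>UNIV. d $ i * \<rho>' i (s *\<^sub>R (y + t *\<^sub>R d - z))\<bar> \<le> (\<Sum>i\<in>UNIV. \<bar>d $ i\<bar> * m i)"
        by (intro order_trans[OF sum_abs] sum_mono) (auto simp: abs_mult intro!: mult_left_mono m)
      then show "norm (s * (\<Sum>i\<in>UNIV. d $ i * \<rho>' i (s *\<^sub>R (y + t *\<^sub>R d - z)))) \<le> M"
        unfolding M_def by (auto simp: abs_mult intro!: mult_left_mono)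
    qed auto
    then show ?thesis
      by simp
  qed
  moreover have "M \<ge> 0"
    using m by (auto simp: M_def intro!: sum_nonneg mult_nonneg_nonneg)
  ultimately show thesis
    using that by blast
qed

text \<open>Differentiation under the integral by dominated convergence: the kernel is Lipschitz
  along the line, so its difference quotients are bounded. Derivatives along lines suffice later,
  where functions are compared along segments only.\<close>

lemma DERIV_convolution_line:
  assumes f: "borel_locally_integrable f" and s: "s > 0"
  shows "((\<lambda>t. \<integral>z. f z * \<rho> (s *\<^sub>R (y + t *\<^sub>R d - z)) \<partial>lborel) has_real_derivative
    (\<integral>z. f z * (s * (\<Sum>i\<in>UNIV. d $ i * \<rho>' i (s *\<^sub>R (y + t *\<^sub>R d - z)))) \<partial>lborel)) (at t)"
proof -
  have [measurable]: "f \<in> borel_measurable borel" "\<rho>' i \<in> borel_measurable borel" for i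
    using f kernel_derivative_continuous
    by (auto simp: borel_locally_integrable_def intro: borel_measurable_continuous_onI)
  define F where "F = (\<lambda>t. \<integral>z. f z * \<rho> (s *\<^sub>R (y + t *\<^sub>R d - z)) \<partial>lborel)"
  obtain M where M: "M \<ge> 0"
    "\<And>t h z. \<bar>\<rho> (s *\<^sub>R (y + (t + h) *\<^sub>R d - z)) - \<rho> (s *\<^sub>R (y + t *\<^sub>R d - z))\<bar> \<le> M * \<bar>h\<bar>"
    using line_kernel_bound by metis
  have int: "integrable lborel (\<lambda>z. f z * \<rho> (s *\<^sub>R (x - z)))" for x
    by (intro integrable_convolution f s kernel_continuous kernel_outside)
  show ?thesis
    unfolding F_def[symmetric] DERIV_def tendsto_at_iff_sequentially
  proof (intro allI impI)
    fix X :: "nat \<Rightarrow> real"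
    assume X: "\<forall>k. X k \<in> UNIV - {0}" "X \<longlonglongrightarrow> 0"
    then obtain B where B: "\<And>k. \<bar>X k\<bar> \<le> B"
      using convergent_imp_Bseq[of X] by (auto simp: convergent_def Bseq_def)
    \<comment> \<open>Large enough to contain the support in \<open>z\<close> of the kernel for
      every parameter t' with |t'| \<le> |t| + B, so one ball serves the whole sequence of
      quotients.\<close>
    define r where "r = norm y + (\<bar>t\<bar> + B) * norm d + CARD('n) / s"
    have quot: "(F (t + X k) - F t) / X k =
      (\<integral>z. f z * ((\<rho> (s *\<^sub>R (y + (t + X k) *\<^sub>R d - z)) - \<rho> (s *\<^sub>R (y + t *\<^sub>R d - z))) / X k) \<partial>lborel)" for k
      unfolding F_def using int
      by (simp add: right_diff_distrib diff_divide_distrib flip: Bochner_Integration.integral_diff)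
        (subst integral_divide_zero[symmetric], simp add: diff_divide_distrib)
    have out: "\<rho> (s *\<^sub>R (y + t' *\<^sub>R d - z)) = 0" if "z \<notin> cball 0 r" "\<bar>t'\<bar> \<le> \<bar>t\<bar> + B" for t' z
    proof (rule ccontr)
      assume "\<rho> (s *\<^sub>R (y + t' *\<^sub>R d - z)) \<noteq> 0"
      then have "norm (y + t' *\<^sub>R d - z) \<le> CARD('n) / s"
        using kernel_outside s by (intro rescaled_support_norm) auto
      moreover have "norm z \<le> norm (y + t' *\<^sub>R d - z) + (norm y + \<bar>t'\<bar> * norm d)"
        using norm_triangle_ineq4[of "y + t' *\<^sub>R d" "y + t' *\<^sub>R d - z"] norm_triangle_ineq[of y "t' *\<^sub>R d"]
        by simp
      moreover have "\<bar>t'\<bar> * norm d \<le> (\<bar>t\<bar> + B) * norm d"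
        using that by (intro mult_right_mono) auto
      ultimately show False
        using that by (auto simp: r_def)
    qed
    have "(\<lambda>k. (F (t + X k) - F t) / X k) \<longlonglongrightarrow>
        (\<integral>z. f z * (s * (\<Sum>i\<in>UNIV. d $ i * \<rho>' i (s *\<^sub>R (y + t *\<^sub>R d - z)))) \<partial>lborel)"
      unfolding quot
    proof (rule integral_dominated_convergence)
      show "integrable lborel (\<lambda>z. M * norm (indicator (cball 0 r) z * f z))"
        using f by (intro integrable_mult_right integrable_norm) (auto simp: borel_locally_integrable_def)
      show "AE z in lborel. (\<lambda>k. f z * ((\<rho> (s *\<^sub>R (y + (t + X k) *\<^sub>R d - z)) - \<rho> (s *\<^sub>R (y + t *\<^sub>R d - z))) / X k))
        \<longlonglongrightarrow> f z * (s * (\<Sum>i\<in>UNIV. d $ i * \<rho>' i (s *\<^sub>R (y + t *\<^sub>R d - z))))"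
      proof (intro AE_I2 tendsto_intros)
        fix z
        show "(\<lambda>k. (\<rho> (s *\<^sub>R (y + (t + X k) *\<^sub>R d - z)) - \<rho> (s *\<^sub>R (y + t *\<^sub>R d - z))) / X k)
          \<longlonglongrightarrow> s * (\<Sum>i\<in>UNIV. d $ i * \<rho>' i (s *\<^sub>R (y + t *\<^sub>R d - z)))"
          using line_kernel_derivative[of s y d z t] X
          unfolding DERIV_def tendsto_at_iff_sequentially o_def by blast
      qed
      show "AE z in lborel. norm (f z * ((\<rho> (s *\<^sub>R (y + (t + X k) *\<^sub>R d - z)) - \<rho> (s *\<^sub>R (y + t *\<^sub>R d - z))) / X k))
        \<le> M * norm (indicator (cball 0 r) z * f z)" for k
      proof (intro AE_I2)
        fix z
        have "\<bar>t + X k\<bar> \<le> \<bar>t\<bar> + B" "\<bar>t\<bar> \<le> \<bar>t\<bar> + B"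
          using B[of k] by linarith+
        note out = out[OF _ this(1), of z] out[OF _ this(2), of z]
        show "norm (f z * ((\<rho> (s *\<^sub>R (y + (t + X k) *\<^sub>R d - z)) - \<rho> (s *\<^sub>R (y + t *\<^sub>R d - z))) / X k))
          \<le> M * norm (indicator (cball 0 r) z * f z)"
        proof (cases "z \<in> cball 0 r")
          case True
          have "\<bar>(\<rho> (s *\<^sub>R (y + (t + X k) *\<^sub>R d - z)) - \<rho> (s *\<^sub>R (y + t *\<^sub>R d - z))) / X k\<bar> \<le> M"
            using M(2)[of t "X k" z] X(1) by (simp add: abs_divide pos_divide_le_eq)
          then have "\<bar>f z\<bar> * \<bar>(\<rho> (s *\<^sub>R (y + (t + X k) *\<^sub>R d - z)) - \<rho> (s *\<^sub>R (y + t *\<^sub>R d - z))) / X k\<bar> \<le> \<bar>f z\<bar> * M"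
            by (intro mult_left_mono) auto
          then show ?thesis
            using True by (simp add: abs_mult mult.commute)
        qed (use out in simp)
      qed
    qed measurable
    then show "((\<lambda>h. (F (t + h) - F t) / h) \<circ> X) \<longlonglongrightarrow>
        (\<integral>z. f z * (s * (\<Sum>i\<in>UNIV. d $ i * \<rho>' i (s *\<^sub>R (y + t *\<^sub>R d - z)))) \<partial>lborel)"
      by (simp add: o_def)
  qed
qed

text \<open>The rescaled kernel is itself a test function in z, and its derivative in z is the
  negative of the one in x. The two minus signs cancel, and the gradient of the mollified function
  is the mollified weak gradient.\<close>

lemma DERIV_mollify_line:
  fixes v :: "real^'n \<Rightarrow> real^'n"
  assumes u: "borel_locally_integrable u" and v: "\<And>i. borel_locally_integrable (\<lambda>z. v z $ i)" and s: "s > 0"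
    and weak: "\<And>\<phi> i. test_function \<phi> \<Longrightarrow>
      (\<integral>z. u z * partial_deriv i \<phi> z \<partial>lborel) = - (\<integral>z. v z $ i * \<phi> z \<partial>lborel)"
  shows "((\<lambda>t. mollify s u (y + t *\<^sub>R d)) has_real_derivative
    (\<Sum>i\<in>UNIV. d $ i * mollify s (\<lambda>z. v z $ i) (y + t *\<^sub>R d))) (at t)"
proof -
  let ?x = "y + t *\<^sub>R d"
  have parts: "(\<integral>z. u z * (s * \<rho>' i (s *\<^sub>R (?x - z))) \<partial>lborel) = (\<integral>z. v z $ i * \<rho> (s *\<^sub>R (?x - z)) \<partial>lborel)" for i
    using weak[OF kernel_test_function[OF s], of i ?x] by (simp add: partial_deriv_kernel)
  have "integrable lborel (\<lambda>z. u z * (s * \<rho>' i (s *\<^sub>R (?x - z))))" for i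
    using integrable_mult_right[OF integrable_convolution[OF u kernel_derivative_continuous kernel_derivative_outside s], of s]
    by (simp add: mult_ac)
  then have "(\<Sum>i\<in>UNIV. d $ i * (\<integral>z. u z * (s * \<rho>' i (s *\<^sub>R (?x - z))) \<partial>lborel)) =
    (\<integral>z. (\<Sum>i\<in>UNIV. d $ i * (u z * (s * \<rho>' i (s *\<^sub>R (?x - z))))) \<partial>lborel)"
    by (subst Bochner_Integration.integral_sum) auto
  also have "\<dots> = (\<integral>z. u z * (s * (\<Sum>i\<in>UNIV. d $ i * \<rho>' i (s *\<^sub>R (?x - z)))) \<partial>lborel)"
    by (simp add: sum_distrib_left mult_ac)
  finally have "(\<integral>z. u z * (s * (\<Sum>i\<in>UNIV. d $ i * \<rho>' i (s *\<^sub>R (?x - z)))) \<partial>lborel) =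
      (\<Sum>i\<in>UNIV. d $ i * (\<integral>z. v z $ i * \<rho> (s *\<^sub>R (?x - z)) \<partial>lborel))"
    by (simp only: parts)
  from DERIV_cmult[OF DERIV_convolution_line[OF u s, of y d t, unfolded this], of "s ^ CARD('n)"]
  show ?thesis
    unfolding mollify_eq by (rule DERIV_cong) (simp add: sum_distrib_left mult_ac)
qed

text \<open>The kernel has mass 1, so \<open>f x\<close> may be moved under the integral; the
  substitution z = x - y / s then turns the error into an average of translation
  differences.\<close>

lemma mollify_error:
  assumes f: "borel_locally_integrable f" and s: "s > 0"
  shows "ennreal \<bar>mollify s f x - f x\<bar> \<le> (\<integral>\<^sup>+y. \<rho> y * ennreal \<bar>f (x - y /\<^sub>R s) - f x\<bar> \<partial>lborel)"
proof -
  have [measurable]: "f \<in> borel_measurable borel"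
    using f by (simp add: borel_locally_integrable_def)
  define \<kappa> where "\<kappa> = (\<lambda>z. s ^ CARD('n) * \<rho> (s *\<^sub>R (x - z)))"
  have \<kappa>_nonneg: "\<kappa> z \<ge> 0" for z
    using s kernel_nonneg by (simp add: \<kappa>_def)
  have subst: "(\<integral>\<^sup>+z. ennreal (\<kappa> z) * F z \<partial>lborel) = (\<integral>\<^sup>+y. \<rho> y * F (x - y /\<^sub>R s) \<partial>lborel)"
    if [measurable]: "F \<in> borel_measurable borel" for F :: "real^'n \<Rightarrow> ennreal"
  proof -
    have "(\<integral>\<^sup>+z. ennreal (\<kappa> z) * F z \<partial>lborel) =
        ennreal (\<bar>- inverse s\<bar> ^ CARD('n)) *
        (\<integral>\<^sup>+y. ennreal (\<kappa> (x + (- inverse s) *\<^sub>R y)) * F (x + (- inverse s) *\<^sub>R y) \<partial>lborel)"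
      using s by (subst nn_integral_lborel_affine[of _ "- inverse s" x]) (auto simp: \<kappa>_def)
    also have "\<dots> = (\<integral>\<^sup>+y. ennreal (\<bar>- inverse s\<bar> ^ CARD('n)) *
        (ennreal (\<kappa> (x + (- inverse s) *\<^sub>R y)) * F (x + (- inverse s) *\<^sub>R y)) \<partial>lborel)"
      by (rule nn_integral_cmult[symmetric]) (simp add: \<kappa>_def)
    also have "\<dots> = (\<integral>\<^sup>+y. \<rho> y * F (x - y /\<^sub>R s) \<partial>lborel)"
    proof (intro nn_integral_cong)
      fix y
      have "\<bar>- inverse s\<bar> ^ CARD('n) * \<kappa> (x + (- inverse s) *\<^sub>R y) = \<rho> y"
        using s by (simp add: \<kappa>_def power_inverse)
      then have "ennreal (\<bar>- inverse s\<bar> ^ CARD('n)) * ennreal (\<kappa> (x + (- inverse s) *\<^sub>R y)) = ennreal (\<rho> y)"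
        using s by (subst ennreal_mult'[symmetric]) auto
      then show "ennreal (\<bar>- inverse s\<bar> ^ CARD('n)) *
        (ennreal (\<kappa> (x + (- inverse s) *\<^sub>R y)) * F (x + (- inverse s) *\<^sub>R y)) = \<rho> y * F (x - y /\<^sub>R s)"
        by (simp add: mult.assoc[symmetric])
    qed
    finally show ?thesis .
  qed
  have \<kappa>_int: "has_bochner_integral lborel \<kappa> 1"
    using subst[of "\<lambda>_. 1"] \<kappa>_nonneg kernel_integral
    by (intro has_bochner_integral_nn_integral) (auto simp: \<kappa>_def)
  have f\<kappa>_int: "integrable lborel (\<lambda>z. f z * \<kappa> z)"
    using integrable_mult_right[OF integrable_convolution[OF f kernel_continuous kernel_outside s], of "s ^ CARD('n)"]
    by (simp add: \<kappa>_def mult_ac)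
  have "mollify s f x - f x = (\<integral>z. f z * \<kappa> z \<partial>lborel) - (\<integral>z. f x * \<kappa> z \<partial>lborel)"
    using has_bochner_integral_integral_eq[OF \<kappa>_int] by (simp add: mollify_def \<kappa>_def)
  also have "\<dots> = (\<integral>z. f z * \<kappa> z - f x * \<kappa> z \<partial>lborel)"
    using f\<kappa>_int \<kappa>_int by (subst Bochner_Integration.integral_diff) (auto simp: has_bochner_integral_iff)
  finally have eq: "mollify s f x - f x = (\<integral>z. f z * \<kappa> z - f x * \<kappa> z \<partial>lborel)" .
  have "integrable lborel (\<lambda>z. f z * \<kappa> z - f x * \<kappa> z)"
    using f\<kappa>_int \<kappa>_int by (auto simp: has_bochner_integral_iff)
  then have "ennreal \<bar>mollify s f x - f x\<bar> \<le> (\<integral>\<^sup>+z. norm (f z * \<kappa> z - f x * \<kappa> z) \<partial>lborel)"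
    unfolding eq real_norm_def[symmetric] by (rule integral_norm_bound_ennreal)
  also have "\<dots> = (\<integral>\<^sup>+z. ennreal (\<kappa> z) * ennreal \<bar>f z - f x\<bar> \<partial>lborel)"
    using \<kappa>_nonneg
  proof (intro nn_integral_cong)
    fix z
    have "norm (f z * \<kappa> z - f x * \<kappa> z) = \<kappa> z * \<bar>f z - f x\<bar>"
      using \<kappa>_nonneg[of z] by (simp add: abs_mult flip: left_diff_distrib)
    then show "ennreal (norm (f z * \<kappa> z - f x * \<kappa> z)) = ennreal (\<kappa> z) * ennreal \<bar>f z - f x\<bar>"
      using \<kappa>_nonneg[of z] by (simp add: ennreal_mult)
  qed
  also have "\<dots> = (\<integral>\<^sup>+y. \<rho> y * ennreal \<bar>f (x - y /\<^sub>R s) - f x\<bar> \<partial>lborel)"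
    by (rule subst) simp
  finally show ?thesis .
qed

text \<open>After Fubini, each y in the unit cube contributes a translation by y / s, of length at
  most n / s, and the translation estimate applies uniformly in y.\<close>

lemma mollify_L1:
  assumes f: "borel_locally_integrable f" and "e > 0"
  obtains s0 where "s0 > 0"
    "\<And>s. s > s0 \<Longrightarrow> (\<integral>\<^sup>+x\<in>cball 0 r. \<bar>mollify s f x - f x\<bar> \<partial>lborel) \<le> ennreal e"
proof -
  have [measurable]: "f \<in> borel_measurable borel"
    using f by (simp add: borel_locally_integrable_def)
  obtain d where d: "d > 0"
    "\<And>h. norm h < d \<Longrightarrow> (\<integral>\<^sup>+x\<in>cball 0 r. \<bar>f (x - h) - f x\<bar> \<partial>lborel) \<le> ennreal e"
    by (rule L1_translation_continuous[OF f \<open>e > 0\<close>, of r]) blast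
  show thesis
  proof (rule that[of "CARD('n) / d"])
    fix s assume "s > CARD('n) / d"
    moreover have "CARD('n) / d > 0"
      using d by simp
    ultimately have "s > 0"
      by (rule less_trans[rotated])
    with \<open>s > CARD('n) / d\<close> have s: "s > 0" "CARD('n) / s < d"
      using d(1) by (auto simp: field_simps)
    have "(\<integral>\<^sup>+x\<in>cball 0 r. \<bar>mollify s f x - f x\<bar> \<partial>lborel) \<le>
      (\<integral>\<^sup>+x. (\<integral>\<^sup>+y. \<rho> y * ennreal \<bar>f (x - y /\<^sub>R s) - f x\<bar> \<partial>lborel) * indicator (cball 0 r) x \<partial>lborel)"
      by (intro nn_integral_mono mult_right_mono mollify_error f s) auto
    also have "\<dots> = (\<integral>\<^sup>+x. (\<integral>\<^sup>+y. \<rho> y * (ennreal \<bar>f (x - y /\<^sub>R s) - f x\<bar> * indicator (cball 0 r) x) \<partial>lborel) \<partial>lborel)"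
      by (intro nn_integral_cong) (simp add: mult.assoc flip: nn_integral_multc)
    also have "\<dots> = (\<integral>\<^sup>+y. (\<integral>\<^sup>+x. \<rho> y * (ennreal \<bar>f (x - y /\<^sub>R s) - f x\<bar> * indicator (cball 0 r) x) \<partial>lborel) \<partial>lborel)"
      by (rule lborel_pair.Fubini'[symmetric]) measurable
    also have "\<dots> = (\<integral>\<^sup>+y. \<rho> y * (\<integral>\<^sup>+x\<in>cball 0 r. \<bar>f (x - y /\<^sub>R s) - f x\<bar> \<partial>lborel) \<partial>lborel)"
      by (intro nn_integral_cong nn_integral_cmult) simp
    also have "\<dots> \<le> (\<integral>\<^sup>+y. \<rho> y * ennreal e \<partial>lborel)"
    proof (intro nn_integral_mono)
      fix y
      show "\<rho> y * (\<integral>\<^sup>+x\<in>cball 0 r. \<bar>f (x - y /\<^sub>R s) - f x\<bar> \<partial>lborel) \<le> \<rho> y * ennreal e"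
      proof (cases "y \<in> cbox 0 1")
        case True
        then have "norm (y /\<^sub>R s) \<le> CARD('n) / s"
          using norm_cbox_0_1[OF True] s by (simp add: divide_simps mult.commute)
        then show ?thesis
          using d(2)[of "y /\<^sub>R s"] s by (intro mult_left_mono) auto
      qed (simp add: kernel_outside)
    qed
    also have "\<dots> = ennreal e"
      by (simp add: nn_integral_multc kernel_integral)
    finally show "(\<integral>\<^sup>+x\<in>cball 0 r. \<bar>mollify s f x - f x\<bar> \<partial>lborel) \<le> ennreal e" .
  qed (use d in simp)
qed

lemma mollify_tendsto_L1:
  assumes f: "borel_locally_integrable f"
  shows "(\<lambda>k. \<integral>\<^sup>+x\<in>cball 0 r. \<bar>mollify (real (Suc k)) f x - f x\<bar> \<partial>lborel) \<longlonglongrightarrow> 0"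
proof (rule order_tendstoI)
  fix a :: ennreal assume "0 < a"
  obtain e where e: "e > 0" "ennreal e < a"
  proof (cases a)
    case (real r)
    with \<open>0 < a\<close> show thesis
      by (intro that[of "r / 2"]) (auto simp: ennreal_less_iff)
  next
    case top
    then show thesis
      by (intro that[of 1]) auto
  qed
  obtain s0 where s0: "s0 > 0"
    "\<And>s. s > s0 \<Longrightarrow> (\<integral>\<^sup>+x\<in>cball 0 r. \<bar>mollify s f x - f x\<bar> \<partial>lborel) \<le> ennreal e"
    by (rule mollify_L1[OF f e(1), of r]) blast
  obtain N where "s0 < real N"
    using reals_Archimedean2 by blast
  then have "s0 < real (Suc k)" if "k \<ge> N" for k
    using that by linarith
  then have "(\<integral>\<^sup>+x\<in>cball 0 r. \<bar>mollify (real (Suc k)) f x - f x\<bar> \<partial>lborel) < a" if "k \<ge> N" for k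
    using s0(2) e(2) that by (meson le_less_trans)
  then show "\<forall>\<^sub>F k in sequentially. (\<integral>\<^sup>+x\<in>cball 0 r. \<bar>mollify (real (Suc k)) f x - f x\<bar> \<partial>lborel) < a"
    by (auto simp: eventually_sequentially)
qed auto

end

text \<open>The gradient is an explicit argument, which detaches the analysis from the choice hidden
  in \<open>weak_partial\<close>; Borel versions of that choice are supplied towards the
  end.\<close>

definition borel_weak_gradient :: "(real^'n \<Rightarrow> real) \<Rightarrow> (real^'n \<Rightarrow> real^'n) \<Rightarrow> bool" where
  "borel_weak_gradient u v \<longleftrightarrow> borel_locally_integrable u \<and> (\<forall>i. borel_locally_integrable (\<lambda>x. v x $ i)) \<and>
     (\<forall>\<phi> i. test_function \<phi> \<longrightarrow>
        (\<integral>x. u x * partial_deriv i \<phi> x \<partial>lborel) = - (\<integral>x. v x $ i * \<phi> x \<partial>lborel))"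

text \<open>The only interface to mollification used afterwards: derivatives along lines and local
  L1 convergence of functions and gradients.\<close>

lemma weak_gradient_smooth_approximation:
  fixes u :: "real^'n \<Rightarrow> real"
  assumes "borel_weak_gradient u v"
  obtains w :: "nat \<Rightarrow> real^'n \<Rightarrow> real" and g :: "nat \<Rightarrow> real^'n \<Rightarrow> real^'n"
  where "\<And>k. continuous_on UNIV (w k)" "\<And>k. continuous_on UNIV (g k)"
    and "\<And>k y d t. ((\<lambda>t. w k (y + t *\<^sub>R d)) has_real_derivative d \<bullet> g k (y + t *\<^sub>R d)) (at t)"
    and "\<And>r. (\<lambda>k. \<integral>\<^sup>+x\<in>cball 0 r. \<bar>w k x - u x\<bar> \<partial>lborel) \<longlonglongrightarrow> 0"
    and "\<And>r i. (\<lambda>k. \<integral>\<^sup>+x\<in>cball 0 r. \<bar>g k x $ i - v x $ i\<bar> \<partial>lborel) \<longlonglongrightarrow> 0"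
proof -
  obtain \<rho> :: "real^'n \<Rightarrow> real" and \<rho>' where "smoothing_kernel \<rho> \<rho>'"
    by (rule smoothing_kernel_exists) (blast intro: smoothing_kernel.intro)
  then interpret smoothing_kernel \<rho> \<rho>' .
  have u: "borel_locally_integrable u" "\<And>i. borel_locally_integrable (\<lambda>x. v x $ i)"
    using assms by (auto simp: borel_weak_gradient_def)
  define g where "g = (\<lambda>k x. \<chi> i. mollify (real (Suc k)) (\<lambda>x. v x $ i) x)"
  show thesis
  proof (rule that[of "\<lambda>k. mollify (real (Suc k)) u" g])
    show "continuous_on UNIV (mollify (real (Suc k)) u)" for k
      by (intro continuous_on_mollify u) simp
    show "continuous_on UNIV (g k)" for k
      unfolding g_def by (intro continuous_on_vec_lambda continuous_on_mollify u) simp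
    show "((\<lambda>t. mollify (real (Suc k)) u (y + t *\<^sub>R d)) has_real_derivative d \<bullet> g k (y + t *\<^sub>R d)) (at t)" for k y d t
      using DERIV_mollify_line[OF u, of "real (Suc k)" y d t] assms
      by (simp add: g_def inner_vec_def borel_weak_gradient_def)
    show "(\<lambda>k. \<integral>\<^sup>+x\<in>cball 0 r. \<bar>mollify (real (Suc k)) u x - u x\<bar> \<partial>lborel) \<longlonglongrightarrow> 0" for r
      by (intro mollify_tendsto_L1 u)
    show "(\<lambda>k. \<integral>\<^sup>+x\<in>cball 0 r. \<bar>g k x $ i - v x $ i\<bar> \<partial>lborel) \<longlonglongrightarrow> 0" for r i
      using mollify_tendsto_L1[OF u(2)] by (simp add: g_def)
  qed
qed

section \<open>A Poincare inequality between two levels\<close>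

text \<open>The fundamental theorem along the segment from y to x. By convexity the indicator of
  \<open>R\<close> is 1 on it; it is carried along so that the later change of variables leaves an
  integral over \<open>R\<close> and not over the whole space.\<close>

lemma line_integral_bound:
  fixes W :: "'a::euclidean_space \<Rightarrow> real" and G :: "'a \<Rightarrow> 'a"
  assumes G: "continuous_on UNIV G"
    and W: "\<And>y d t. ((\<lambda>t. W (y + t *\<^sub>R d)) has_real_derivative d \<bullet> G (y + t *\<^sub>R d)) (at t)"
    and R: "convex R" "x \<in> R" "y \<in> R" and D: "norm (x - y) \<le> D"
  shows "ennreal \<bar>W x - W y\<bar> \<le>
    D * (\<integral>\<^sup>+t\<in>{0..1}. indicator R (y + t *\<^sub>R (x - y)) * ennreal (norm (G (y + t *\<^sub>R (x - y)))) \<partial>lborel)"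
proof -
  define \<gamma> where "\<gamma> = (\<lambda>t. y + t *\<^sub>R (x - y))"
  have \<gamma>_cont: "continuous_on S \<gamma>" for S
    unfolding \<gamma>_def by (intro continuous_intros)
  have \<gamma>_R: "\<gamma> t \<in> R" if "t \<in> {0..1}" for t
    using convexD[OF R(1) R(3) R(2), of "1 - t" t] that by (simp add: \<gamma>_def algebra_simps)
  have G\<gamma>_cont: "continuous_on S (\<lambda>t. G (\<gamma> t))" for S
    by (rule continuous_on_compose2[OF G \<gamma>_cont]) auto
  have [measurable]: "(\<lambda>t. G (\<gamma> t)) \<in> borel_measurable borel"
    using G\<gamma>_cont by (rule borel_measurable_continuous_onI)
  have "has_bochner_integral lborel (\<lambda>t. indicator {0..1} t *\<^sub>R ((x - y) \<bullet> G (\<gamma> t))) (W (\<gamma> 1) - W (\<gamma> 0))"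
  proof (rule has_bochner_integral_FTC_Icc)
    show "((\<lambda>t. W (\<gamma> t)) has_vector_derivative (x - y) \<bullet> G (\<gamma> t)) (at t within {0..1})" for t
      using W[of y "x - y" t] unfolding \<gamma>_def
      by (simp add: has_real_derivative_iff_has_vector_derivative[symmetric] has_field_derivative_at_within)
    show "continuous_on {0..1} (\<lambda>t. (x - y) \<bullet> G (\<gamma> t))"
      by (intro continuous_intros G\<gamma>_cont)
  qed simp
  then have "integrable lborel (\<lambda>t. indicator {0..1} t *\<^sub>R ((x - y) \<bullet> G (\<gamma> t)))"
    "W x - W y = (\<integral>t. indicator {0..1} t *\<^sub>R ((x - y) \<bullet> G (\<gamma> t)) \<partial>lborel)"
    by (auto simp: has_bochner_integral_iff \<gamma>_def)
  then have "ennreal \<bar>W x - W y\<bar> \<le> (\<integral>\<^sup>+t. norm (indicator {0..1} t *\<^sub>R ((x - y) \<bullet> G (\<gamma> t))) \<partial>lborel)"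
    using integral_norm_bound_ennreal by (metis real_norm_def)
  also have "\<dots> \<le> (\<integral>\<^sup>+t. D * (indicator R (\<gamma> t) * ennreal (norm (G (\<gamma> t))) * indicator {0..1} t) \<partial>lborel)"
  proof (intro nn_integral_mono)
    fix t :: real
    have "\<bar>(x - y) \<bullet> G (\<gamma> t)\<bar> \<le> D * norm (G (\<gamma> t))"
      using Cauchy_Schwarz_ineq2[of "x - y" "G (\<gamma> t)"] D
      by (meson mult_right_mono norm_ge_zero order_trans)
    moreover have "D \<ge> 0"
      using D norm_ge_zero order_trans by blast
    ultimately show "ennreal (norm (indicator {0..1} t *\<^sub>R ((x - y) \<bullet> G (\<gamma> t)))) \<le>
      D * (indicator R (\<gamma> t) * ennreal (norm (G (\<gamma> t))) * indicator {0..1} t)"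
      using \<gamma>_R[of t] by (auto simp: indicator_def simp flip: ennreal_mult intro!: ennreal_leI)
  qed
  also have "\<dots> = D * (\<integral>\<^sup>+t. indicator R (\<gamma> t) * ennreal (norm (G (\<gamma> t))) * indicator {0..1} t \<partial>lborel)"
  proof -
    have "indicator R (\<gamma> t) * ennreal (norm (G (\<gamma> t))) * indicator {0..1} t =
      ennreal (norm (G (\<gamma> t))) * indicator {0..1} t" for t
      using \<gamma>_R by (auto simp: indicator_def)
    then show ?thesis
      by (simp only:) (rule nn_integral_cmult, measurable)
  qed
  finally show ?thesis
    by (simp add: \<gamma>_def)
qed

text \<open>One of t and 1 - t is at least 1/2, which bounds the Jacobian by 2^n. Always
  substituting for \<open>x\<close> would produce t^(-n), which is not integrable over t in (0,
  1).\<close>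

lemma segment_average_bound:
  fixes H :: "'a::euclidean_space \<Rightarrow> ennreal"
  assumes [measurable]: "H \<in> borel_measurable borel" "R \<in> sets borel" and t: "t \<in> {0..1}"
  shows "(\<integral>\<^sup>+y\<in>R. (\<integral>\<^sup>+x\<in>R. H (y + t *\<^sub>R (x - y)) \<partial>lborel) \<partial>lborel) \<le>
    2 ^ DIM('a) * emeasure lborel R * (\<integral>\<^sup>+z. H z \<partial>lborel)"
proof -
  \<comment> \<open>Integrate first over whichever of \<open>x\<close> and \<open>y\<close> carries the larger coefficient.\<close>
  have *: "(\<integral>\<^sup>+y\<in>R. (\<integral>\<^sup>+x\<in>R. H ((1 - t) *\<^sub>R y + t *\<^sub>R x) \<partial>lborel) \<partial>lborel) \<le>
      2 ^ DIM('a) * emeasure lborel R * (\<integral>\<^sup>+z. H z \<partial>lborel)" if t: "t \<ge> 1 / 2" for t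
  proof -
    have "(\<integral>\<^sup>+x\<in>R. H ((1 - t) *\<^sub>R y + t *\<^sub>R x) \<partial>lborel) \<le> 2 ^ DIM('a) * (\<integral>\<^sup>+z. H z \<partial>lborel)" for y
    proof -
      have "(\<integral>\<^sup>+x\<in>R. H ((1 - t) *\<^sub>R y + t *\<^sub>R x) \<partial>lborel) \<le> (\<integral>\<^sup>+x. H ((1 - t) *\<^sub>R y + t *\<^sub>R x) \<partial>lborel)"
        by (intro nn_integral_mono) (auto simp: indicator_def)
      also have "\<dots> \<le> ennreal ((2 * t) ^ DIM('a)) * (\<integral>\<^sup>+x. H ((1 - t) *\<^sub>R y + t *\<^sub>R x) \<partial>lborel)"
        using t mult_right_mono[of 1 "ennreal ((2 * t) ^ DIM('a))"] one_le_power[of "2 * t" "DIM('a)"] by auto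
      also have "\<dots> = 2 ^ DIM('a) * (ennreal (\<bar>t\<bar> ^ DIM('a)) * (\<integral>\<^sup>+x. H ((1 - t) *\<^sub>R y + t *\<^sub>R x) \<partial>lborel))"
        using t by (simp add: power_mult_distrib ennreal_mult mult.assoc ennreal_power[symmetric])
      also have "ennreal (\<bar>t\<bar> ^ DIM('a)) * (\<integral>\<^sup>+x. H ((1 - t) *\<^sub>R y + t *\<^sub>R x) \<partial>lborel) = (\<integral>\<^sup>+z. H z \<partial>lborel)"
        using t by (intro nn_integral_lborel_affine[symmetric]) auto
      finally show ?thesis .
    qed
    then have "(\<integral>\<^sup>+y\<in>R. (\<integral>\<^sup>+x\<in>R. H ((1 - t) *\<^sub>R y + t *\<^sub>R x) \<partial>lborel) \<partial>lborel) \<le>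
        (\<integral>\<^sup>+y. 2 ^ DIM('a) * (\<integral>\<^sup>+z. H z \<partial>lborel) * indicator R y \<partial>lborel)"
      by (intro nn_integral_mono mult_right_mono) auto
    then show ?thesis
      by (subst (asm) nn_integral_cmult_indicator) (auto simp: mult_ac)
  qed
  show ?thesis
  proof (cases "t \<ge> 1 / 2")
    case True
    then show ?thesis
      using *[of t] by (simp add: algebra_simps)
  next
    case False
    have "(\<integral>\<^sup>+y\<in>R. (\<integral>\<^sup>+x\<in>R. H (y + t *\<^sub>R (x - y)) \<partial>lborel) \<partial>lborel) =
      (\<integral>\<^sup>+y. (\<integral>\<^sup>+x. H (y + t *\<^sub>R (x - y)) * indicator R x * indicator R y \<partial>lborel) \<partial>lborel)"
      by (intro nn_integral_cong) (simp add: nn_integral_multc)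
    also have "\<dots> = (\<integral>\<^sup>+x. (\<integral>\<^sup>+y. H (y + t *\<^sub>R (x - y)) * indicator R x * indicator R y \<partial>lborel) \<partial>lborel)"
      by (rule lborel_pair.Fubini') measurable
    also have "\<dots> = (\<integral>\<^sup>+x. (\<integral>\<^sup>+y. H (y + t *\<^sub>R (x - y)) * indicator R y * indicator R x \<partial>lborel) \<partial>lborel)"
      by (simp add: mult_ac)
    also have "\<dots> = (\<integral>\<^sup>+x\<in>R. (\<integral>\<^sup>+y\<in>R. H (y + t *\<^sub>R (x - y)) \<partial>lborel) \<partial>lborel)"
      by (intro nn_integral_cong) (simp add: nn_integral_multc)
    also have "\<dots> \<le> 2 ^ DIM('a) * emeasure lborel R * (\<integral>\<^sup>+z. H z \<partial>lborel)"
      using *[of "1 - t"] False by (simp add: algebra_simps)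
    finally show ?thesis .
  qed
qed

text \<open>The form with a double integral, and no mean value, is chosen because it passes directly
  to a pair of level sets: x can be restricted to one and y to the other.\<close>

lemma convex_poincare_smooth:
  fixes W :: "'a::euclidean_space \<Rightarrow> real" and G :: "'a \<Rightarrow> 'a"
  assumes "continuous_on UNIV W" and G: "continuous_on UNIV G"
    and W: "\<And>y d t. ((\<lambda>t. W (y + t *\<^sub>R d)) has_real_derivative d \<bullet> G (y + t *\<^sub>R d)) (at t)"
    and R: "convex R" and [measurable]: "R \<in> sets borel" and D: "\<And>x y. x \<in> R \<Longrightarrow> y \<in> R \<Longrightarrow> norm (x - y) \<le> D"
  shows "(\<integral>\<^sup>+y\<in>R. (\<integral>\<^sup>+x\<in>R. \<bar>W x - W y\<bar> \<partial>lborel) \<partial>lborel) \<le>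
    ennreal D * 2 ^ DIM('a) * emeasure lborel R * (\<integral>\<^sup>+z\<in>R. norm (G z) \<partial>lborel)"
proof -
  have [measurable]: "W \<in> borel_measurable borel" "G \<in> borel_measurable borel"
    using assms by (auto intro: borel_measurable_continuous_onI)
  define H where "H = (\<lambda>z. indicator R z * ennreal (norm (G z)))"
  have [measurable]: "H \<in> borel_measurable borel"
    by (simp add: H_def)
  have "(\<integral>\<^sup>+y\<in>R. (\<integral>\<^sup>+x\<in>R. \<bar>W x - W y\<bar> \<partial>lborel) \<partial>lborel) \<le>
    (\<integral>\<^sup>+y\<in>R. (\<integral>\<^sup>+x\<in>R. D * (\<integral>\<^sup>+t\<in>{0..1}. H (y + t *\<^sub>R (x - y)) \<partial>lborel) \<partial>lborel) \<partial>lborel)"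
  proof (intro nn_integral_mono)
    fix y
    show "(\<integral>\<^sup>+x\<in>R. \<bar>W x - W y\<bar> \<partial>lborel) * indicator R y \<le>
      (\<integral>\<^sup>+x\<in>R. D * (\<integral>\<^sup>+t\<in>{0..1}. H (y + t *\<^sub>R (x - y)) \<partial>lborel) \<partial>lborel) * indicator R y"
    proof (cases "y \<in> R")
      case True
      have "(\<integral>\<^sup>+x\<in>R. \<bar>W x - W y\<bar> \<partial>lborel) \<le> (\<integral>\<^sup>+x\<in>R. D * (\<integral>\<^sup>+t\<in>{0..1}. H (y + t *\<^sub>R (x - y)) \<partial>lborel) \<partial>lborel)"
      proof (intro nn_integral_mono)
        fix x
        show "ennreal \<bar>W x - W y\<bar> * indicator R x \<le> D * (\<integral>\<^sup>+t\<in>{0..1}. H (y + t *\<^sub>R (x - y)) \<partial>lborel) * indicator R x"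
          using line_integral_bound[OF G W R _ True D[OF _ True], of x] by (cases "x \<in> R") (auto simp: H_def)
      qed
      then show ?thesis
        using True by simp
    qed simp
  qed
  also have "\<dots> = (\<integral>\<^sup>+y. (\<integral>\<^sup>+x. (\<integral>\<^sup>+t. D * (H (y + t *\<^sub>R (x - y)) * indicator {0..1} t) *
      indicator R x * indicator R y \<partial>lborel) \<partial>lborel) \<partial>lborel)"
    by (simp add: nn_integral_multc nn_integral_cmult)
  also have "\<dots> = (\<integral>\<^sup>+y. (\<integral>\<^sup>+t. (\<integral>\<^sup>+x. D * (H (y + t *\<^sub>R (x - y)) * indicator {0..1} t) *
      indicator R x * indicator R y \<partial>lborel) \<partial>lborel) \<partial>lborel)"
    by (intro nn_integral_cong lborel_pair.Fubini') measurable
  also have "\<dots> = (\<integral>\<^sup>+t. (\<integral>\<^sup>+y. (\<integral>\<^sup>+x. D * (H (y + t *\<^sub>R (x - y)) * indicator {0..1} t) *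
      indicator R x * indicator R y \<partial>lborel) \<partial>lborel) \<partial>lborel)"
    by (intro lborel_pair.Fubini') measurable
  also have "\<dots> = (\<integral>\<^sup>+t. D * (\<integral>\<^sup>+y\<in>R. (\<integral>\<^sup>+x\<in>R. H (y + t *\<^sub>R (x - y)) \<partial>lborel) \<partial>lborel) * indicator {0..1} t \<partial>lborel)"
  proof (intro nn_integral_cong)
    fix t :: real
    have eq: "(\<integral>\<^sup>+x. D * (H (y + t *\<^sub>R (x - y)) * indicator {0..1} t) * indicator R x * indicator R y \<partial>lborel) =
      (ennreal D * indicator {0..1} t) * ((\<integral>\<^sup>+x\<in>R. H (y + t *\<^sub>R (x - y)) \<partial>lborel) * indicator R y)" for y
      by (simp add: mult_ac flip: nn_integral_multc nn_integral_cmult)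
    show "(\<integral>\<^sup>+y. (\<integral>\<^sup>+x. D * (H (y + t *\<^sub>R (x - y)) * indicator {0..1} t) *
        indicator R x * indicator R y \<partial>lborel) \<partial>lborel) =
      D * (\<integral>\<^sup>+y\<in>R. (\<integral>\<^sup>+x\<in>R. H (y + t *\<^sub>R (x - y)) \<partial>lborel) \<partial>lborel) * indicator {0..1} t"
      unfolding eq by (subst nn_integral_cmult) (measurable, simp add: mult_ac)
  qed
  also have "\<dots> \<le> (\<integral>\<^sup>+t. D * (2 ^ DIM('a) * emeasure lborel R * (\<integral>\<^sup>+z. H z \<partial>lborel)) * indicator {0..1::real} t \<partial>lborel)"
  proof (intro nn_integral_mono)
    fix t :: real
    show "D * (\<integral>\<^sup>+y\<in>R. (\<integral>\<^sup>+x\<in>R. H (y + t *\<^sub>R (x - y)) \<partial>lborel) \<partial>lborel) * indicator {0..1} t \<le>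
      D * (2 ^ DIM('a) * emeasure lborel R * (\<integral>\<^sup>+z. H z \<partial>lborel)) * indicator {0..1} t"
      using segment_average_bound[of H R t]
      by (cases "t \<in> {0..1}") (auto intro!: mult_left_mono)
  qed
  also have "\<dots> = ennreal D * 2 ^ DIM('a) * emeasure lborel R * (\<integral>\<^sup>+z. H z \<partial>lborel)"
    by (subst nn_integral_cmult_indicator) (auto simp: mult_ac)
  finally show ?thesis
    by (simp add: H_def mult.commute)
qed

section \<open>Truncation between two levels and passage to weak gradients\<close>

lemma DERIV_pos_part_square:
  "((\<lambda>t::real. (max 0 t)^2) has_real_derivative 2 * max 0 t) (at t)"
proof -
  consider "t > 0" | "t < 0" | "t = 0"
    by linarith
  then show ?thesis
  proof cases
    case 1
    have "((\<lambda>t. t^2) has_real_derivative 2 * max 0 t) (at t)"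
      using 1 by (auto intro!: derivative_eq_intros)
    then show ?thesis
      by (rule has_field_derivative_transform_within_open[of _ _ _ "{0<..}"]) (use 1 in auto)
  next
    case 2
    have "((\<lambda>t. 0) has_real_derivative 2 * max 0 t) (at t)"
      using 2 by auto
    then show ?thesis
      by (rule has_field_derivative_transform_within_open[of _ _ _ "{..<0}"]) (use 2 in auto)
  next
    case 3
    have "((\<lambda>t::real. (max 0 t)^2) has_real_derivative 0) (at 0)"
      by (rule DERIV_zero_of_quadratic_bound[of _ _ 1]) (auto simp: max_def)
    then show ?thesis
      using 3 by simp
  qed
qed

text \<open>A continuously differentiable substitute for the truncation of \<open>s\<close> to \<open>[a, b]\<close>, so that the
  chain rule for the mollified functions is elementary.\<close>

definition smooth_step :: "real \<Rightarrow> real \<Rightarrow> real \<Rightarrow> real" where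
  "smooth_step a b s = (max 0 (s - a))^2 - 2 * (max 0 (s - (a + b) / 2))^2 + (max 0 (s - b))^2"

definition smooth_step_deriv :: "real \<Rightarrow> real \<Rightarrow> real \<Rightarrow> real" where
  "smooth_step_deriv a b s = 2 * max 0 (s - a) - 4 * max 0 (s - (a + b) / 2) + 2 * max 0 (s - b)"

lemma DERIV_smooth_step: "(smooth_step a b has_real_derivative smooth_step_deriv a b s) (at s)"
proof -
  have "((\<lambda>s. (max 0 (s - c))^2) has_real_derivative 2 * max 0 (s - c)) (at s)" for c
    using DERIV_chain2[OF DERIV_pos_part_square DERIV_diff[OF DERIV_ident DERIV_const], of c s] by simp
  note this [derivative_intros]
  show ?thesis
    unfolding smooth_step_def[abs_def] smooth_step_deriv_def
    by (rule derivative_eq_intros refl)+ simp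
qed

text \<open>The derivative is the tent over [a, b] with peak b - a at the midpoint, so the total
  rise of the step is (b - a)^2 / 2.\<close>

lemma smooth_step_deriv_bounds:
  assumes "a < b"
  shows "0 \<le> smooth_step_deriv a b s" "smooth_step_deriv a b s \<le> (b - a) * indicator {a<..<b} s"
  using assms by (auto simp: smooth_step_deriv_def max_def indicator_def field_simps)

lemma smooth_step_le: "s \<le> a \<Longrightarrow> a < b \<Longrightarrow> smooth_step a b s = 0"
  by (auto simp: smooth_step_def max_def)

lemma smooth_step_ge: "s \<ge> b \<Longrightarrow> a < b \<Longrightarrow> smooth_step a b s = (b - a)^2 / 2"
  by (auto simp: smooth_step_def max_def power2_eq_square field_simps)

lemma borel_measurable_component:
  fixes f :: "'a \<Rightarrow> real^'n"
  assumes "f \<in> borel_measurable M"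
  shows "(\<lambda>x. f x $ i) \<in> borel_measurable M"
  by (rule measurable_compose[OF assms], rule borel_measurable_continuous_onI)
    (rule linear_continuous_on, rule bounded_linear_vec_nth)

lemma borel_locally_integrable_norm:
  fixes v :: "real^'n \<Rightarrow> real^'n"
  assumes "\<And>i. borel_locally_integrable (\<lambda>x. v x $ i)"
  shows "v \<in> borel_measurable borel" "(\<integral>\<^sup>+x\<in>cball 0 r. norm (v x) \<partial>lborel) < \<infinity>"
proof -
  have [measurable]: "(\<lambda>x. v x $ i) \<in> borel_measurable borel" for i
    using assms by (simp add: borel_locally_integrable_def)
  show "v \<in> borel_measurable borel"
    by (subst borel_measurable_euclidean_space) (auto simp: Basis_vec_def inner_axis)
  have "(\<integral>\<^sup>+x\<in>cball 0 r. norm (v x) \<partial>lborel) \<le> (\<integral>\<^sup>+x. (\<Sum>i\<in>UNIV. ennreal \<bar>v x $ i\<bar> * indicator (cball 0 r) x) \<partial>lborel)"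
    by (intro nn_integral_mono)
      (auto intro!: mult_right_mono ennreal_leI norm_le_l1_cart simp flip: sum_distrib_right)
  also have "\<dots> = (\<Sum>i\<in>UNIV. \<integral>\<^sup>+x\<in>cball 0 r. \<bar>v x $ i\<bar> \<partial>lborel)"
    by (rule nn_integral_sum) simp
  also have "\<dots> < \<infinity>"
    using borel_locally_integrable_nn_integral[OF assms] by (simp add: less_top[symmetric])
  finally show "(\<integral>\<^sup>+x\<in>cball 0 r. norm (v x) \<partial>lborel) < \<infinity>" .
qed

text \<open>The smooth inequality is applied to \<open>smooth_step a b\<close> composed with the
  mollified functions. Along a subsequence converging almost everywhere, Fatou's lemma handles the
  left side and dominated convergence the right. Continuity of the step derivative is essential
  here; the indicator left by a sharp truncation need not converge.\<close>

lemma weak_gradient_poincare: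
  fixes u :: "real^'n \<Rightarrow> real"
  assumes uv: "borel_weak_gradient u v" and "a < b"
    and R: "convex R" "R \<subseteq> cball 0 r" and [measurable]: "R \<in> sets borel"
    and D: "\<And>x y. x \<in> R \<Longrightarrow> y \<in> R \<Longrightarrow> norm (x - y) \<le> D"
  shows "(\<integral>\<^sup>+y\<in>R. (\<integral>\<^sup>+x\<in>R. \<bar>smooth_step a b (u x) - smooth_step a b (u y)\<bar> \<partial>lborel) \<partial>lborel) \<le>
    ennreal D * 2 ^ CARD('n) * emeasure lborel R *
      (\<integral>\<^sup>+z\<in>R. ennreal (smooth_step_deriv a b (u z)) * ennreal (norm (v z)) \<partial>lborel)"
proof -
  define \<sigma> where "\<sigma> = smooth_step a b"
  define \<sigma>' where "\<sigma>' = smooth_step_deriv a b"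
  have \<sigma>_cont: "continuous_on UNIV \<sigma>" and \<sigma>'_cont: "continuous_on UNIV \<sigma>'"
    by (auto simp: \<sigma>_def \<sigma>'_def smooth_step_def[abs_def] smooth_step_deriv_def[abs_def] intro!: continuous_intros)
  have \<sigma>'_bounds: "0 \<le> \<sigma>' s" "\<sigma>' s \<le> b - a" for s
    using smooth_step_deriv_bounds[OF \<open>a < b\<close>, of s] \<open>a < b\<close>
    by (auto simp: \<sigma>'_def indicator_def of_bool_def split: if_splits)
  have uv': "borel_locally_integrable u" "\<And>i. borel_locally_integrable (\<lambda>x. v x $ i)"
    using uv by (auto simp: borel_weak_gradient_def)
  have [measurable]: "u \<in> borel_measurable borel" "v \<in> borel_measurable borel"
    "\<sigma> \<in> borel_measurable borel" "\<sigma>' \<in> borel_measurable borel"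
    using uv' borel_locally_integrable_norm(1)[OF uv'(2)] \<sigma>_cont \<sigma>'_cont
    by (auto simp: borel_locally_integrable_def intro: borel_measurable_continuous_onI)
  obtain w g where w: "\<And>k. continuous_on UNIV (w k)" and g: "\<And>k. continuous_on UNIV (g k)"
    and deriv: "\<And>k y d t. ((\<lambda>t. w k (y + t *\<^sub>R d)) has_real_derivative d \<bullet> g k (y + t *\<^sub>R d)) (at t)"
    and w_lim: "\<And>r. (\<lambda>k. \<integral>\<^sup>+x\<in>cball 0 r. \<bar>w k x - u x\<bar> \<partial>lborel) \<longlonglongrightarrow> 0"
    and g_lim: "\<And>r i. (\<lambda>k. \<integral>\<^sup>+x\<in>cball 0 r. \<bar>g k x $ i - v x $ i\<bar> \<partial>lborel) \<longlonglongrightarrow> 0"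
    using weak_gradient_smooth_approximation[OF uv] by blast
  have [measurable]: "w k \<in> borel_measurable borel" "g k \<in> borel_measurable borel" for k
    using w g by (auto intro: borel_measurable_continuous_onI)
  have [measurable]: "(\<lambda>x. g k x $ i) \<in> borel_measurable borel" "(\<lambda>x. v x $ i) \<in> borel_measurable borel" for k i
    by (intro borel_measurable_component; measurable)+

  have "\<exists>s::nat\<Rightarrow>nat. strict_mono s \<and>
    (AE x in lborel. (\<lambda>k. indicator (cball 0 r) x * (w (s k) x - u x)) \<longlonglongrightarrow> 0)"
  proof (rule tendsto_L1_AE_subseq)
    show "integrable lborel (\<lambda>x. indicator (cball 0 r) x * (w k x - u x))" for k
    proof -
      have "integrable lborel (\<lambda>x. indicator (cball 0 r) x *\<^sub>R w k x)"
        by (rule borel_integrable_compact) (auto intro: continuous_on_subset[OF w])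
      moreover have "integrable lborel (\<lambda>x. indicator (cball 0 r) x * u x)"
        using uv' by (simp add: borel_locally_integrable_def)
      ultimately show ?thesis
        by (simp add: right_diff_distrib)
    qed
    have "(\<integral>x. norm (indicator (cball 0 r) x * (w k x - u x)) \<partial>lborel) =
        enn2real (\<integral>\<^sup>+x\<in>cball 0 r. \<bar>w k x - u x\<bar> \<partial>lborel)" for k
      by (subst integral_eq_nn_integral)
        (auto intro!: arg_cong[where f = enn2real] nn_integral_cong simp: indicator_def)
    moreover have "(\<lambda>k. enn2real (\<integral>\<^sup>+x\<in>cball 0 r. \<bar>w k x - u x\<bar> \<partial>lborel)) \<longlonglongrightarrow> enn2real 0"
      by (rule tendsto_enn2real) (use w_lim in auto)
    ultimately show "(\<lambda>k. \<integral>x. norm (indicator (cball 0 r) x * (w k x - u x)) \<partial>lborel) \<longlonglongrightarrow> 0"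
      by simp
  qed
  then obtain s :: "nat \<Rightarrow> nat" where s: "strict_mono s"
    and AE_cball: "AE x in lborel. (\<lambda>k. indicator (cball 0 r) x * (w (s k) x - u x)) \<longlonglongrightarrow> 0"
    by blast
  have AE_lim: "AE x in lborel. x \<in> R \<longrightarrow> (\<lambda>k. w (s k) x) \<longlonglongrightarrow> u x"
    using AE_cball R(2) by (auto elim!: eventually_mono simp: LIM_zero_iff subset_eq)

  define C where "C = ennreal D * 2 ^ CARD('n) * emeasure lborel R"
  have R_fin: "emeasure lborel R < \<infinity>"
    by (rule emeasure_bounded_finite) (rule bounded_subset[OF bounded_cball R(2)])
  then have C: "C < \<infinity>"
    by (auto simp: C_def ennreal_mult_less_top power_less_top_ennreal)
  define L where "L = (\<lambda>k. \<integral>\<^sup>+y\<in>R. (\<integral>\<^sup>+x\<in>R. \<bar>\<sigma> (w (s k) x) - \<sigma> (w (s k) y)\<bar> \<partial>lborel) \<partial>lborel)"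
  \<comment> \<open>\<open>Y\<close> has the mollified function in the factor \<sigma>' but already
    the limit gradient \<open>v\<close>. Exchanging the gradient costs \<open>Z\<close>, weighted by
    the bound b - a for \<sigma>'.\<close>
  define Y where "Y = (\<lambda>k. \<integral>\<^sup>+z\<in>R. ennreal (\<sigma>' (w (s k) z)) * ennreal (norm (v z)) \<partial>lborel)"
  define Z where "Z = (\<lambda>k. \<Sum>i\<in>UNIV. \<integral>\<^sup>+z\<in>cball 0 r. \<bar>g (s k) z $ i - v z $ i\<bar> \<partial>lborel)"

  have L_le: "L k \<le> C * (Y k + ennreal (b - a) * Z k)" for k
  proof -
    have "L k \<le> ennreal D * 2 ^ DIM(real^'n) * emeasure lborel R *
        (\<integral>\<^sup>+z\<in>R. norm (\<sigma>' (w (s k) z) *\<^sub>R g (s k) z) \<partial>lborel)"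
      unfolding L_def
    proof (rule convex_poincare_smooth[OF _ _ _ R(1)])
      show "continuous_on UNIV (\<lambda>x. \<sigma> (w (s k) x))"
        by (rule continuous_on_compose2[OF \<sigma>_cont w]) auto
      show "continuous_on UNIV (\<lambda>z. \<sigma>' (w (s k) z) *\<^sub>R g (s k) z)"
        by (intro continuous_on_scaleR g continuous_on_compose2[OF \<sigma>'_cont w]) auto
      show "((\<lambda>t. \<sigma> (w (s k) (y + t *\<^sub>R d))) has_real_derivative
        d \<bullet> (\<sigma>' (w (s k) (y + t *\<^sub>R d)) *\<^sub>R g (s k) (y + t *\<^sub>R d))) (at t)" for y d t
        using DERIV_chain2[OF DERIV_smooth_step deriv] by (simp add: \<sigma>_def \<sigma>'_def)
    qed (use D in auto)
    also have "\<dots> = C * (\<integral>\<^sup>+z\<in>R. norm (\<sigma>' (w (s k) z) *\<^sub>R g (s k) z) \<partial>lborel)"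
      by (simp add: C_def)
    also have "(\<integral>\<^sup>+z\<in>R. norm (\<sigma>' (w (s k) z) *\<^sub>R g (s k) z) \<partial>lborel) \<le>
      (\<integral>\<^sup>+z. ennreal (\<sigma>' (w (s k) z)) * ennreal (norm (v z)) * indicator R z +
        ennreal (b - a) * (\<Sum>i\<in>UNIV. ennreal \<bar>g (s k) z $ i - v z $ i\<bar> * indicator (cball 0 r) z) \<partial>lborel)"
    proof (intro nn_integral_mono)
      fix z
      show "ennreal (norm (\<sigma>' (w (s k) z) *\<^sub>R g (s k) z)) * indicator R z \<le>
        ennreal (\<sigma>' (w (s k) z)) * ennreal (norm (v z)) * indicator R z +
        ennreal (b - a) * (\<Sum>i\<in>UNIV. ennreal \<bar>g (s k) z $ i - v z $ i\<bar> * indicator (cball 0 r) z)"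
      proof (cases "z \<in> R")
        case True
        then have "z \<in> cball 0 r"
          using R(2) by auto
        have "norm (g (s k) z) \<le> norm (v z) + norm (g (s k) z - v z)"
          by (simp add: norm_triangle_sub)
        also have "\<dots> \<le> norm (v z) + (\<Sum>i\<in>UNIV. \<bar>g (s k) z $ i - v z $ i\<bar>)"
          using norm_le_l1_cart[of "g (s k) z - v z"] by simp
        finally have "\<sigma>' (w (s k) z) * norm (g (s k) z) \<le>
            \<sigma>' (w (s k) z) * (norm (v z) + (\<Sum>i\<in>UNIV. \<bar>g (s k) z $ i - v z $ i\<bar>))"
          using \<sigma>'_bounds by (intro mult_left_mono)
        also have "\<dots> \<le> \<sigma>' (w (s k) z) * norm (v z) + (b - a) * (\<Sum>i\<in>UNIV. \<bar>g (s k) z $ i - v z $ i\<bar>)"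
          unfolding distrib_left by (intro add_left_mono mult_right_mono \<sigma>'_bounds sum_nonneg) auto
        finally have "ennreal (\<sigma>' (w (s k) z) * norm (g (s k) z)) \<le>
            ennreal (\<sigma>' (w (s k) z) * norm (v z) + (b - a) * (\<Sum>i\<in>UNIV. \<bar>g (s k) z $ i - v z $ i\<bar>))"
          by (rule ennreal_leI)
        also have "\<dots> = ennreal (\<sigma>' (w (s k) z)) * ennreal (norm (v z)) +
            ennreal (b - a) * (\<Sum>i\<in>UNIV. ennreal \<bar>g (s k) z $ i - v z $ i\<bar>)"
          using \<sigma>'_bounds \<open>a < b\<close> by (simp add: ennreal_plus ennreal_mult sum_nonneg sum_ennreal)
        finally show ?thesis
          using True \<open>z \<in> cball 0 r\<close> \<sigma>'_bounds(1) by (simp add: abs_mult)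
      qed simp
    qed
    also have "\<dots> = Y k + ennreal (b - a) * Z k"
    proof -
      have "(\<integral>\<^sup>+z. ennreal (b - a) * (\<Sum>i\<in>UNIV. ennreal \<bar>g (s k) z $ i - v z $ i\<bar> * indicator (cball 0 r) z) \<partial>lborel) =
          ennreal (b - a) * Z k"
        unfolding Z_def
        by (subst nn_integral_sum[symmetric]) (simp, rule nn_integral_cmult, measurable)
      note eq = this[symmetric]
      show ?thesis
        unfolding Y_def eq by (rule nn_integral_add) measurable
    qed
    finally show ?thesis
      by (simp add: mult_left_mono)
  qed

  have "Y \<longlonglongrightarrow> (\<integral>\<^sup>+z\<in>R. ennreal (\<sigma>' (u z)) * ennreal (norm (v z)) \<partial>lborel)"
    unfolding Y_def
  proof (rule nn_integral_dominated_convergence[where w = "\<lambda>z. ennreal (b - a) * (ennreal (norm (v z)) * indicator (cball 0 r) z)"])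
    show "AE z in lborel. ennreal (\<sigma>' (w (s k) z)) * ennreal (norm (v z)) * indicator R z \<le>
        ennreal (b - a) * (ennreal (norm (v z)) * indicator (cball 0 r) z)" for k
      using R(2) \<sigma>'_bounds(2)
      by (intro AE_I2) (auto simp: indicator_def intro!: mult_right_mono ennreal_leI)
    show "(\<integral>\<^sup>+z. ennreal (b - a) * (ennreal (norm (v z)) * indicator (cball 0 r) z) \<partial>lborel) < \<infinity>"
      using borel_locally_integrable_norm(2)[OF uv'(2), of r]
      by (subst nn_integral_cmult) (auto simp: ennreal_mult_less_top)
    show "AE z in lborel. (\<lambda>k. ennreal (\<sigma>' (w (s k) z)) * ennreal (norm (v z)) * indicator R z) \<longlonglongrightarrow>
        ennreal (\<sigma>' (u z)) * ennreal (norm (v z)) * indicator R z"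
      using AE_lim
    proof eventually_elim
      case (elim z)
      show ?case
      proof (cases "z \<in> R")
        case True
        then have "(\<lambda>k. \<sigma>' (w (s k) z)) \<longlonglongrightarrow> \<sigma>' (u z)"
          using elim by (intro continuous_on_tendsto_compose[OF \<sigma>'_cont]) auto
        then have "(\<lambda>k. ennreal (\<sigma>' (w (s k) z) * norm (v z))) \<longlonglongrightarrow> ennreal (\<sigma>' (u z) * norm (v z))"
          by (intro tendsto_ennrealI tendsto_intros)
        then show ?thesis
          using True \<sigma>'_bounds(1) by (simp add: ennreal_mult)
      qed simp
    qed
  qed measurable
  moreover have "Z \<longlonglongrightarrow> (\<Sum>i\<in>(UNIV::'n set). 0)"
    unfolding Z_def
    by (intro tendsto_sum LIMSEQ_subseq_LIMSEQ[OF g_lim s, unfolded o_def])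
  ultimately have "(\<lambda>k. C * (Y k + ennreal (b - a) * Z k)) \<longlonglongrightarrow>
      C * ((\<integral>\<^sup>+z\<in>R. ennreal (\<sigma>' (u z)) * ennreal (norm (v z)) \<partial>lborel) + ennreal (b - a) * (\<Sum>i\<in>(UNIV::'n set). 0))"
    using C by (intro ennreal_tendsto_cmult tendsto_add) auto
  then have lim: "liminf (\<lambda>k. C * (Y k + ennreal (b - a) * Z k)) =
      C * (\<integral>\<^sup>+z\<in>R. ennreal (\<sigma>' (u z)) * ennreal (norm (v z)) \<partial>lborel)"
    by (simp add: lim_imp_Liminf)

  \<comment> \<open>Fatou's lemma is needed twice, here for the inner integral in x and afterwards
    for the outer one in y.\<close>
  have inner: "AE y in lborel. (\<integral>\<^sup>+x\<in>R. \<bar>\<sigma> (u x) - \<sigma> (u y)\<bar> \<partial>lborel) * indicator R y \<le>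
      liminf (\<lambda>k. (\<integral>\<^sup>+x\<in>R. \<bar>\<sigma> (w (s k) x) - \<sigma> (w (s k) y)\<bar> \<partial>lborel) * indicator R y)"
    using AE_lim
  proof eventually_elim
    case (elim y)
    show ?case
    proof (cases "y \<in> R")
      case True
      have "AE x in lborel. ennreal \<bar>\<sigma> (u x) - \<sigma> (u y)\<bar> * indicator R x =
          liminf (\<lambda>k. ennreal \<bar>\<sigma> (w (s k) x) - \<sigma> (w (s k) y)\<bar> * indicator R x)"
        using AE_lim
      proof eventually_elim
        case x: (elim x)
        show ?case
        proof (cases "x \<in> R")
          case True
          have "(\<lambda>k. ennreal \<bar>\<sigma> (w (s k) x) - \<sigma> (w (s k) y)\<bar>) \<longlonglongrightarrow> ennreal \<bar>\<sigma> (u x) - \<sigma> (u y)\<bar>"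
            using x elim \<open>x \<in> R\<close> \<open>y \<in> R\<close>
            by (intro tendsto_ennrealI tendsto_rabs tendsto_diff continuous_on_tendsto_compose[OF \<sigma>_cont]) auto
          from lim_imp_Liminf[OF _ this] show ?thesis
            using True by simp
        qed (simp add: Liminf_const)
      qed
      then have "(\<integral>\<^sup>+x\<in>R. \<bar>\<sigma> (u x) - \<sigma> (u y)\<bar> \<partial>lborel) =
          (\<integral>\<^sup>+x. liminf (\<lambda>k. ennreal \<bar>\<sigma> (w (s k) x) - \<sigma> (w (s k) y)\<bar> * indicator R x) \<partial>lborel)"
        by (rule nn_integral_cong_AE)
      also have "\<dots> \<le> liminf (\<lambda>k. \<integral>\<^sup>+x\<in>R. \<bar>\<sigma> (w (s k) x) - \<sigma> (w (s k) y)\<bar> \<partial>lborel)"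
        by (rule nn_integral_liminf) simp
      finally show ?thesis
        using True by simp
    qed simp
  qed
  have "(\<integral>\<^sup>+y\<in>R. (\<integral>\<^sup>+x\<in>R. \<bar>\<sigma> (u x) - \<sigma> (u y)\<bar> \<partial>lborel) \<partial>lborel) \<le>
      (\<integral>\<^sup>+y. liminf (\<lambda>k. (\<integral>\<^sup>+x\<in>R. \<bar>\<sigma> (w (s k) x) - \<sigma> (w (s k) y)\<bar> \<partial>lborel) * indicator R y) \<partial>lborel)"
    by (rule nn_integral_mono_AE) (rule inner)
  also have "\<dots> \<le> liminf L"
    unfolding L_def by (rule nn_integral_liminf) measurable
  also have "\<dots> \<le> liminf (\<lambda>k. C * (Y k + ennreal (b - a) * Z k))"
    by (intro Liminf_mono always_eventually allI L_le)
  finally show ?thesis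
    unfolding lim by (simp add: C_def \<sigma>_def \<sigma>'_def)
qed

text \<open>For u y \<le> a and u x \<ge> b the steps differ by their full rise (b - a)^2 / 2, while
  the step derivative is at most b - a and lives on values in (a, b). One factor b - a
  cancels.\<close>

lemma level_set_poincare:
  fixes u :: "real^'n \<Rightarrow> real"
  assumes uv: "borel_weak_gradient u v" and "a < b"
    and R: "convex R" "R \<subseteq> cball 0 r" and [measurable]: "R \<in> sets borel"
    and D: "\<And>x y. x \<in> R \<Longrightarrow> y \<in> R \<Longrightarrow> norm (x - y) \<le> D"
  shows "ennreal ((b - a) / 2) * emeasure lborel {x \<in> R. u x \<ge> b} * emeasure lborel {x \<in> R. u x \<le> a} \<le>
    ennreal D * 2 ^ CARD('n) * emeasure lborel R *
      (\<integral>\<^sup>+z\<in>R. ennreal (norm (v z) * indicator {a<..<b} (u z)) \<partial>lborel)"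
proof -
  have [measurable]: "u \<in> borel_measurable borel" "v \<in> borel_measurable borel"
    using uv borel_locally_integrable_norm(1)[of v]
    by (auto simp: borel_weak_gradient_def borel_locally_integrable_def)
  let ?A = "{x \<in> R. u x \<le> a}" and ?B = "{x \<in> R. u x \<ge> b}"
  let ?I = "\<integral>\<^sup>+z\<in>R. ennreal (norm (v z) * indicator {a<..<b} (u z)) \<partial>lborel"
  have meas [measurable]: "?A \<in> sets borel" "?B \<in> sets borel"
    by measurable
  have "ennreal ((b - a)^2 / 2) * emeasure lborel ?B * emeasure lborel ?A =
    (\<integral>\<^sup>+y. (\<integral>\<^sup>+x. ennreal ((b - a)^2 / 2) * indicator ?B x \<partial>lborel) * indicator ?A y \<partial>lborel)"
    by (simp add: nn_integral_cmult_indicator)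
  also have "\<dots> \<le> (\<integral>\<^sup>+y\<in>R. (\<integral>\<^sup>+x\<in>R. \<bar>smooth_step a b (u x) - smooth_step a b (u y)\<bar> \<partial>lborel) \<partial>lborel)"
  proof (intro nn_integral_mono)
    fix y
    show "(\<integral>\<^sup>+x. ennreal ((b - a)^2 / 2) * indicator ?B x \<partial>lborel) * indicator ?A y \<le>
      (\<integral>\<^sup>+x\<in>R. \<bar>smooth_step a b (u x) - smooth_step a b (u y)\<bar> \<partial>lborel) * indicator R y"
    proof (cases "y \<in> ?A")
      case True
      have "(\<integral>\<^sup>+x. ennreal ((b - a)^2 / 2) * indicator ?B x \<partial>lborel) \<le>
          (\<integral>\<^sup>+x\<in>R. \<bar>smooth_step a b (u x) - smooth_step a b (u y)\<bar> \<partial>lborel)"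
        using True \<open>a < b\<close>
        by (intro nn_integral_mono) (auto simp: indicator_def smooth_step_le smooth_step_ge)
      then show ?thesis
        using True by simp
    qed simp
  qed
  also have "\<dots> \<le> ennreal D * 2 ^ CARD('n) * emeasure lborel R *
      (\<integral>\<^sup>+z\<in>R. ennreal (smooth_step_deriv a b (u z)) * ennreal (norm (v z)) \<partial>lborel)"
    by (rule weak_gradient_poincare[OF uv \<open>a < b\<close> R _ D]) auto
  also have "(\<integral>\<^sup>+z\<in>R. ennreal (smooth_step_deriv a b (u z)) * ennreal (norm (v z)) \<partial>lborel) \<le>
      (\<integral>\<^sup>+z. ennreal (b - a) * (ennreal (norm (v z) * indicator {a<..<b} (u z)) * indicator R z) \<partial>lborel)"
  proof (intro nn_integral_mono)
    fix z
    have "smooth_step_deriv a b (u z) * norm (v z) \<le> (b - a) * indicator {a<..<b} (u z) * norm (v z)"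
      using smooth_step_deriv_bounds[OF \<open>a < b\<close>] by (intro mult_right_mono) auto
    then have "ennreal (smooth_step_deriv a b (u z) * norm (v z)) \<le> ennreal ((b - a) * (norm (v z) * indicator {a<..<b} (u z)))"
      by (intro ennreal_leI) (simp add: mult_ac)
    then show "ennreal (smooth_step_deriv a b (u z)) * ennreal (norm (v z)) * indicator R z \<le>
      ennreal (b - a) * (ennreal (norm (v z) * indicator {a<..<b} (u z)) * indicator R z)"
      using smooth_step_deriv_bounds[OF \<open>a < b\<close>] \<open>a < b\<close>
      by (auto simp: indicator_def ennreal_mult split: if_splits)
  qed
  also have "\<dots> = ennreal (b - a) * ?I"
    by (rule nn_integral_cmult) measurable
  finally have "ennreal ((b - a)^2 / 2) * emeasure lborel ?B * emeasure lborel ?A \<le>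
      ennreal D * 2 ^ CARD('n) * emeasure lborel R * (ennreal (b - a) * ?I)"
    by (simp add: mult_left_mono)
  moreover have "ennreal ((b - a)^2 / 2) = ennreal (b - a) * ennreal ((b - a) / 2)"
    using \<open>a < b\<close> by (simp add: power2_eq_square flip: ennreal_mult)
  ultimately have "ennreal (b - a) * (ennreal ((b - a) / 2) * emeasure lborel ?B * emeasure lborel ?A) \<le>
      ennreal (b - a) * (ennreal D * 2 ^ CARD('n) * emeasure lborel R * ?I)"
    by (simp add: mult_ac)
  then show ?thesis
    using \<open>a < b\<close> by (subst (asm) ennreal_mult_le_mult_iff) auto
qed

section \<open>Dyadic cells and level jumps\<close>

text \<open>Floors give half-open cells, which partition the space at each scale. The integer vector
  names the cell, so a pair of a scale and a vector ranges over a countable type.\<close>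

definition dyadic_index :: "nat \<Rightarrow> real^'n \<Rightarrow> int^'n" where
  "dyadic_index j x = (\<chi> i. \<lfloor>2 ^ j * x $ i\<rfloor>)"

definition dyadic_corner :: "nat \<Rightarrow> int^'n \<Rightarrow> real^'n" where
  "dyadic_corner j k = (\<chi> i. of_int (k $ i) / 2 ^ j)"

definition dyadic_cell :: "nat \<Rightarrow> real^'n \<Rightarrow> (real^'n) set" where
  "dyadic_cell j x = {y. dyadic_index j y = dyadic_index j x}"

lemma dyadic_index_corner [simp]: "dyadic_index j (dyadic_corner j k) = k"
  by (simp add: dyadic_index_def dyadic_corner_def vec_eq_iff)

lemma self_in_dyadic_cell [simp]: "x \<in> dyadic_cell j x"
  by (simp add: dyadic_cell_def)

lemma dyadic_index_coarser:
  assumes "dyadic_index j x = dyadic_index j y" "i \<le> j"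
  shows "dyadic_index i x = dyadic_index i y"
proof -
  have "\<lfloor>2 ^ i * s\<rfloor> = \<lfloor>2 ^ j * s\<rfloor> div 2 ^ (j - i)" for s :: real
  proof -
    have "2 ^ i * s = (2 ^ j * s) / real_of_int (2 ^ (j - i))"
      using \<open>i \<le> j\<close> power_add[of "2::real" i "j - i"] by simp
    then show ?thesis
      by (simp only:) (rule floor_divide_real_eq_div, simp)
  qed
  then show ?thesis
    using assms(1) by (simp add: dyadic_index_def vec_eq_iff)
qed

lemma mem_dyadic_cell_iff:
  "y \<in> dyadic_cell j x \<longleftrightarrow>
    (\<forall>i. of_int (dyadic_index j x $ i) \<le> 2 ^ j * y $ i \<and> 2 ^ j * y $ i < of_int (dyadic_index j x $ i) + 1)"
  by (auto simp: dyadic_cell_def dyadic_index_def vec_eq_iff floor_eq_iff)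

lemma convex_dyadic_cell: "convex (dyadic_cell j x)"
proof -
  have "dyadic_cell j x = (\<Inter>i. {y. (2 ^ j *\<^sub>R axis i 1) \<bullet> y \<ge> of_int (dyadic_index j x $ i)} \<inter>
      {y. (2 ^ j *\<^sub>R axis i 1) \<bullet> y < of_int (dyadic_index j x $ i) + 1})"
    by (auto simp: mem_dyadic_cell_iff  inner_axis')
  then show ?thesis
    by (simp only:) (intro convex_INT convex_Int convex_halfspace_ge convex_halfspace_lt)
qed

lemma dyadic_cell_sandwich:
  defines "a \<equiv> \<lambda>j x. dyadic_corner j (dyadic_index j x)"
  defines "b \<equiv> \<lambda>j x. \<chi> i. (of_int (dyadic_index j x $ i) + 1) / 2 ^ j"
  shows "box (a j x) (b j x) \<subseteq> dyadic_cell j x" "dyadic_cell j x \<subseteq> cbox (a j x) (b j x)"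
  by (auto simp: mem_dyadic_cell_iff a_def b_def dyadic_corner_def mem_box_cart field_simps less_imp_le)

lemma dyadic_cell_sets [measurable]: "dyadic_cell j x \<in> sets borel"
proof -
  have "dyadic_cell j x = {y \<in> space borel. \<forall>i. of_int (dyadic_index j x $ i) \<le> 2 ^ j * y $ i \<and>
      2 ^ j * y $ i < of_int (dyadic_index j x $ i) + 1}"
    by (auto simp: mem_dyadic_cell_iff)
  moreover have [measurable]: "(\<lambda>y::real^'n. y $ i) \<in> borel_measurable borel" for i
    by (rule borel_measurable_component) simp
  ultimately show ?thesis
    by (simp only:) measurable
qed

lemma emeasure_dyadic_cell: "emeasure lborel (dyadic_cell j x) = ennreal ((1 / 2) ^ (j * CARD('n)))"
  for x :: "real^'n"
proof -
  define a where "a = dyadic_corner j (dyadic_index j x)"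
  define b :: "real^'n" where "b = (\<chi> i. (of_int (dyadic_index j x $ i) + 1) / 2 ^ j)"
  have diff: "(b - a) \<bullet> e = 1 / 2 ^ j" if "e \<in> Basis" for e
    using that by (auto simp: Basis_vec_def inner_axis a_def b_def dyadic_corner_def field_simps)
  then have le: "a \<bullet> e \<le> b \<bullet> e" if "e \<in> Basis" for e
    using that by (metis inner_diff_left diff_ge_0_iff_ge zero_le_divide_1_iff zero_le_power zero_le_numeral)
  have "(\<Prod>e\<in>Basis. (b - a) \<bullet> e) = (\<Prod>e\<in>(Basis :: (real^'n) set). 1 / 2 ^ j)"
    by (rule prod.cong) (auto simp: diff)
  also have "\<dots> = (1 / 2) ^ (j * CARD('n))"
    by (simp add: power_mult power_one_over)
  finally have vol: "(\<Prod>e\<in>Basis. (b - a) \<bullet> e) = (1 / 2) ^ (j * CARD('n))" .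
  have "emeasure lborel (box a b) \<le> emeasure lborel (dyadic_cell j x)"
    using dyadic_cell_sandwich(1)[of j x] by (intro emeasure_mono) (auto simp: a_def b_def)
  moreover have "emeasure lborel (dyadic_cell j x) \<le> emeasure lborel (cbox a b)"
    using dyadic_cell_sandwich(2)[of j x] by (intro emeasure_mono) (auto simp: a_def b_def)
  ultimately show ?thesis
    using le by (simp add: vol)
qed

text \<open>The crude bound by the sum of the coordinates suffices. It is strict because cells are
  half-open, and strictness places a cell inside the open ball of radius n / 2^j about any of its
  points.\<close>

lemma norm_diff_dyadic_cell:
  fixes x :: "real^'n"
  assumes "y \<in> dyadic_cell j x" "z \<in> dyadic_cell j x"
  shows "norm (y - z) < CARD('n) / 2 ^ j"
proof -
  have "\<bar>y $ i - z $ i\<bar> < 1 / 2 ^ j" for i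
  proof -
    have "\<bar>2 ^ j * y $ i - 2 ^ j * z $ i\<bar> < 1"
      using assms[unfolded mem_dyadic_cell_iff, rule_format, of i] by linarith
    also have "\<bar>2 ^ j * y $ i - 2 ^ j * z $ i\<bar> = 2 ^ j * \<bar>y $ i - z $ i\<bar>"
      by (simp add: abs_mult flip: right_diff_distrib)
    finally show ?thesis
      by (simp add: field_simps)
  qed
  then have "(\<Sum>i\<in>UNIV. \<bar>(y - z) $ i\<bar>) < (\<Sum>i\<in>(UNIV::'n set). 1 / 2 ^ j)"
    by (intro sum_strict_mono) auto
  then show ?thesis
    using norm_le_l1_cart[of "y - z"] by simp
qed

lemma dyadic_cell_subset_cball:
  obtains r where "dyadic_cell j x \<subseteq> cball 0 r"
proof (rule that[of "norm x + CARD('a) / 2 ^ j"])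
  show "dyadic_cell j x \<subseteq> cball 0 (norm x + CARD('a) / 2 ^ j)"
  proof
    fix y assume "y \<in> dyadic_cell j x"
    then have "norm (y - x) < CARD('a) / 2 ^ j"
      by (rule norm_diff_dyadic_cell) simp
    then show "y \<in> cball 0 (norm x + CARD('a) / 2 ^ j)"
      using norm_triangle_sub[of y x] by simp
  qed
qed

text \<open>The density threshold is so small that a cell which is not dense at level \<open>t\<close> has children
  in which \<open>{u \<ge> t}\<close> occupies at most half of the volume.\<close>

definition dense_at :: "(real^'n \<Rightarrow> real) \<Rightarrow> nat \<Rightarrow> real^'n \<Rightarrow> real \<Rightarrow> bool" where
  "dense_at u j x t \<longleftrightarrow> ennreal ((1 / 2) ^ (CARD('n) + 1)) * emeasure lborel (dyadic_cell j x) \<le>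
     emeasure lborel {y \<in> dyadic_cell j x. u y \<ge> t}"

text \<open>This is the running maximum. Because of \<open>i < m\<close> it looks at cells coarser
  than scale m only, so the jump caused by the cell at scale j runs from \<open>level u j0 j\<close>
  to \<open>level u j0 (Suc j)\<close>. Inserting 1/2 provides the starting value and a non-empty
  set.\<close>

definition level :: "(real^'n \<Rightarrow> real) \<Rightarrow> nat \<Rightarrow> nat \<Rightarrow> real^'n \<Rightarrow> real" where
  "level u j0 m x = Sup (insert (1 / 2) {t. 1 / 2 \<le> t \<and> t \<le> 1 \<and> (\<exists>i. j0 \<le> i \<and> i < m \<and> dense_at u i x t)})"

lemma dense_at_antimono:
  assumes [measurable]: "u \<in> borel_measurable borel" and "dense_at u j x t" "s \<le> t"
  shows "dense_at u j x s"
proof -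
  have "emeasure lborel {y \<in> dyadic_cell j x. u y \<ge> t} \<le> emeasure lborel {y \<in> dyadic_cell j x. u y \<ge> s}"
    using \<open>s \<le> t\<close> by (intro emeasure_mono) auto
  then show ?thesis
    using assms(2) unfolding dense_at_def by (rule order_trans[rotated])
qed

lemma level_bdd_above:
  "bdd_above (insert (1 / 2) {t::real. 1 / 2 \<le> t \<and> t \<le> 1 \<and> P t})"
  by (rule bdd_aboveI[of _ 1]) auto

lemma level_start [simp]: "level u j0 j0 x = 1 / 2"
proof -
  have "{t. 1 / 2 \<le> t \<and> t \<le> 1 \<and> (\<exists>i. j0 \<le> i \<and> i < j0 \<and> dense_at u i x t)} = {}"
    by auto
  then show ?thesis
    unfolding level_def by (simp only: cSup_singleton)
qed

lemma level_mono: "m \<le> m' \<Longrightarrow> level u j0 m x \<le> level u j0 m' x"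
  unfolding level_def by (intro cSup_subset_mono level_bdd_above) auto

lemma level_bounds: "1 / 2 \<le> level u j0 m x" "level u j0 m x \<le> 1"
proof -
  show "1 / 2 \<le> level u j0 m x"
    unfolding level_def by (intro cSup_upper level_bdd_above) simp
  show "level u j0 m x \<le> 1"
    unfolding level_def by (rule cSup_least) auto
qed

lemma level_ge:
  assumes "dense_at u i x t" "1 / 2 \<le> t" "t \<le> 1" "j0 \<le> i" "i < m"
  shows "t \<le> level u j0 m x"
  unfolding level_def by (intro cSup_upper level_bdd_above) (use assms in auto)

text \<open>With m up to \<open>Suc j\<close>, both ends of the jump at scale j are constant on the
  cell: jumps belong to cells, not to points.\<close>

lemma level_cong:
  assumes "dyadic_index j x = dyadic_index j y" "m \<le> Suc j"
  shows "level u j0 m x = level u j0 m y"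
proof -
  have "dense_at u i x t = dense_at u i y t" if "i < m" for i t
    using dyadic_index_coarser[OF assms(1), of i] that assms(2) by (simp add: dense_at_def dyadic_cell_def)
  then show ?thesis
    unfolding level_def by (intro arg_cong[where f = Sup]) auto
qed

text \<open>Some s > t is attained by a dense cell of scale at most j. Were its scale below j,
  \<open>level u j0 j\<close> would already be at least s; so the cell at scale j itself is dense at
  s, and hence at t.\<close>

lemma dense_below_level:
  assumes u: "u \<in> borel_measurable borel" and "level u j0 j x < t" "t < level u j0 (Suc j) x"
  shows "dense_at u j x t"
proof -
  obtain s where s: "s \<in> insert (1 / 2) {t. 1 / 2 \<le> t \<and> t \<le> 1 \<and> (\<exists>i. j0 \<le> i \<and> i < Suc j \<and> dense_at u i x t)}" "t < s"
    using assms(3) unfolding level_def by (rule less_cSupE) auto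
  have "s > 1 / 2"
    using level_bounds(1)[of u j0 j x] assms(2) s(2) by linarith
  then obtain i where i: "s \<le> 1" "j0 \<le> i" "i < Suc j" "dense_at u i x s"
    using s(1) by auto
  have "\<not> i < j"
    using level_ge[OF i(4) _ i(1) i(2), of j] \<open>s > 1 / 2\<close> s(2) assms(2) by linarith
  then have "dense_at u j x s"
    using i by (metis not_less_less_Suc_eq)
  then show ?thesis
    by (rule dense_at_antimono[OF u]) (use s in simp)
qed

text \<open>At the first scale this is the global smallness of {u \<ge> 1/2}. Later the parent cell
  is not dense at t, and 2^(-(n+1)) times the volume of the parent is half the volume of the
  child.\<close>

lemma sparse_above_level:
  fixes u :: "real^'n \<Rightarrow> real"
  assumes [measurable]: "u \<in> borel_measurable borel"
    and small: "emeasure lborel {y. u y \<ge> 1 / 2} \<le> ennreal ((1 / 2) ^ (j0 * CARD('n) + 1))"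
    and t: "level u j0 j x < t" "t \<le> 1" and "j0 \<le> j"
  shows "emeasure lborel {y \<in> dyadic_cell j x. u y \<ge> t} \<le> ennreal ((1 / 2) ^ (j * CARD('n) + 1))"
proof (cases "j = j0")
  case True
  have "t \<ge> 1 / 2"
    using level_bounds(1)[of u j0 j x] t by linarith
  then have "emeasure lborel {y \<in> dyadic_cell j x. u y \<ge> t} \<le> emeasure lborel {y. u y \<ge> 1 / 2}"
    by (intro emeasure_mono) auto
  then show ?thesis
    using small True by (auto intro: order_trans)
next
  case False
  then obtain i where i: "j = Suc i" "j0 \<le> i"
    using \<open>j0 \<le> j\<close> by (cases j) auto
  have "t \<ge> 1 / 2"
    using level_bounds(1)[of u j0 j x] t by linarith
  then have "\<not> dense_at u i x t"
    using level_ge[of u i x t j0 j] i t by fastforce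
  then have "emeasure lborel {y \<in> dyadic_cell i x. u y \<ge> t} \<le>
      ennreal ((1 / 2) ^ (CARD('n) + 1)) * emeasure lborel (dyadic_cell i x)"
    by (simp add: dense_at_def)
  also have "\<dots> = ennreal ((1 / 2) ^ (j * CARD('n) + 1))"
    unfolding emeasure_dyadic_cell i by (simp add: power_add ennreal_mult[symmetric] algebra_simps)
  finally have "emeasure lborel {y \<in> dyadic_cell i x. u y \<ge> t} \<le> ennreal ((1 / 2) ^ (j * CARD('n) + 1))" .
  moreover have "emeasure lborel {y \<in> dyadic_cell j x. u y \<ge> t} \<le> emeasure lborel {y \<in> dyadic_cell i x. u y \<ge> t}"
  proof (rule emeasure_mono)
    show "{y \<in> dyadic_cell j x. u y \<ge> t} \<subseteq> {y \<in> dyadic_cell i x. u y \<ge> t}"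
      using i by (auto simp: dyadic_cell_def intro: dyadic_index_coarser)
  qed simp
  ultimately show ?thesis
    by (rule order_trans[rotated])
qed

text \<open>A sufficiently fine cell around \<open>x\<close> lies in \<open>U\<close>, where u \<ge>
  1 almost everywhere, so it is dense at 1. The scale may depend on \<open>x\<close>.\<close>

lemma level_eq_1:
  fixes u :: "real^'n \<Rightarrow> real"
  assumes [measurable]: "u \<in> borel_measurable borel" and U: "open U" "x \<in> U" "AE y in lborel. y \<in> U \<longrightarrow> u y \<ge> 1"
  obtains m where "j0 \<le> m" "level u j0 m x = 1"
proof -
  obtain e where e: "e > 0" "ball x e \<subseteq> U"
    using U openE by blast
  have "(\<lambda>j. CARD('n) * (1 / 2) ^ j) \<longlonglongrightarrow> real CARD('n) * 0"
    by (intro tendsto_intros LIMSEQ_power_zero) auto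
  then have "\<forall>\<^sub>F j in sequentially. CARD('n) * (1 / 2) ^ j < e"
    using e(1) by (intro order_tendstoD) auto
  then obtain N where N: "\<And>j. j \<ge> N \<Longrightarrow> CARD('n) * (1 / 2) ^ j < e"
    by (auto simp: eventually_sequentially)
  define j where "j = max N j0"
  have sub: "dyadic_cell j x \<subseteq> U"
  proof
    fix y assume "y \<in> dyadic_cell j x"
    then have "norm (x - y) < CARD('n) / 2 ^ j"
      using norm_diff_dyadic_cell[of x j x y] by simp
    also have "\<dots> < e"
      using N[of j] by (simp add: j_def power_one_over field_simps)
    finally show "y \<in> U"
      using e by (auto simp: dist_norm)
  qed
  have "emeasure lborel {y \<in> dyadic_cell j x. u y \<ge> 1} = emeasure lborel (dyadic_cell j x)"
    using U(3) sub by (intro emeasure_eq_AE) (auto elim!: eventually_mono)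
  moreover have "ennreal ((1 / 2) ^ (CARD('n) + 1)) * emeasure lborel (dyadic_cell j x) \<le> 1 * emeasure lborel (dyadic_cell j x)"
    using power_le_one[of "1 / 2 :: real" "CARD('n) + 1"]
    by (intro mult_right_mono) (auto simp: ennreal_le_1 simp del: power_Suc)
  ultimately have "dense_at u j x 1"
    by (simp add: dense_at_def)
  then have "1 \<le> level u j0 (Suc j) x"
    by (rule level_ge) (auto simp: j_def)
  then show thesis
    using level_bounds(2)[of u j0 "Suc j" x] by (intro that[of "Suc j"]) (auto simp: j_def)
qed

text \<open>The factor n comes from the cell diameter and 2^n from averaging over segments; 2^(n+1)
  undoes the density threshold. The remaining 2^3 pays for the 1/2 in
  \<open>level_set_poincare\<close>, for using only the middle half of the jump, and for the half
  volume below the jump.\<close>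

definition poincare_const :: "nat \<Rightarrow> real" where
  "poincare_const n = real n * 2 ^ (2 * n + 4)"

text \<open>Inside the jump the cell is dense at the higher values and at most half filled at the
  lower ones, so both level sets in \<open>level_set_poincare\<close> have volume comparable to that
  of the cell.\<close>

lemma level_jump_energy:
  fixes u :: "real^'n \<Rightarrow> real" and x :: "real^'n"
  assumes uv: "borel_weak_gradient u v"
    and small: "emeasure lborel {y. u y \<ge> 1 / 2} \<le> ennreal ((1 / 2) ^ (j0 * CARD('n) + 1))"
    and "j0 \<le> j"
  defines "G \<equiv> level u j0 j x" and "g \<equiv> level u j0 (Suc j) x"
  assumes "G < g"
  shows "ennreal ((g - G) * 2 ^ j * (1 / 2) ^ (j * CARD('n))) \<le> ennreal (poincare_const CARD('n)) *
    (\<integral>\<^sup>+y\<in>dyadic_cell j x. ennreal (norm (v y) * indicator {G<..<g} (u y)) \<partial>lborel)"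
proof -
  have u [measurable]: "u \<in> borel_measurable borel" and [measurable]: "v \<in> borel_measurable borel"
    using uv borel_locally_integrable_norm(1)[of v]
    by (auto simp: borel_weak_gradient_def borel_locally_integrable_def)
  define n where "n = CARD('n)"
  define q :: real where "q = (1 / 2) ^ (j * n)"
  \<comment> \<open>The quarter points lie strictly inside the jump, as sparsity is known only
    strictly above \<open>G\<close> and density only strictly below \<open>g\<close>.\<close>
  define a where "a = G + (g - G) / 4"
  define b where "b = g - (g - G) / 4"
  have ab: "G < a" "a < b" "b < g" "b - a = (g - G) / 2"
    using \<open>G < g\<close> by (auto simp: a_def b_def field_simps)
  let ?Q = "dyadic_cell j x"
  let ?I = "\<lambda>a b. \<integral>\<^sup>+y\<in>?Q. ennreal (norm (v y) * indicator {a<..<b} (u y)) \<partial>lborel"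
  have Q: "emeasure lborel ?Q = ennreal q"
    by (simp add: emeasure_dyadic_cell q_def n_def)
  have "q > 0"
    by (simp add: q_def)
  have B: "ennreal ((1 / 2) ^ (n + 1) * q) \<le> emeasure lborel {y \<in> ?Q. u y \<ge> b}"
    using dense_below_level[OF u, of j0 j x b] ab \<open>q > 0\<close>
    unfolding dense_at_def Q n_def[symmetric] by (subst ennreal_mult) (auto simp: G_def g_def)
  have "ennreal (q / 2) + emeasure lborel {y \<in> ?Q. u y \<le> a} \<ge> ennreal q"
  proof -
    have "g \<le> 1"
      using level_bounds by (simp add: g_def)
    then have "emeasure lborel {y \<in> ?Q. u y \<ge> a} \<le> ennreal ((1 / 2) ^ (j * CARD('n) + 1))"
      using sparse_above_level[OF u small, of j x a] ab \<open>j0 \<le> j\<close> by (simp add: G_def)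
    then have "emeasure lborel {y \<in> ?Q. u y \<ge> a} \<le> ennreal (q / 2)"
      by (simp add: q_def n_def)
    moreover have "emeasure lborel ?Q \<le> emeasure lborel ({y \<in> ?Q. u y \<ge> a} \<union> {y \<in> ?Q. u y \<le> a})"
      by (rule emeasure_mono) auto
    moreover have "emeasure lborel ({y \<in> ?Q. u y \<ge> a} \<union> {y \<in> ?Q. u y \<le> a}) \<le>
        emeasure lborel {y \<in> ?Q. u y \<ge> a} + emeasure lborel {y \<in> ?Q. u y \<le> a}"
      by (rule emeasure_subadditive) auto
    ultimately show ?thesis
      unfolding Q by (meson add_right_mono order_trans)
  qed
  moreover have "ennreal q = ennreal (q / 2) + ennreal (q / 2)"
    using \<open>q > 0\<close> by (simp flip: ennreal_plus)
  ultimately have A: "ennreal (q / 2) \<le> emeasure lborel {y \<in> ?Q. u y \<le> a}"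
    by simp
  obtain r where r: "?Q \<subseteq> cball 0 r"
    by (rule dyadic_cell_subset_cball)
  have "ennreal ((b - a) / 2) * ennreal ((1 / 2) ^ (n + 1) * q) * ennreal (q / 2) \<le>
      ennreal ((b - a) / 2) * emeasure lborel {y \<in> ?Q. u y \<ge> b} * emeasure lborel {y \<in> ?Q. u y \<le> a}"
    by (intro mult_mono A B order_refl) auto
  also have "\<dots> \<le> ennreal (n / 2 ^ j) * 2 ^ n * ennreal q * ?I a b"
    using level_set_poincare[OF uv ab(2) convex_dyadic_cell r _ less_imp_le[OF norm_diff_dyadic_cell]]
    by (simp add: Q n_def)
  also have "?I a b \<le> ?I G g"
    using ab by (intro nn_integral_mono mult_right_mono ennreal_leI mult_left_mono) (auto simp: indicator_def)
  finally have le: "ennreal ((b - a) / 2) * ennreal ((1 / 2) ^ (n + 1) * q) * ennreal (q / 2) \<le>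
      ennreal (n / 2 ^ j) * 2 ^ n * ennreal q * ?I G g"
    by (simp add: mult_left_mono)
  have "ennreal ((b - a) / 2) * ennreal ((1 / 2) ^ (n + 1) * q) * ennreal (q / 2) =
      ennreal q * ennreal ((b - a) / 2 * (1 / 2) ^ (n + 1) * (q / 2))"
    using \<open>q > 0\<close> ab(2) by (simp add: ennreal_mult[symmetric] mult_ac)
  moreover have "ennreal (n / 2 ^ j) * 2 ^ n * ennreal q = ennreal q * ennreal (n / 2 ^ j * 2 ^ n)"
  proof -
    have "ennreal (n / 2 ^ j * 2 ^ n) = ennreal (n / 2 ^ j) * 2 ^ n"
      by (subst ennreal_mult) (simp_all add: ennreal_power[symmetric])
    then show ?thesis
      by (simp only: mult_ac)
  qed
  ultimately have "ennreal q * ennreal ((b - a) / 2 * (1 / 2) ^ (n + 1) * (q / 2)) \<le>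
      ennreal q * (ennreal (n / 2 ^ j * 2 ^ n) * ?I G g)"
    using le by (simp only: mult.assoc)
  then have "ennreal ((b - a) / 2 * (1 / 2) ^ (n + 1) * (q / 2)) \<le> ennreal (n / 2 ^ j * 2 ^ n) * ?I G g"
    using \<open>q > 0\<close> by (subst (asm) ennreal_mult_le_mult_iff) auto
  then have "ennreal (2 ^ j * 2 ^ (n + 4)) * ennreal ((b - a) / 2 * (1 / 2) ^ (n + 1) * (q / 2)) \<le>
      ennreal (2 ^ j * 2 ^ (n + 4)) * (ennreal (n / 2 ^ j * 2 ^ n) * ?I G g)"
    by (rule mult_left_mono) simp
  moreover have "ennreal (2 ^ j * 2 ^ (n + 4)) * ennreal ((b - a) / 2 * (1 / 2) ^ (n + 1) * (q / 2)) =
      ennreal ((g - G) * 2 ^ j * q)"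
    unfolding ab(4) using \<open>G < g\<close> \<open>q > 0\<close>
    by (subst ennreal_mult[symmetric]) (auto simp: power_add power_one_over field_simps)
  moreover have "ennreal (2 ^ j * 2 ^ (n + 4)) * (ennreal (n / 2 ^ j * 2 ^ n) * ?I G g) =
      ennreal (poincare_const n) * ?I G g"
  proof -
    have "poincare_const n = (2 ^ j * 2 ^ (n + 4)) * (n / 2 ^ j * 2 ^ n)"
      by (simp add: poincare_const_def power_add power_mult power2_eq_square mult_2 field_simps
        flip: power_mult_distrib)
    then have "ennreal (poincare_const n) = ennreal (2 ^ j * 2 ^ (n + 4)) * ennreal (n / 2 ^ j * 2 ^ n)"
      by (simp only:) (rule ennreal_mult; simp)
    then show ?thesis
      by (simp only: mult.assoc)
  qed
  ultimately show ?thesis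
    by (simp add: q_def n_def)
qed

section \<open>The cost of a cell\<close>

text \<open>This replaces Jensen's inequality, which for a variable exponent fails unless \<open>\<mu> powr p\<close> is
  essentially constant on the set.\<close>

lemma modular_lower_bound:
  fixes F p :: "'a::euclidean_space \<Rightarrow> real"
  assumes [measurable]: "F \<in> borel_measurable borel" "p \<in> borel_measurable borel" "Q \<in> sets borel"
    and q: "emeasure lborel Q = ennreal q" "q > 0" and F: "\<And>y. F y \<ge> 0"
    and \<mu>: "\<mu> > 0" and M: "\<And>y. y \<in> Q \<Longrightarrow> \<mu> powr (s - p y) \<le> M" "M \<ge> 0" and p: "\<And>y. y \<in> Q \<Longrightarrow> p y \<ge> 1"
    and le: "ennreal (2 * \<mu> * q) \<le> (\<integral>\<^sup>+y\<in>Q. ennreal (F y) \<partial>lborel)"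
  shows "ennreal (\<mu> powr s * q) \<le> ennreal M * (\<integral>\<^sup>+y\<in>Q. ennreal (F y powr p y) \<partial>lborel)"
proof -
  let ?J = "\<integral>\<^sup>+y\<in>Q. ennreal (F y powr p y) \<partial>lborel"
  \<comment> \<open>Where \<open>F\<close> exceeds \<mu>, the exponent 1 - p \<le> 0 gives F powr (1
    - p) \<le> \<mu> powr (1 - p), and replacing p by the constant s costs \<open>M\<close>. The
    part with F \<le> \<mu> carries at most \<mu> * q, half of the assumed mass, and is
    absorbed.\<close>
  have pointwise: "F y \<le> \<mu> + \<mu> powr (1 - s) * M * F y powr p y" if y: "y \<in> Q" for y
  proof (cases "F y \<le> \<mu>")
    case True
    then show ?thesis
      using M(2) by (auto intro: add_increasing2)
  next
    case False
    then have "F y > 0"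
      using \<mu> by simp
    then have "F y = F y powr p y * F y powr (1 - p y)"
      by (simp add: powr_add[symmetric])
    also have "\<dots> \<le> F y powr p y * \<mu> powr (1 - p y)"
      using False \<mu> p[OF y] by (intro mult_left_mono powr_mono2') auto
    also have "\<mu> powr (1 - p y) = \<mu> powr (1 - s) * \<mu> powr (s - p y)"
      by (simp add: powr_add[symmetric])
    also have "F y powr p y * (\<mu> powr (1 - s) * \<mu> powr (s - p y)) \<le> F y powr p y * (\<mu> powr (1 - s) * M)"
      by (intro mult_left_mono M y) auto
    finally show ?thesis
      using \<mu> by (simp add: mult_ac)
  qed
  have "(\<integral>\<^sup>+y\<in>Q. ennreal (F y) \<partial>lborel) \<le>
    (\<integral>\<^sup>+y. ennreal \<mu> * indicator Q y + ennreal (\<mu> powr (1 - s) * M) * (ennreal (F y powr p y) * indicator Q y) \<partial>lborel)"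
  proof (intro nn_integral_mono)
    fix y
    show "ennreal (F y) * indicator Q y \<le>
      ennreal \<mu> * indicator Q y + ennreal (\<mu> powr (1 - s) * M) * (ennreal (F y powr p y) * indicator Q y)"
      using ennreal_leI[OF pointwise[of y]] \<mu> M(2)
      by (cases "y \<in> Q") (auto simp: ennreal_plus ennreal_mult)
  qed
  also have "\<dots> = ennreal \<mu> * ennreal q + ennreal (\<mu> powr (1 - s) * M) * ?J"
    by (subst nn_integral_add) (simp_all add: nn_integral_cmult nn_integral_cmult_indicator q)
  also have "ennreal \<mu> * ennreal q = ennreal (\<mu> * q)"
    using \<mu> q by (intro ennreal_mult[symmetric]) auto
  finally have "ennreal (2 * \<mu> * q) \<le> ennreal (\<mu> * q) + ennreal (\<mu> powr (1 - s) * M) * ?J"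
    using le by (rule order_trans[rotated])
  moreover have "ennreal (2 * \<mu> * q) = ennreal (\<mu> * q) + ennreal (\<mu> * q)"
    using \<mu> q by (subst ennreal_plus[symmetric]) auto
  ultimately have "ennreal (\<mu> * q) \<le> ennreal (\<mu> powr (1 - s) * M) * ?J"
    by simp
  then have "ennreal (\<mu> powr (s - 1)) * ennreal (\<mu> * q) \<le> ennreal (\<mu> powr (s - 1)) * (ennreal (\<mu> powr (1 - s) * M) * ?J)"
    by (rule mult_left_mono) simp
  moreover have "ennreal (\<mu> powr (s - 1)) * ennreal (\<mu> * q) = ennreal (\<mu> powr s * q)"
    using \<mu> q by (simp add: ennreal_mult[symmetric] powr_diff)
  moreover have "ennreal (\<mu> powr (s - 1)) * (ennreal (\<mu> powr (1 - s) * M) * ?J) = ennreal M * ?J"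
  proof -
    have "\<mu> powr (s - 1) * (\<mu> powr (1 - s) * M) = M"
      using \<mu> by (simp add: mult.assoc[symmetric] powr_add[symmetric])
    then have "ennreal (\<mu> powr (s - 1)) * ennreal (\<mu> powr (1 - s) * M) = ennreal M"
      using M(2) by (subst ennreal_mult[symmetric]) auto
    then show ?thesis
      by (simp only: mult.assoc[symmetric])
  qed
  ultimately show ?thesis
    by simp
qed

text \<open>The argument 2n / 2^j is the diameter of the covering ball. Up to constants the gauge is
  2^(-jn) * 2^(js) * j powr (- P), and 2^j = 2 * K * \<mu> / c with \<mu> = c * 2^j / (2 * K) trades
  2^(js) for \<mu> powr s * c powr (- s). The constants 2n, 4 and 2K, each to the power n, come from
  \<open>T1\<close>, \<open>T2\<close> and \<open>T3\<close>.\<close>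

lemma gauge_bound:
  fixes n j :: nat and s P c K :: real
  assumes n: "n \<ge> 1" and j: "j \<ge> 1" and K: "K \<ge> 1" and s: "1 \<le> s" "s \<le> P" "P \<le> n"
    and c: "real j powr (- (1 + 1 / n)) \<le> c" and large: "ln (2 ^ j / (2 * real n)) \<ge> j / 4"
  shows "c * ((2 * real n / 2 ^ j) powr (n - s) * ln (1 / (2 * real n / 2 ^ j)) powr (- P)) \<le>
    (16 * real n * K) ^ n * ((c * 2 ^ j / (2 * K)) powr s * (1 / 2) ^ (j * n))"
proof -
  define \<mu> where "\<mu> = c * 2 ^ j / (2 * K)"
  have "real j powr (- (1 + 1 / n)) > 0"
    using j by simp
  then have "c > 0"
    using c by linarith
  have "\<mu> > 0"
    using \<open>c > 0\<close> K by (simp add: \<mu>_def)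
  have T1: "(2 * real n / 2 ^ j) powr (n - s) \<le> (2 * real n) ^ n * ((1 / 2) ^ (j * n) * (2 ^ j) powr s)"
  proof -
    have "(2 * real n / 2 ^ j) powr (n - s) = (2 * real n) powr (n - s) / (2 ^ j) powr (n - s)"
      by (simp add: powr_divide)
    also have "(2 ^ j) powr (real n - s) = (2 ^ j) ^ n / (2 ^ j) powr s"
      by (simp add: powr_diff powr_realpow)
    also have "(2 * real n) powr (n - s) \<le> (2 * real n) powr n"
      using n s by (intro powr_mono) auto
    then have "(2 * real n) powr (n - s) / ((2 ^ j) ^ n / (2 ^ j) powr s) \<le> (2 * real n) powr n / ((2 ^ j) ^ n / (2 ^ j) powr s)"
      by (rule divide_right_mono) simp
    also have "\<dots> = (2 * real n) ^ n * ((1 / 2) ^ (j * n) * (2 ^ j) powr s)"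
      using n by (simp add: powr_realpow power_mult power_one_over)
    finally show ?thesis .
  qed
  have T2: "ln (1 / (2 * real n / 2 ^ j)) powr (- P) \<le> 4 ^ n * real j powr (- P)"
  proof -
    have "ln (1 / (2 * real n / 2 ^ j)) powr (- P) \<le> (j / 4) powr (- P)"
      using large j s by (intro powr_mono2') auto
    also have "\<dots> = 4 powr P * real j powr (- P)"
      using j by (simp add: powr_divide powr_minus field_simps)
    also have "4 powr P \<le> 4 powr real n"
      using s by (intro powr_mono) auto
    then have "4 powr P * real j powr (- P) \<le> 4 powr real n * real j powr (- P)"
      by (rule mult_right_mono) simp
    finally show ?thesis
      by (simp add: powr_realpow)
  qed
  have T3: "(2 ^ j) powr s \<le> (2 * K) ^ n * \<mu> powr s * c powr (- s)"
  proof -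
    have "2 ^ j = 2 * K * \<mu> * inverse c"
      using \<open>c > 0\<close> K by (simp add: \<mu>_def field_simps)
    then have "(2 ^ j) powr s = (2 * K) powr s * \<mu> powr s * c powr (- s)"
      using \<open>c > 0\<close> K \<open>\<mu> > 0\<close> by (simp only:) (simp add: powr_mult powr_minus inverse_powr)
    also have "(2 * K) powr s \<le> (2 * K) powr n"
      using K s by (intro powr_mono) auto
    then have "(2 * K) powr s * \<mu> powr s * c powr (- s) \<le> (2 * K) powr n * \<mu> powr s * c powr (- s)"
      by (intro mult_right_mono) auto
    finally show ?thesis
      using K by (simp add: powr_realpow)
  qed
  \<comment> \<open>The only place where the lower bound on the jump meets the logarithm of the
    gauge: (1 + 1/n) * (s - 1) \<le> s - 1 + 1 \<le> P, since s - 1 \<le> n.\<close>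
  have T4: "c * c powr (- s) * real j powr (- P) \<le> 1"
  proof -
    have "c * c powr (- s) = c powr (1 - s)"
      using \<open>c > 0\<close> by (simp add: powr_diff powr_minus field_simps)
    also have "\<dots> \<le> (real j powr (- (1 + 1 / n))) powr (1 - s)"
      using c j s by (intro powr_mono2') auto
    also have "\<dots> = real j powr ((1 + 1 / n) * (s - 1))"
      by (simp only: powr_powr) (simp add: algebra_simps diff_divide_distrib)
    finally have "c * c powr (- s) * real j powr (- P) \<le> real j powr ((1 + 1 / n) * (s - 1)) * real j powr (- P)"
      by (rule mult_right_mono) simp
    also have "\<dots> = real j powr ((1 + 1 / n) * (s - 1) - P)"
      by (simp add: powr_add[symmetric])
    also have "\<dots> \<le> real j powr 0"
    proof (rule powr_mono)
      have "(s - 1) / n \<le> 1"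
        using s n by (simp add: divide_le_eq)
      then show "(1 + 1 / n) * (s - 1) - P \<le> 0"
        using s by (simp add: algebra_simps diff_divide_distrib)
    qed (use j in simp)
    finally show ?thesis
      using j by simp
  qed
  have "c * ((2 * real n / 2 ^ j) powr (n - s) * ln (1 / (2 * real n / 2 ^ j)) powr (- P)) \<le>
    c * (((2 * real n) ^ n * ((1 / 2) ^ (j * n) * ((2 * K) ^ n * \<mu> powr s * c powr (- s)))) * (4 ^ n * real j powr (- P)))"
    using T1 T2 T3 \<open>c > 0\<close> K
    by (intro mult_left_mono mult_mono order_trans[OF T1] order_refl mult_nonneg_nonneg) auto
  also have "\<dots> = ((2 * real n) ^ n * (2 * K) ^ n * 4 ^ n * (\<mu> powr s * (1 / 2) ^ (j * n))) * (c * c powr (- s) * real j powr (- P))"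
    by (simp only: mult_ac)
  also have "\<dots> \<le> ((2 * real n) ^ n * (2 * K) ^ n * 4 ^ n * (\<mu> powr s * (1 / 2) ^ (j * n))) * 1"
    using T4 K by (intro mult_left_mono) auto
  also have "(2 * real n) ^ n * (2 * K) ^ n * 4 ^ n = (16 * real n * K) ^ n"
  proof -
    have "16 * real n * K = 2 * real n * (2 * K) * 4"
      by simp
    then show ?thesis
      by (simp only: power_mult_distrib)
  qed
  finally show ?thesis
    by (simp add: \<mu>_def)
qed

text \<open>The jump is at most 1 and not too small, so 1 \<le> \<mu> \<le> 2^j, and an oscillation
  B / j of \<open>p\<close> on the cell changes \<mu> powr p at most by the factor 2 powr B.
  \<open>modular_lower_bound\<close> and \<open>gauge_bound\<close> then combine.\<close>

lemma heavy_cell_cost: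
  fixes u p :: "real^'n \<Rightarrow> real" and x :: "real^'n"
  assumes uv: "borel_weak_gradient u v"
    and small: "emeasure lborel {y. u y \<ge> 1 / 2} \<le> ennreal ((1 / 2) ^ (j0 * CARD('n) + 1))"
    and "j0 \<le> j" "j \<ge> 1"
    and [measurable]: "p \<in> borel_measurable borel" and p: "\<And>x. 1 \<le> p x" "\<And>x. p x \<le> exponent_sup p"
    and P: "exponent_sup p \<le> CARD('n)"
    and osc: "\<And>y. y \<in> dyadic_cell j x \<Longrightarrow> \<bar>p x - p y\<bar> \<le> B / j"
    and large: "ln (2 ^ j / (2 * real CARD('n))) \<ge> j / 4"
      "2 ^ j * real j powr (- (1 + 1 / CARD('n))) \<ge> 2 * poincare_const CARD('n)"
  defines "G \<equiv> level u j0 j x" and "g \<equiv> level u j0 (Suc j) x"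
  assumes heavy: "real j powr (- (1 + 1 / CARD('n))) \<le> g - G"
  shows "ennreal ((g - G) * log_gauge p x (2 * real CARD('n) / 2 ^ j)) \<le>
    ennreal ((16 * real CARD('n) * poincare_const CARD('n)) ^ CARD('n) * 2 powr B) *
    (\<integral>\<^sup>+y\<in>dyadic_cell j x. ennreal ((norm (v y) * indicator {G<..<g} (u y)) powr p y) \<partial>lborel)"
proof -
  define n where "n = CARD('n)"
  define K where "K = poincare_const n"
  \<comment> \<open>Half of the mean gradient that the jump forces by
    \<open>level_jump_energy\<close>; the other half is the reserve needed in
    \<open>modular_lower_bound\<close>.\<close>
  define \<mu> where "\<mu> = (g - G) * 2 ^ j / (2 * K)"
  define q :: real where "q = (1 / 2) ^ (j * n)"
  define F where "F = (\<lambda>y. norm (v y) * indicator {G<..<g} (u y))"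
  have [measurable]: "u \<in> borel_measurable borel" "v \<in> borel_measurable borel"
    using uv borel_locally_integrable_norm(1)[of v]
    by (auto simp: borel_weak_gradient_def borel_locally_integrable_def)
  have [measurable]: "F \<in> borel_measurable borel"
    by (simp add: F_def)
  have n: "n \<ge> 1"
    by (simp add: n_def)
  have "real n * 2 ^ (2 * n + 4) \<ge> 1 * 1"
    using n by (intro mult_mono) auto
  then have K: "K \<ge> 1"
    by (simp add: K_def poincare_const_def)
  have "real j powr (- (1 + 1 / CARD('n))) > 0"
    using \<open>j \<ge> 1\<close> by simp
  then have "G < g"
    using heavy by linarith
  have "g - G \<le> 1"
    using level_bounds(2)[of u j0 "Suc j" x] level_bounds(1)[of u j0 j x] by (simp add: g_def G_def)
  have "2 * K \<le> 2 ^ j * (g - G)"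
    using order_trans[OF large(2) mult_left_mono[OF heavy]] by (simp add: K_def n_def)
  then have \<mu>1: "\<mu> \<ge> 1"
    using K by (simp add: \<mu>_def field_simps)
  have \<mu>2: "\<mu> \<le> 2 ^ j"
  proof -
    have "(g - G) * 2 ^ j \<le> 1 * 2 ^ j"
      using \<open>g - G \<le> 1\<close> by (intro mult_right_mono) auto
    also have "\<dots> \<le> (2 * K) * 2 ^ j"
      using K by (intro mult_right_mono) auto
    finally show ?thesis
      using K by (simp add: \<mu>_def divide_le_eq mult.commute)
  qed
  have "q > 0"
    by (simp add: q_def)
  have "ennreal (\<mu> powr p x * q) \<le> ennreal (2 powr B) * (\<integral>\<^sup>+y\<in>dyadic_cell j x. ennreal (F y powr p y) \<partial>lborel)"
  proof (rule modular_lower_bound)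
    show "emeasure lborel (dyadic_cell j x) = ennreal q"
      by (simp add: emeasure_dyadic_cell q_def n_def)
    show "\<mu> powr (p x - p y) \<le> 2 powr B" if "y \<in> dyadic_cell j x" for y
    proof -
      have "p x - p y \<le> B / j"
        using osc[OF that] by simp
      moreover have "0 \<le> B / j"
        using osc[OF that] abs_ge_zero order_trans by blast
      ultimately have "\<mu> powr (p x - p y) \<le> (2 ^ j) powr (B / j)"
        using \<mu>1 \<mu>2 by (intro order_trans[OF powr_mono powr_mono2]) auto
      also have "\<dots> = 2 powr B"
        using \<open>j \<ge> 1\<close> by (simp add: powr_realpow[symmetric] powr_powr)
      finally show ?thesis .
    qed
    have "ennreal K * ennreal (2 * \<mu> * q) = ennreal ((g - G) * 2 ^ j * q)"
      using K \<open>G < g\<close> \<open>q > 0\<close> \<mu>1 by (subst ennreal_mult[symmetric]) (auto simp: \<mu>_def)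
    also have "\<dots> \<le> ennreal K * (\<integral>\<^sup>+y\<in>dyadic_cell j x. ennreal (F y) \<partial>lborel)"
      using level_jump_energy[OF uv small \<open>j0 \<le> j\<close>, of x] \<open>G < g\<close>
      by (simp add: K_def n_def q_def F_def g_def G_def)
    finally show "ennreal (2 * \<mu> * q) \<le> (\<integral>\<^sup>+y\<in>dyadic_cell j x. ennreal (F y) \<partial>lborel)"
      using K by (subst (asm) ennreal_mult_le_mult_iff) auto
  qed (use \<mu>1 p \<open>q > 0\<close> in \<open>auto simp: F_def\<close>)
  then have "ennreal ((16 * real n * K) ^ n) * ennreal (\<mu> powr p x * q) \<le>
      ennreal ((16 * real n * K) ^ n) * (ennreal (2 powr B) * (\<integral>\<^sup>+y\<in>dyadic_cell j x. ennreal (F y powr p y) \<partial>lborel))"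
    by (rule mult_left_mono) simp
  moreover have "ennreal ((g - G) * log_gauge p x (2 * real n / 2 ^ j)) \<le> ennreal ((16 * real n * K) ^ n) * ennreal (\<mu> powr p x * q)"
  proof -
    have "(g - G) * log_gauge p x (2 * real n / 2 ^ j) \<le> (16 * real n * K) ^ n * (\<mu> powr p x * q)"
      unfolding log_gauge_def \<mu>_def q_def n_def[symmetric]
      by (rule gauge_bound) (use n K p P large(1) heavy \<open>j \<ge> 1\<close> in \<open>auto simp: n_def\<close>)
    then show ?thesis
      using K by (subst ennreal_mult[symmetric]) (auto intro: ennreal_leI simp: q_def)
  qed
  moreover have "ennreal ((16 * real n * K) ^ n * 2 powr B) = ennreal ((16 * real n * K) ^ n) * ennreal (2 powr B)"
    using K by (intro ennreal_mult) auto
  ultimately have "ennreal ((g - G) * log_gauge p x (2 * real n / 2 ^ j)) \<le>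
      ennreal ((16 * real n * K) ^ n * 2 powr B) * (\<integral>\<^sup>+y\<in>dyadic_cell j x. ennreal (F y powr p y) \<partial>lborel)"
    by (simp only: mult.assoc order_trans)
  then show ?thesis
    by (simp only: F_def K_def n_def)
qed

section \<open>Selection of cells\<close>

text \<open>Averaging over the threshold \<open>\<theta>\<close> turns a fractional covering into an honest one: an index is
  selected when the partial sum of the weights along its chain crosses \<open>\<theta>\<close>.\<close>

lemma threshold_selection:
  fixes a b :: "nat \<Rightarrow> real" and h :: "nat \<Rightarrow> ennreal"
  assumes sum: "(\<Sum>m. h m * ennreal (b m - a m)) < ennreal (\<epsilon> / 4)" and "\<And>m. a m \<le> b m"
  obtains \<theta> where "0 < \<theta>" "\<theta> < 1 / 4" "(\<Sum>m. h m * indicator {a m<..b m} \<theta>) \<le> ennreal \<epsilon>"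
proof (rule ccontr)
  assume "\<not> thesis"
  note select = that
  \<comment> \<open>If every threshold in (0, 1/4) were too expensive, integrating the cost over
    this interval of length 1/4 would give at least \<epsilon> / 4.\<close>
  have large: "ennreal \<epsilon> \<le> (\<Sum>m. h m * indicator {a m<..b m} \<theta>)" if "0 < \<theta>" "\<theta> < 1 / 4" for \<theta>
    using select[OF that] \<open>\<not> thesis\<close> by (meson linear)
  have "ennreal (\<epsilon> / 4) = (\<integral>\<^sup>+\<theta>. ennreal \<epsilon> * indicator {0<..<1 / 4 :: real} \<theta> \<partial>lborel)"
    by (subst nn_integral_cmult_indicator) (auto simp: ennreal_mult''[symmetric])
  also have "\<dots> \<le> (\<integral>\<^sup>+\<theta>. (\<Sum>m. h m * indicator {a m<..b m} \<theta>) \<partial>lborel)"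
    using large by (intro nn_integral_mono) (auto simp: indicator_def)
  also have "\<dots> = (\<Sum>m. \<integral>\<^sup>+\<theta>. h m * indicator {a m<..b m} \<theta> \<partial>lborel)"
    by (rule nn_integral_suminf) simp
  also have "\<dots> = (\<Sum>m. h m * ennreal (b m - a m))"
    using assms(2) by (simp add: nn_integral_cmult_indicator)
  finally show False
    using sum by simp
qed

lemma suminf_at_most_one:
  fixes f :: "nat \<Rightarrow> ennreal"
  assumes "\<And>m m'. f m \<noteq> 0 \<Longrightarrow> f m' \<noteq> 0 \<Longrightarrow> m = m'" "\<And>m. f m \<le> B"
  shows "(\<Sum>m. f m) \<le> B"
proof (cases "\<exists>m. f m \<noteq> 0")
  case True
  then obtain m where "f m \<noteq> 0"
    by blast
  then have "(\<Sum>m. f m) = (\<Sum>i\<in>{m}. f i)"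
    using assms(1) by (intro suminf_finite) auto
  then show ?thesis
    using assms(2) by simp
qed simp

definition heavy_jump :: "(real^'n \<Rightarrow> real) \<Rightarrow> nat \<Rightarrow> nat \<Rightarrow> real^'n \<Rightarrow> real" where
  "heavy_jump u j0 j x = (let c = level u j0 (Suc j) x - level u j0 j x in
     if real j powr (- (1 + 1 / CARD('n))) \<le> c then c else 0)"

definition heavy_sum :: "(real^'n \<Rightarrow> real) \<Rightarrow> nat \<Rightarrow> nat \<Rightarrow> real^'n \<Rightarrow> real" where
  "heavy_sum u j0 m x = (\<Sum>j=j0..<m. heavy_jump u j0 j x)"

lemma heavy_jump_nonneg: "heavy_jump u j0 j x \<ge> 0"
  using level_mono[of j "Suc j" u j0 x] by (simp add: heavy_jump_def Let_def)

lemma heavy_sum_Suc: "j0 \<le> j \<Longrightarrow> heavy_sum u j0 (Suc j) x = heavy_sum u j0 j x + heavy_jump u j0 j x"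
  by (simp add: heavy_sum_def)

lemma heavy_sum_cong:
  assumes "dyadic_index j x = dyadic_index j y" "m \<le> Suc j"
  shows "heavy_sum u j0 m x = heavy_sum u j0 m y"
proof -
  have "heavy_jump u j0 i x = heavy_jump u j0 i y" if "i < m" for i
    using level_cong[OF assms(1), of i u j0] level_cong[OF assms(1), of "Suc i" u j0] that assms(2)
    by (simp add: heavy_jump_def Let_def)
  then show ?thesis
    unfolding heavy_sum_def by (intro sum.cong) auto
qed

text \<open>The level rises by 1/2 in total, and the discarded jumps account for at most 1/4 of
  it.\<close>

lemma heavy_sum_lower_bound:
  fixes u :: "real^'n \<Rightarrow> real"
  assumes "j0 \<le> m" "level u j0 m x = 1" "(\<Sum>j=j0..<m. real j powr (- (1 + 1 / CARD('n)))) \<le> 1 / 4"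
  shows "heavy_sum u j0 m x \<ge> 1 / 4"
proof -
  have "1 / 2 = (\<Sum>j=j0..<m. level u j0 (Suc j) x - level u j0 j x)"
    unfolding sum_Suc_diff'[OF assms(1), of "\<lambda>j. level u j0 j x"] using assms(2) by simp
  also have "\<dots> \<le> (\<Sum>j=j0..<m. heavy_jump u j0 j x + real j powr (- (1 + 1 / CARD('n))))"
    by (intro sum_mono) (simp add: heavy_jump_def Let_def)
  also have "\<dots> \<le> heavy_sum u j0 m x + 1 / 4"
    using assms(3) by (simp add: heavy_sum_def sum.distrib)
  finally show ?thesis
    by simp
qed

lemma threshold_crossing:
  assumes "j0 \<le> m" "\<theta> \<le> heavy_sum u j0 m x" "0 < \<theta>"
  obtains j where "j0 \<le> j" "heavy_sum u j0 j x < \<theta>" "\<theta> \<le> heavy_sum u j0 (Suc j) x"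
proof -
  define k where "k = (LEAST k. \<theta> \<le> heavy_sum u j0 k x)"
  have k: "\<theta> \<le> heavy_sum u j0 k x"
    unfolding k_def by (rule LeastI) (rule assms(2))
  have "k > j0"
    using k assms(3) by (cases "k \<le> j0") (auto simp: heavy_sum_def)
  then obtain j where "k = Suc j" "j0 \<le> j"
    by (cases k) auto
  moreover have "heavy_sum u j0 j x < \<theta>"
    using not_less_Least[of j "\<lambda>k. \<theta> \<le> heavy_sum u j0 k x"] \<open>k = Suc j\<close> by (simp add: k_def[symmetric])
  ultimately show thesis
    using k that by blast
qed

text \<open>If \<open>y\<close> contributes to a cell of scale j, then u y lies strictly between the
  levels of \<open>y\<close> before and after j. Levels increase with the scale, so this determines
  j, and then \<open>y\<close> determines the cell. The test \<open>to_nat (j, k) = m\<close>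
  discards numbers that are not codes and would count a cell repeatedly.\<close>

lemma suminf_jump_energy:
  fixes u p :: "real^'n \<Rightarrow> real"
  assumes [measurable]: "u \<in> borel_measurable borel" "v \<in> borel_measurable borel" "p \<in> borel_measurable borel"
  shows "(\<Sum>m. case from_nat m of (j, k) \<Rightarrow>
      if to_nat (j, k) = m \<and> j0 \<le> j then
        (\<integral>\<^sup>+y\<in>dyadic_cell j (dyadic_corner j k). ennreal ((norm (v y) *
           indicator {level u j0 j (dyadic_corner j k)<..<level u j0 (Suc j) (dyadic_corner j k)} (u y)) powr p y) \<partial>lborel)
      else 0) \<le> (\<integral>\<^sup>+y. ennreal (norm (v y) powr p y) \<partial>lborel)" (is "(\<Sum>m. ?e m) \<le> _")
proof -
  define J where "J = (\<lambda>m. fst (from_nat m :: nat \<times> (int^'n)))"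
  define X :: "nat \<Rightarrow> real^'n" where "X = (\<lambda>m. dyadic_corner (J m) (snd (from_nat m :: nat \<times> (int^'n))))"
  define valid where "valid = (\<lambda>m. to_nat (from_nat m :: nat \<times> (int^'n)) = m \<and> j0 \<le> J m)"
  define f where "f = (\<lambda>m y. of_bool (valid m) * (ennreal ((norm (v y) *
      indicator {level u j0 (J m) (X m)<..<level u j0 (Suc (J m)) (X m)} (u y)) powr p y) * indicator (dyadic_cell (J m) (X m)) y))"
  have "?e m = (\<integral>\<^sup>+y. f m y \<partial>lborel)" for m
    by (auto simp: f_def J_def X_def valid_def case_prod_unfold)
  then have "(\<Sum>m. ?e m) = (\<integral>\<^sup>+y. (\<Sum>m. f m y) \<partial>lborel)"
    by (simp only:) (rule nn_integral_suminf[symmetric], simp add: f_def)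
  also have "\<dots> \<le> (\<integral>\<^sup>+y. ennreal (norm (v y) powr p y) \<partial>lborel)"
  proof (intro nn_integral_mono suminf_at_most_one)
    fix y m m'
    show "f m y \<le> ennreal (norm (v y) powr p y)"
      by (auto simp: f_def indicator_def)
    assume "f m y \<noteq> 0" "f m' y \<noteq> 0"
    have *: "valid m \<and> dyadic_index (J m) y = snd (from_nat m :: nat \<times> (int^'n)) \<and>
        level u j0 (J m) y < u y \<and> u y < level u j0 (Suc (J m)) y" if "f m y \<noteq> 0" for m
    proof -
      have "valid m" "y \<in> dyadic_cell (J m) (X m)"
        "u y \<in> {level u j0 (J m) (X m)<..<level u j0 (Suc (J m)) (X m)}"
        using that by (auto simp: f_def indicator_def split: if_splits)
      moreover from this have index: "dyadic_index (J m) y = dyadic_index (J m) (X m)"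
        by (simp add: dyadic_cell_def)
      ultimately show ?thesis
        using level_cong[OF index, of _ u j0] by (simp add: X_def)
    qed
    note m = *[OF \<open>f m y \<noteq> 0\<close>] and m' = *[OF \<open>f m' y \<noteq> 0\<close>]
    have "\<not> J m < J m'"
      using level_mono[of "Suc (J m)" "J m'" u j0 y] m m' by (auto simp: Suc_le_eq)
    moreover have "\<not> J m' < J m"
      using level_mono[of "Suc (J m')" "J m" u j0 y] m m' by (auto simp: Suc_le_eq)
    ultimately have "J m = J m'"
      by simp
    then have "(from_nat m :: nat \<times> (int^'n)) = from_nat m'"
      using m m' by (metis J_def prod_eqI)
    then show "m = m'"
      using m m' by (metis valid_def)
  qed
  finally show ?thesis .
qed

text \<open>Converts the sum over an index set of balls into a series with an indicator, the shape
  that \<open>threshold_selection\<close> delivers.\<close>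

lemma gen_hausdorff_content_le:
  fixes h :: "'a::euclidean_space \<Rightarrow> real \<Rightarrow> real" and I :: "nat set"
  assumes "E \<subseteq> (\<Union>i\<in>I. ball (c i) (r i))" "\<And>i. i \<in> I \<Longrightarrow> 0 < r i" "\<And>i. i \<in> I \<Longrightarrow> 2 * r i \<le> \<eta>"
  shows "gen_hausdorff_content h \<eta> E \<le> (\<Sum>m. ennreal (h (c m) (2 * r m)) * indicator I m)"
proof -
  have diam: "diameter (ball (c i) (r i)) = 2 * r i" if "i \<in> I" for i
    using assms(2)[OF that] by simp
  have "\<forall>i\<in>I. 0 < diameter (ball (c i) (r i)) \<and> diameter (ball (c i) (r i)) \<le> \<eta>"
  proof
    fix i assume "i \<in> I"
    then show "0 < diameter (ball (c i) (r i)) \<and> diameter (ball (c i) (r i)) \<le> \<eta>"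
      using assms(2,3) by (simp only: diam) auto
  qed
  then have "gen_hausdorff_content h \<eta> E \<le> (\<Sum>\<^sub>\<infinity>i\<in>I. ennreal (h (c i) (diameter (ball (c i) (r i)))))"
    unfolding gen_hausdorff_content_def using assms(1) by (intro Inf_lower) blast
  also have "\<dots> \<le> (\<Sum>m. ennreal (h (c m) (2 * r m)) * indicator I m)"
  proof (rule infsum_le_finite_sums)
    fix F assume F: "finite F" "F \<subseteq> I"
    have "(\<Sum>i\<in>F. ennreal (h (c i) (diameter (ball (c i) (r i))))) = (\<Sum>i\<in>F. ennreal (h (c i) (2 * r i)) * indicator I i)"
      using F(2) diam by (intro sum.cong) (auto simp: indicator_def simp del: diameter_ball)
    also have "\<dots> \<le> (\<Sum>m. ennreal (h (c m) (2 * r m)) * indicator I m)"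
      by (rule sum_le_suminf) (use F in auto)
    finally show "(\<Sum>i\<in>F. ennreal (h (c i) (diameter (ball (c i) (r i))))) \<le>
      (\<Sum>m. ennreal (h (c m) (2 * r m)) * indicator I m)" .
  qed (rule nonneg_summable_on_complete, simp)
  finally show ?thesis .
qed

text \<open>The sum over all cells of heavy jump times gauge is bounded by a constant times the
  gradient energy, hence lies below \<epsilon> / 4. A threshold drawn from an interval of length 1/4
  makes this a covering of cost at most \<epsilon>.\<close>

lemma log_gauge_content_le:
  fixes u p :: "real^'n \<Rightarrow> real"
  assumes uv: "borel_weak_gradient u v"
    and small: "emeasure lborel {y. u y \<ge> 1 / 2} \<le> ennreal ((1 / 2) ^ (j0 * CARD('n) + 1))"
    and "j0 \<ge> 1"
    and [measurable]: "p \<in> borel_measurable borel" and p: "\<And>x. 1 \<le> p x" "\<And>x. p x \<le> exponent_sup p"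
    and P: "exponent_sup p \<le> CARD('n)"
    and osc: "\<And>j x y. j \<ge> j0 \<Longrightarrow> y \<in> dyadic_cell j x \<Longrightarrow> \<bar>p x - p y\<bar> \<le> B / j"
    and large: "\<And>j. j \<ge> j0 \<Longrightarrow> ln (2 ^ j / (2 * real CARD('n))) \<ge> j / 4"
      "\<And>j. j \<ge> j0 \<Longrightarrow> 2 ^ j * real j powr (- (1 + 1 / CARD('n))) \<ge> 2 * poincare_const CARD('n)"
    and tail: "\<And>m. (\<Sum>j=j0..<m. real j powr (- (1 + 1 / CARD('n)))) \<le> 1 / 4"
    and energy: "ennreal ((16 * real CARD('n) * poincare_const CARD('n)) ^ CARD('n) * 2 powr B) *
      (\<integral>\<^sup>+y. ennreal (norm (v y) powr p y) \<partial>lborel) < ennreal (\<epsilon> / 4)"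
    and U: "open U" "E \<subseteq> U" "AE y in lborel. y \<in> U \<longrightarrow> u y \<ge> 1"
    and \<eta>: "2 * real CARD('n) / 2 ^ j0 \<le> \<eta>"
  shows "gen_hausdorff_content (log_gauge p) \<eta> E \<le> ennreal \<epsilon>"
proof -
  have u [measurable]: "u \<in> borel_measurable borel" and v [measurable]: "v \<in> borel_measurable borel"
    using uv borel_locally_integrable_norm(1)[of v]
    by (auto simp: borel_weak_gradient_def borel_locally_integrable_def)
  define C where "C = (16 * real CARD('n) * poincare_const CARD('n)) ^ CARD('n) * 2 powr B"
  define J where "J = (\<lambda>m. fst (from_nat m :: nat \<times> (int^'n)))"
  define X :: "nat \<Rightarrow> real^'n" where "X = (\<lambda>m. dyadic_corner (J m) (snd (from_nat m :: nat \<times> (int^'n))))"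
  define valid where "valid = (\<lambda>m. to_nat (from_nat m :: nat \<times> (int^'n)) = m \<and> j0 \<le> J m)"
  \<comment> \<open>The ball of this radius about the corner contains the cell, and its diameter is
    the argument of the gauge in \<open>heavy_cell_cost\<close>.\<close>
  define r where "r = (\<lambda>m. real CARD('n) / 2 ^ J m)"
  define h where "h = (\<lambda>m. ennreal (log_gauge p (X m) (2 * r m)))"
  \<comment> \<open>The heavy sums before and after the cell. Numbers that code no admissible cell
    get the value 0 in both, so a positive threshold never selects them.\<close>
  define a where "a = (\<lambda>m. if valid m then heavy_sum u j0 (J m) (X m) else 0)"
  define b where "b = (\<lambda>m. if valid m then heavy_sum u j0 (Suc (J m)) (X m) else 0)"
  define e where "e = (\<lambda>m. if valid m then (\<integral>\<^sup>+y\<in>dyadic_cell (J m) (X m). ennreal ((norm (v y) *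
      indicator {level u j0 (J m) (X m)<..<level u j0 (Suc (J m)) (X m)} (u y)) powr p y) \<partial>lborel) else 0)"
  have ba: "b m - a m = (if valid m then heavy_jump u j0 (J m) (X m) else 0)" for m
    by (simp add: a_def b_def valid_def heavy_sum_Suc)
  have cost: "h m * ennreal (b m - a m) \<le> ennreal C * e m" for m
  proof (cases "valid m \<and> heavy_jump u j0 (J m) (X m) \<noteq> 0")
    case True
    define c where "c = level u j0 (Suc (J m)) (X m) - level u j0 (J m) (X m)"
    have J: "j0 \<le> J m"
      using True by (simp add: valid_def)
    have heavy: "real (J m) powr (- (1 + 1 / CARD('n))) \<le> c" "heavy_jump u j0 (J m) (X m) = c"
      using True by (auto simp: heavy_jump_def Let_def c_def split: if_splits)
    have "h m * ennreal (b m - a m) = ennreal (c * log_gauge p (X m) (2 * real CARD('n) / 2 ^ J m))"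
      using True heavy heavy_jump_nonneg[of u j0 "J m" "X m"]
      by (simp add: h_def ba r_def ennreal_mult'[symmetric] mult.commute)
    also have "\<dots> \<le> ennreal C * e m"
      using heavy_cell_cost[OF uv small J _ _ p P osc[OF J] large[OF J]] J \<open>j0 \<ge> 1\<close> heavy(1) True
      by (simp add: C_def e_def c_def)
    finally show ?thesis .
  qed (auto simp: ba)
  have "(\<Sum>m. h m * ennreal (b m - a m)) \<le> (\<Sum>m. ennreal C * e m)"
    by (intro suminf_le cost) auto
  also have "\<dots> = ennreal C * (\<Sum>m. e m)"
    by simp
  also have "(\<Sum>m. e m) \<le> (\<integral>\<^sup>+y. ennreal (norm (v y) powr p y) \<partial>lborel)"
    using suminf_jump_energy[of u v p j0, OF u v \<open>p \<in> borel_measurable borel\<close>]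
    unfolding e_def valid_def X_def J_def case_prod_unfold prod.collapse .
  also have "ennreal C * \<dots> < ennreal (\<epsilon> / 4)"
    using energy by (simp add: C_def)
  finally have "(\<Sum>m. h m * ennreal (b m - a m)) < ennreal (\<epsilon> / 4)"
    by (simp add: mult_left_mono)
  moreover have "a m \<le> b m" for m
    using ba[of m] heavy_jump_nonneg[of u j0 "J m" "X m"] by (auto split: if_splits)
  ultimately obtain \<theta> where \<theta>: "0 < \<theta>" "\<theta> < 1 / 4" "(\<Sum>m. h m * indicator {a m<..b m} \<theta>) \<le> ennreal \<epsilon>"
    by (rule threshold_selection)
  define I where "I = {m. a m < \<theta> \<and> \<theta> \<le> b m}"
  have I_valid: "valid m" if "m \<in> I" for m
    using that \<theta>(1) by (auto simp: I_def a_def b_def split: if_splits)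
  have "gen_hausdorff_content (log_gauge p) \<eta> E \<le> (\<Sum>m. ennreal (log_gauge p (X m) (2 * r m)) * indicator I m)"
  proof (rule gen_hausdorff_content_le)
    show "E \<subseteq> (\<Union>i\<in>I. ball (X i) (r i))"
    proof
      fix x assume "x \<in> E"
      then obtain m where m: "j0 \<le> m" "level u j0 m x = 1"
        using U by (blast intro: level_eq_1[OF u])
      have "\<theta> \<le> heavy_sum u j0 m x"
        using heavy_sum_lower_bound[OF m tail] \<theta>(2) by simp
      then obtain j where j: "j0 \<le> j" "heavy_sum u j0 j x < \<theta>" "\<theta> \<le> heavy_sum u j0 (Suc j) x"
        using threshold_crossing[OF m(1) _ \<theta>(1)] by metis
      define i where "i = to_nat (j, dyadic_index j x)"
      have i: "J i = j" "valid i" "X i = dyadic_corner j (dyadic_index j x)"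
        using j(1) by (auto simp: J_def valid_def X_def i_def)
      have index: "dyadic_index j (X i) = dyadic_index j x"
        by (simp add: i)
      \<comment> \<open>Selection is decided at the corner \<open>X i\<close>, but heavy sums up to
        \<open>Suc j\<close> are constant on the cell, so a crossing at \<open>x\<close> is a
        crossing at the corner.\<close>
      have "i \<in> I"
        using j i heavy_sum_cong[OF index, of _ u j0] by (simp add: I_def a_def b_def)
      moreover have "x \<in> ball (X i) (r i)"
        using norm_diff_dyadic_cell[of "X i" j x x] index i(1)
        by (simp add: dist_norm r_def dyadic_cell_def)
      ultimately show "x \<in> (\<Union>i\<in>I. ball (X i) (r i))"
        by blast
    qed
    show "0 < r i" for i
      by (simp add: r_def)
    show "2 * r i \<le> \<eta>" if "i \<in> I" for i
    proof -
      have "2 * r i \<le> 2 * real CARD('n) / 2 ^ j0"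
        using I_valid[OF that] by (auto simp: r_def valid_def intro!: divide_left_mono power_increasing)
      then show ?thesis
        using \<eta> by linarith
    qed
  qed
  also have "\<dots> = (\<Sum>m. h m * indicator {a m<..b m} \<theta>)"
    by (simp add: h_def I_def indicator_def)
  also have "\<dots> \<le> ennreal \<epsilon>"
    by (rule \<theta>(3))
  finally show ?thesis .
qed

section \<open>Exponents and capacity\<close>

lemma log_holder_continuous_imp_continuous_on:
  assumes "log_holder_continuous p"
  shows "continuous_on UNIV p"
proof -
  obtain c where c: "c > 0" "\<And>x y. x \<noteq> y \<Longrightarrow> \<bar>p x - p y\<bar> \<le> c / ln (exp 1 + 1 / norm (x - y))"
    using assms by (auto simp: log_holder_continuous_def)
  show ?thesis
    unfolding continuous_on_iff
  proof (intro ballI allI impI)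
    fix x :: 'a and e :: real assume "e > 0"
    show "\<exists>d>0. \<forall>y\<in>UNIV. dist y x < d \<longrightarrow> dist (p y) (p x) < e"
    proof (intro exI[of _ "exp (- (c / e))"] conjI ballI impI)
      fix y assume y: "dist y x < exp (- (c / e))"
      show "dist (p y) (p x) < e"
      proof (cases "y = x")
        case False
        then have "norm (y - x) > 0"
          by simp
        then have "exp (c / e) < 1 / norm (y - x)"
          using y by (simp add: dist_norm exp_minus field_simps)
        then have "exp (c / e) < exp 1 + 1 / norm (y - x)"
          by (simp add: add_strict_increasing2)
        then have ln: "c / e < ln (exp 1 + 1 / norm (y - x))"
          by (metis exp_gt_zero less_trans ln_exp ln_less_cancel_iff)
        then have "c < e * ln (exp 1 + 1 / norm (y - x))"
          using \<open>e > 0\<close> by (simp add: field_simps)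
        moreover have "ln (exp 1 + 1 / norm (y - x)) > 0"
          using ln c(1) \<open>e > 0\<close> by (meson divide_pos_pos less_trans)
        ultimately have "c / ln (exp 1 + 1 / norm (y - x)) < e"
          by (simp add: divide_less_eq)
        then show ?thesis
          using c(2)[OF False] by (simp add: dist_real_def)
      qed (use \<open>e > 0\<close> in simp)
    qed simp
  qed
qed

text \<open>Continuity upgrades the almost everywhere bound to a pointwise one: the set where
  \<open>p\<close> exceeds its essential supremum is open and null, hence empty.\<close>

lemma exponent_sup_bounds:
  fixes p :: "'a::euclidean_space \<Rightarrow> real"
  assumes cont: "continuous_on UNIV p" and p: "\<And>x. l \<le> p x" "\<And>x. p x \<le> r"
  shows "p x \<le> exponent_sup p" "exponent_sup p \<le> r"
proof -
  have [measurable]: "p \<in> borel_measurable borel"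
    using cont by (rule borel_measurable_continuous_onI)
  define s where "s = esssup lebesgue (\<lambda>x. ereal (p x))"
  have "(\<lambda>x. ereal (p x)) \<in> borel_measurable lebesgue"
    by (rule measurable_completion) simp
  then have "s \<le> ereal r"
    unfolding s_def using p by (intro esssup_I) auto
  have AE: "AE x in lborel. ereal (p x) \<le> s"
    using esssup_AE[of "\<lambda>x. ereal (p x)" lebesgue] by (simp add: s_def AE_completion_iff)
  have "\<exists>x. ereal (p x) \<le> s"
  proof (rule ccontr)
    assume "\<nexists>x. ereal (p x) \<le> s"
    with AE have "AE x in (lborel :: 'a measure). False"
      by auto
    then have "emeasure (lborel :: 'a measure) UNIV = 0"
      by (subst (asm) AE_iff_measurable[OF _ refl]) auto
    then show False
      using emeasure_lborel_open_nonzero[of "UNIV :: 'a set"] by simp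
  qed
  then obtain x0 where "ereal l \<le> s"
    using p(1) by (meson ereal_less_eq(3) order_trans)
  then obtain P where P: "s = ereal P"
    using \<open>s \<le> ereal r\<close> by (cases s) auto
  then have sup: "exponent_sup p = P"
    by (simp add: exponent_sup_def s_def[symmetric])
  show "exponent_sup p \<le> r"
    using \<open>s \<le> ereal r\<close> P sup by simp
  have "open {x. P < p x}"
    using cont by (intro open_Collect_less) auto
  moreover have "emeasure lborel {x. P < p x} = 0"
    using AE unfolding P by (subst (asm) AE_iff_measurable[OF _ refl]) (auto simp: not_le)
  ultimately have "{x. P < p x} = {}"
    using emeasure_lborel_open_nonzero by blast
  then show "p x \<le> exponent_sup p"
    unfolding sup by (auto simp: not_less)
qed

text \<open>Points of a cell are closer than n / 2^j, so the logarithm in the modulus of continuity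
  is at least j / 4.\<close>

lemma log_holder_oscillation:
  fixes p :: "real^'n \<Rightarrow> real"
  assumes c: "c > 0" "\<And>x y. x \<noteq> y \<Longrightarrow> \<bar>p x - p y\<bar> \<le> c / ln (exp 1 + 1 / norm (x - y))"
    and j: "j \<ge> 1" "ln (2 ^ j / (2 * real CARD('n))) \<ge> j / 4" and y: "y \<in> dyadic_cell j x"
  shows "\<bar>p x - p y\<bar> \<le> 4 * c / j"
proof (cases "x = y")
  case False
  define d where "d = norm (x - y)"
  have d: "0 < d" "d < real CARD('n) / 2 ^ j"
    using False norm_diff_dyadic_cell[of x j x y] y by (auto simp: d_def)
  have "2 ^ j / (2 * real CARD('n)) \<le> 2 ^ j / real CARD('n)"
    by (intro divide_left_mono) auto
  also have "\<dots> \<le> 1 / d"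
    using d by (simp add: field_simps)
  also have "\<dots> \<le> exp 1 + 1 / d"
    by simp
  finally have "ln (2 ^ j / (2 * real CARD('n))) \<le> ln (exp 1 + 1 / d)"
    by (subst ln_le_cancel_iff) (use d in \<open>auto intro: add_pos_pos\<close>)
  then have "j / 4 \<le> ln (exp 1 + 1 / d)"
    using j(2) by linarith
  then have "c / ln (exp 1 + 1 / d) \<le> c / (j / 4)"
    using c(1) j(1) by (intro divide_left_mono mult_pos_pos) auto
  then show ?thesis
    using c(2)[OF False] by (simp add: d_def mult.commute)
qed (use c j in simp)

text \<open>Gathers every requirement on the first scale, each true for all large \<open>j0\<close>.
  The last one is the Cauchy criterion for a series convergent because 1 + 1/N > 1.\<close>

lemma eventually_scales:
  assumes "N \<ge> (1::nat)" and "\<eta> > 0"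
  shows "\<forall>\<^sub>F j0 in sequentially. j0 \<ge> 1 \<and> 2 * real N / 2 ^ j0 \<le> \<eta> \<and>
    (\<forall>j\<ge>j0. ln (2 ^ j / (2 * real N)) \<ge> j / 4 \<and> 2 ^ j * real j powr (- (1 + 1 / N)) \<ge> K) \<and>
    (\<forall>m. (\<Sum>j=j0..<m. real j powr (- (1 + 1 / N))) \<le> 1 / 4)"
proof -
  have N: "real N > 0"
    using assms by simp
  have "\<forall>\<^sub>F j in sequentially. ln (2 ^ j / (2 * real N)) \<ge> j / 4"
  proof -
    obtain M where M: "4 * ln (2 * real N) \<le> real M"
      using real_arch_simple by blast
    have "ln (2 ^ j / (2 * real N)) \<ge> j / 4" if "j \<ge> M" for j
    proof -
      have "ln (2 ^ j / (2 * real N)) = real j * ln 2 - ln (2 * real N)"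
        using N by (subst ln_div) (auto simp: ln_realpow)
      moreover have "real j * ln 2 \<ge> real j * (1 / 2)"
        using exp_le ln_ge_iff[of 2 "1 / 2"] exp_half_le2 by (intro mult_left_mono) auto
      moreover have "real M \<le> real j"
        using that by simp
      ultimately show ?thesis
        using M by linarith
    qed
    then show ?thesis
      unfolding eventually_sequentially by blast
  qed
  then have 1: "\<forall>\<^sub>F j0 in sequentially. \<forall>j\<ge>j0. ln (2 ^ j / (2 * real N)) \<ge> j / 4"
    by (rule eventually_all_ge_at_top)
  \<comment> \<open>The exponent - 2 lies below - (1 + 1/N) for every N \<ge> 1, so the growth has
    to be checked for one fixed exponent only.\<close>
  have "filterlim (\<lambda>j::nat. 2 ^ j * real j powr (- 2)) at_top sequentially"
    by real_asymp
  then have "\<forall>\<^sub>F j::nat in sequentially. 2 ^ j * real j powr (- 2) \<ge> K"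
    by (simp add: filterlim_at_top)
  moreover have "\<forall>\<^sub>F j::nat in sequentially. j \<ge> 1"
    by (rule eventually_ge_at_top)
  ultimately have "\<forall>\<^sub>F j::nat in sequentially. 2 ^ j * real j powr (- (1 + 1 / N)) \<ge> K"
  proof eventually_elim
    case (elim j)
    have "1 / real N \<le> 1"
      using assms by (simp add: divide_le_eq)
    then have "real j powr (- 2) \<le> real j powr (- (1 + 1 / N))"
      using elim by (intro powr_mono) auto
    then have "2 ^ j * real j powr (- 2) \<le> 2 ^ j * real j powr (- (1 + 1 / N))"
      by (rule mult_left_mono) simp
    then show ?case
      using elim by linarith
  qed
  then have 2: "\<forall>\<^sub>F j0::nat in sequentially. \<forall>j\<ge>j0. 2 ^ j * real j powr (- (1 + 1 / N)) \<ge> K"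
    by (rule eventually_all_ge_at_top)
  have "summable (\<lambda>j. real j powr (- (1 + 1 / N)))"
    using N by (simp add: summable_real_powr_iff)
  note cauchy = this[unfolded summable_Cauchy, rule_format]
  have "\<exists>M. \<forall>j0\<ge>M. \<forall>m. norm (\<Sum>j=j0..<m. real j powr (- (1 + 1 / N))) < 1 / 4"
    by (rule cauchy) simp
  then obtain M where M: "\<And>j0 m. j0 \<ge> M \<Longrightarrow> norm (\<Sum>j=j0..<m. real j powr (- (1 + 1 / N))) < 1 / 4"
    by blast
  have 3: "\<forall>\<^sub>F j0::nat in sequentially. j0 \<ge> M"
    by (rule eventually_ge_at_top)
  have 4: "\<forall>\<^sub>F j0::nat in sequentially. j0 \<ge> 1"
    by (rule eventually_ge_at_top)
  have "(\<lambda>j0. 2 * real N * (1 / 2) ^ j0) \<longlonglongrightarrow> 2 * real N * 0"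
    by (intro tendsto_intros LIMSEQ_power_zero) auto
  then have "(\<lambda>j0. 2 * real N / 2 ^ j0) \<longlonglongrightarrow> 0"
    by (simp add: power_one_over)
  then have 5: "\<forall>\<^sub>F j0 in sequentially. 2 * real N / 2 ^ j0 < \<eta>"
    using \<open>\<eta> > 0\<close> by (rule order_tendstoD)
  show ?thesis
    using 1 2 3 4 5
  proof eventually_elim
    case (elim j0)
    have "(\<Sum>j=j0..<m. real j powr (- (1 + 1 / N))) \<le> 1 / 4" for m
      using M[of j0 m] elim(3) abs_ge_self[of "\<Sum>j=j0..<m. real j powr (- (1 + 1 / N))"]
      unfolding real_norm_def by linarith
    then show ?case
      using elim by (auto simp: less_imp_le)
  qed
qed

section \<open>Borel representatives and admissible functions of small energy\<close>

lemma test_function_continuous: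
  assumes "test_function \<phi>"
  shows "continuous_on UNIV \<phi>" "continuous_on UNIV (partial_deriv i \<phi>)"
proof -
  have "times_differentiable 0 \<phi>" "times_differentiable (Suc 0) \<phi>"
    using assms by (auto simp only: test_function_def)
  then show "continuous_on UNIV \<phi>" "continuous_on UNIV (partial_deriv i \<phi>)"
    by auto
qed

lemma locally_integrable_borel_version:
  assumes "locally_integrable u"
  obtains u' where "borel_locally_integrable u'" "AE x in lborel. u x = u' x"
proof -
  have "u \<in> borel_measurable lebesgue"
    using assms by (simp add: locally_integrable_def)
  then obtain u' where [measurable]: "u' \<in> borel_measurable borel" and AE: "AE x in lborel. u x = u' x"
    using completion_ex_borel_measurable_real[of u lborel] by auto
  have "integrable lborel (\<lambda>x. indicator (cball 0 r) x * u' x)" for r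
  proof -
    have "integrable lebesgue (\<lambda>x. indicator (cball 0 r) x * u x)"
      using assms by (simp add: locally_integrable_def set_integrable_def)
    moreover have "AE x in lebesgue. indicator (cball 0 r) x * u x = indicator (cball 0 r) x * u' x"
      using AE_completion[OF AE] by (auto elim!: eventually_mono)
    moreover have "(\<lambda>x. indicator (cball 0 r) x * u' x) \<in> borel_measurable lebesgue"
      by (rule measurable_completion) simp
    ultimately have "integrable lebesgue (\<lambda>x. indicator (cball 0 r) x * u' x)"
      by (subst Bochner_Integration.integrable_cong_AE[symmetric]) (auto intro: borel_measurable_integrable)
    then show ?thesis
      by (subst (asm) integrable_completion) auto
  qed
  then show thesis
    using AE by (intro that[of u']) (auto simp: borel_locally_integrable_def)
qed

lemma integral_lebesgue_borel_version:
  fixes u u' :: "'a::euclidean_space \<Rightarrow> real"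
  assumes [measurable]: "u' \<in> borel_measurable borel" and AE: "AE x in lborel. u x = u' x"
    and "u \<in> borel_measurable lebesgue" and \<psi> [measurable]: "\<psi> \<in> borel_measurable borel"
  shows "(LINT x|lebesgue. u x * \<psi> x) = (\<integral>x. u' x * \<psi> x \<partial>lborel)"
proof -
  have "u' \<in> borel_measurable lebesgue" "\<psi> \<in> borel_measurable lebesgue"
    by (rule measurable_completion, simp)+
  note measurable_lebesgue [measurable] = this \<open>u \<in> borel_measurable lebesgue\<close>
  have "(LINT x|lebesgue. u x * \<psi> x) = (LINT x|lebesgue. u' x * \<psi> x)"
  proof (rule integral_cong_AE)
    show "(\<lambda>x. u x * \<psi> x) \<in> borel_measurable lebesgue" "(\<lambda>x. u' x * \<psi> x) \<in> borel_measurable lebesgue"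
      by (intro borel_measurable_times measurable_lebesgue)+
    show "AE x in lebesgue. u x * \<psi> x = u' x * \<psi> x"
      using AE_completion[OF AE] by (auto elim!: eventually_mono)
  qed
  also have "\<dots> = (\<integral>x. u' x * \<psi> x \<partial>lborel)"
    by (rule integral_completion) simp
  finally show ?thesis .
qed

text \<open>Exchanging \<open>u\<close> and its weak partial derivatives for Borel functions equal
  almost everywhere preserves the integration by parts identity, as test functions and their partial
  derivatives are Borel.\<close>

lemma weak_partial_borel_version:
  fixes u :: "real^'n \<Rightarrow> real"
  assumes "\<And>i. is_weak_partial i u (weak_partial i u)"
  obtains u' v' where "borel_weak_gradient u' v'" "AE x in lborel. u x = u' x"
    "AE x in lborel. weak_gradient u x = v' x"
proof -
  have loc: "locally_integrable u" "\<And>i. locally_integrable (weak_partial i u)"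
    using assms by (auto simp: is_weak_partial_def)
  obtain u' where u': "borel_locally_integrable u'" "AE x in lborel. u x = u' x"
    using locally_integrable_borel_version[OF loc(1)] .
  have "\<exists>w. borel_locally_integrable w \<and> (AE x in lborel. weak_partial i u x = w x)" for i
    using locally_integrable_borel_version[OF loc(2)] by metis
  then obtain w where w: "\<And>i. borel_locally_integrable (w i)" "\<And>i. AE x in lborel. weak_partial i u x = w i x"
    by metis
  define v' where "v' = (\<lambda>x. \<chi> i. w i x)"
  have "borel_weak_gradient u' v'"
    unfolding borel_weak_gradient_def
  proof (intro conjI allI impI)
    fix \<phi> :: "real^'n \<Rightarrow> real" and i
    assume \<phi>: "test_function \<phi>"
    then have [measurable]: "\<phi> \<in> borel_measurable borel" "partial_deriv i \<phi> \<in> borel_measurable borel"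
      using test_function_continuous by (auto intro!: borel_measurable_continuous_onI)
    have "(\<integral>x. u' x * partial_deriv i \<phi> x \<partial>lborel) = (LINT x|lebesgue. u x * partial_deriv i \<phi> x)"
      using u' loc(1)
      by (intro integral_lebesgue_borel_version[symmetric]) (auto simp: borel_locally_integrable_def locally_integrable_def)
    also have "\<dots> = - (LINT x|lebesgue. weak_partial i u x * \<phi> x)"
      using assms \<phi> by (auto simp: is_weak_partial_def)
    also have "(LINT x|lebesgue. weak_partial i u x * \<phi> x) = (\<integral>x. w i x * \<phi> x \<partial>lborel)"
      using w loc(2)
      by (intro integral_lebesgue_borel_version) (auto simp: borel_locally_integrable_def locally_integrable_def)
    finally show "(\<integral>x. u' x * partial_deriv i \<phi> x \<partial>lborel) = - (\<integral>x. v' x $ i * \<phi> x \<partial>lborel)"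
      by (simp add: v'_def)
  qed (use u' w in \<open>auto simp: v'_def\<close>)
  moreover have "AE x in lborel. \<forall>i\<in>UNIV. weak_partial i u x = w i x"
    using w(2) by (intro AE_finite_allI) auto
  then have "AE x in lborel. weak_gradient u x = v' x"
    by eventually_elim (auto simp: weak_gradient_def v'_def vec_eq_iff)
  ultimately show thesis
    using u'(2) that by blast
qed

lemma powr_le_Phi_log:
  assumes "t \<ge> 0" "q x \<ge> 0"
  shows "ennreal (t powr p x) \<le> Phi_log p q x t"
proof -
  have "ln (exp 1) \<le> ln (exp 1 + t)"
    using assms(1) by (subst ln_le_cancel_iff) (auto intro: add_pos_nonneg)
  then have "1 \<le> ln (exp 1 + t) powr q x"
    using assms(2) by (simp add: ge_one_powr_ge_zero)
  then have "t powr p x * 1 \<le> t powr p x * ln (exp 1 + t) powr q x"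
    by (intro mult_left_mono) auto
  then show ?thesis
    unfolding Phi_log_def by (intro ennreal_leI) simp
qed

lemma gen_hausdorff_measure_eq_0:
  assumes "\<And>\<eta>. \<eta> > 0 \<Longrightarrow> gen_hausdorff_content h \<eta> E = 0"
  shows "gen_hausdorff_measure h E = 0"
proof -
  have "\<forall>\<^sub>F \<eta> in at_right 0. gen_hausdorff_content h \<eta> E = 0"
    using eventually_at_right_less[of "0::real"] assms by (auto elim: eventually_mono)
  then have "((\<lambda>\<eta>. gen_hausdorff_content h \<eta> E) \<longlongrightarrow> 0) (at_right 0)"
    by (rule tendsto_eventually)
  then show ?thesis
    using gen_hausdorff_content_tendsto[of h E] by (intro tendsto_unique[of "at_right (0::real)"]) auto
qed

text \<open>Turns vanishing capacity into the data used by the covering argument. The Borel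
  representative keeps the bound 1 on \<open>U\<close> only almost everywhere, which is all that
  \<open>level_eq_1\<close> asks for.\<close>

lemma capacity_zero_borel_test_function:
  fixes p q :: "real ^ 'n \<Rightarrow> real"
  assumes cap: "mos_capacity (Phi_log p q) E = 0" and q: "\<And>x. q x \<ge> 0" and "\<delta> > 0"
    and [measurable]: "p \<in> borel_measurable borel"
  obtains u v U where "borel_weak_gradient u v"
    "(\<integral>\<^sup>+x. ennreal (\<bar>u x\<bar> powr p x) \<partial>lborel) < \<delta>" "(\<integral>\<^sup>+x. ennreal (norm (v x) powr p x) \<partial>lborel) < \<delta>"
    "open U" "E \<subseteq> U" "AE x in lborel. x \<in> U \<longrightarrow> u x \<ge> 1"
proof -
  let ?\<Phi> = "Phi_log p q"
  have "mos_capacity ?\<Phi> E < \<delta>"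
    using cap \<open>\<delta> > 0\<close> by simp
  then obtain u where u: "u \<in> capacity_admissible ?\<Phi> E"
    "(\<integral>\<^sup>+x. (?\<Phi> x \<bar>u x\<bar> + ?\<Phi> x (norm (weak_gradient u x))) \<partial>lebesgue) < \<delta>"
    unfolding mos_capacity_def INF_less_iff by blast
  \<comment> \<open>The choice behind \<open>weak_partial\<close> is meaningful because membership
    in the Sobolev space includes existence of a weak derivative.\<close>
  have "is_weak_partial i u (weak_partial i u)" for i
    using u(1) unfolding weak_partial_def[of i u]
    by (intro someI_ex[of "is_weak_partial i u"]) (auto simp: capacity_admissible_def musielak_orlicz_sobolev_def)
  then obtain u' v' where uv: "borel_weak_gradient u' v'" "AE x in lborel. u x = u' x"
    "AE x in lborel. weak_gradient u x = v' x"
    by (rule weak_partial_borel_version[of u]) blast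
  obtain U where U: "open U" "E \<subseteq> U" "\<And>x. x \<in> U \<Longrightarrow> u x \<ge> 1"
    using u(1) by (auto simp: capacity_admissible_def)
  have le: "ennreal (\<bar>u x\<bar> powr p x) \<le> ?\<Phi> x \<bar>u x\<bar> + ?\<Phi> x (norm (weak_gradient u x))"
    "ennreal (norm (weak_gradient u x) powr p x) \<le> ?\<Phi> x \<bar>u x\<bar> + ?\<Phi> x (norm (weak_gradient u x))" for x
    using powr_le_Phi_log[of "\<bar>u x\<bar>" q x p] powr_le_Phi_log[of "norm (weak_gradient u x)" q x p] q
    by (auto intro: add_increasing add_increasing2)
  have energy: "(\<integral>\<^sup>+x. (?\<Phi> x \<bar>u x\<bar> + ?\<Phi> x (norm (weak_gradient u x))) \<partial>lborel) < \<delta>"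
    using u(2) by (simp add: nn_integral_completion)
  show thesis
  proof (rule that[OF uv(1) _ _ U(1,2)])
    have "(\<integral>\<^sup>+x. ennreal (\<bar>u' x\<bar> powr p x) \<partial>lborel) = (\<integral>\<^sup>+x. ennreal (\<bar>u x\<bar> powr p x) \<partial>lborel)"
      using uv(2) by (intro nn_integral_cong_AE) (auto elim!: eventually_mono)
    also have "\<dots> \<le> (\<integral>\<^sup>+x. (?\<Phi> x \<bar>u x\<bar> + ?\<Phi> x (norm (weak_gradient u x))) \<partial>lborel)"
      by (intro nn_integral_mono le)
    finally show "(\<integral>\<^sup>+x. ennreal (\<bar>u' x\<bar> powr p x) \<partial>lborel) < \<delta>"
      using energy by (rule le_less_trans)
    have "(\<integral>\<^sup>+x. ennreal (norm (v' x) powr p x) \<partial>lborel) =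
        (\<integral>\<^sup>+x. ennreal (norm (weak_gradient u x) powr p x) \<partial>lborel)"
      using uv(3) by (intro nn_integral_cong_AE) (auto elim!: eventually_mono)
    also have "\<dots> \<le> (\<integral>\<^sup>+x. (?\<Phi> x \<bar>u x\<bar> + ?\<Phi> x (norm (weak_gradient u x))) \<partial>lborel)"
      by (intro nn_integral_mono le)
    finally show "(\<integral>\<^sup>+x. ennreal (norm (v' x) powr p x) \<partial>lborel) < \<delta>"
      using energy by (rule le_less_trans)
    show "AE x in lborel. x \<in> U \<longrightarrow> u' x \<ge> 1"
      using uv(2) by eventually_elim (use U(3) in force)
  qed
qed

text \<open>Where u \<ge> 1/2, the integrand is at least 2 powr (- p x), hence at least 2^(-N),
  uniformly in the exponent.\<close>

lemma chebyshev_variable_exponent: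
  fixes u p :: "'a::euclidean_space \<Rightarrow> real"
  assumes [measurable]: "u \<in> borel_measurable borel" "p \<in> borel_measurable borel"
    and p: "\<And>x. 0 \<le> p x" "\<And>x. p x \<le> real N"
  shows "emeasure lborel {x. u x \<ge> 1 / 2} \<le> 2 ^ N * (\<integral>\<^sup>+x. ennreal (\<bar>u x\<bar> powr p x) \<partial>lborel)"
proof -
  have "emeasure lborel {x. u x \<ge> 1 / 2} = (\<integral>\<^sup>+x. indicator {x. u x \<ge> 1 / 2} x \<partial>lborel)"
    by simp
  also have "\<dots> \<le> (\<integral>\<^sup>+x. 2 ^ N * ennreal (\<bar>u x\<bar> powr p x) \<partial>lborel)"
  proof (intro nn_integral_mono)
    fix x
    show "indicator {x. u x \<ge> 1 / 2} x \<le> 2 ^ N * ennreal (\<bar>u x\<bar> powr p x)"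
    proof (cases "u x \<ge> 1 / 2")
      case True
      have "(1 / 2) ^ N = (1 / 2 :: real) powr real N"
        by (simp add: powr_realpow)
      also have "\<dots> \<le> (1 / 2) powr p x"
        using p by (intro powr_mono') auto
      also have "\<dots> \<le> \<bar>u x\<bar> powr p x"
        using True p by (intro powr_mono2) auto
      finally have "1 \<le> 2 ^ N * \<bar>u x\<bar> powr p x"
        by (simp add: power_one_over field_simps)
      then have "ennreal 1 \<le> ennreal (2 ^ N * \<bar>u x\<bar> powr p x)"
        by (rule ennreal_leI)
      also have "\<dots> = 2 ^ N * ennreal (\<bar>u x\<bar> powr p x)"
        by (subst ennreal_mult) (simp_all add: ennreal_power[symmetric])
      finally show ?thesis
        using True by simp
    qed simp
  qed
  also have "\<dots> = 2 ^ N * (\<integral>\<^sup>+x. ennreal (\<bar>u x\<bar> powr p x) \<partial>lborel)"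
    by (rule nn_integral_cmult) simp
  finally show ?thesis .
qed

theorem theorem1p7:
  fixes p q :: "real ^ 'n \<Rightarrow> real" and E :: "(real ^ 'n) set"
  assumes "CARD('n) \<ge> 2"
    and "\<forall>x. 1 \<le> p x \<and> p x \<le> real CARD('n)"
    and "log_holder_continuous p"
    and "log_holder_decay p"
    and "\<forall>x. 0 < q x"
    and "generalized_weak_Phi_function (Phi_log p q)"
    and "mos_capacity (Phi_log p q) E = 0"
  shows "gen_hausdorff_measure (log_gauge p) E = 0"
proof (rule gen_hausdorff_measure_eq_0)
  fix \<eta> :: real assume "\<eta> > 0"
  define N where "N = CARD('n)"
  have cont: "continuous_on UNIV p"
    using assms(3) by (rule log_holder_continuous_imp_continuous_on)
  then have [measurable]: "p \<in> borel_measurable borel"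
    by (rule borel_measurable_continuous_onI)
  have p: "1 \<le> p x" "p x \<le> N" for x
    using assms(2) by (auto simp: N_def)
  note sup = exponent_sup_bounds[OF cont p]
  obtain c where c: "c > 0" "\<And>x y. x \<noteq> y \<Longrightarrow> \<bar>p x - p y\<bar> \<le> c / ln (exp 1 + 1 / norm (x - y))"
    using assms(3) by (auto simp: log_holder_continuous_def)
  obtain j0 where "j0 \<ge> 1" and j0: "2 * real N / 2 ^ j0 \<le> \<eta>"
    "\<And>j. j \<ge> j0 \<Longrightarrow> ln (2 ^ j / (2 * real N)) \<ge> j / 4"
    "\<And>j. j \<ge> j0 \<Longrightarrow> 2 ^ j * real j powr (- (1 + 1 / N)) \<ge> 2 * poincare_const N"
    "\<And>m. (\<Sum>j=j0..<m. real j powr (- (1 + 1 / N))) \<le> 1 / 4"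
    using eventually_scales[of N \<eta> "2 * poincare_const N"] \<open>\<eta> > 0\<close> assms(1)
    by (auto simp: N_def eventually_sequentially)
  \<comment> \<open>The constant of \<open>heavy_cell_cost\<close>, with 4 * c as the oscillation
    constant supplied by \<open>log_holder_oscillation\<close>.\<close>
  define C where "C = (16 * real N * poincare_const N) ^ N * 2 powr (4 * c)"
  have "C > 0"
    using assms(1) by (simp add: C_def N_def poincare_const_def)
  have "gen_hausdorff_content (log_gauge p) \<eta> E \<le> ennreal \<epsilon>" if "\<epsilon> > 0" for \<epsilon>
  proof -
    \<comment> \<open>The first bound brings \<open>C\<close> times the gradient energy below
      \<epsilon> / 4. The second leaves, after the loss 2^N in Chebyshev's inequality, half the
      volume of a cell at scale \<open>j0\<close>.\<close>
    define \<delta> where "\<delta> = min (\<epsilon> / (4 * C)) ((1 / 2) ^ (j0 * N + 1 + N))"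
    have "\<delta> > 0"
      using \<open>\<epsilon> > 0\<close> \<open>C > 0\<close> by (simp add: \<delta>_def)
    obtain u v U where uv: "borel_weak_gradient u v"
      "(\<integral>\<^sup>+x. ennreal (\<bar>u x\<bar> powr p x) \<partial>lborel) < ennreal \<delta>"
      "(\<integral>\<^sup>+x. ennreal (norm (v x) powr p x) \<partial>lborel) < ennreal \<delta>"
      and U: "open U" "E \<subseteq> U" "AE x in lborel. x \<in> U \<longrightarrow> u x \<ge> 1"
      by (rule capacity_zero_borel_test_function[OF assms(7), of "ennreal \<delta>"])
        (use assms(5) \<open>\<delta> > 0\<close> in \<open>auto simp: less_imp_le\<close>)
    have [measurable]: "u \<in> borel_measurable borel"
      using uv(1) by (simp add: borel_weak_gradient_def borel_locally_integrable_def)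
    have "emeasure lborel {x. u x \<ge> 1 / 2} \<le> 2 ^ N * (\<integral>\<^sup>+x. ennreal (\<bar>u x\<bar> powr p x) \<partial>lborel)"
      using p by (intro chebyshev_variable_exponent) (auto intro: order_trans[of 0 1])
    also have "\<dots> \<le> 2 ^ N * ennreal ((1 / 2) ^ (j0 * N + 1 + N))"
      using uv(2) by (intro mult_left_mono) (auto simp: \<delta>_def intro: order_trans[OF less_imp_le] ennreal_leI)
    also have "\<dots> = ennreal (2 ^ N * (1 / 2) ^ (j0 * N + 1 + N))"
      by (subst ennreal_mult) (simp_all add: ennreal_power[symmetric])
    also have "2 ^ N * (1 / 2) ^ (j0 * N + 1 + N) = (1 / 2 :: real) ^ (j0 * N + 1)"
      by (simp add: power_add power_one_over)
    finally have small: "emeasure lborel {x. u x \<ge> 1 / 2} \<le> ennreal ((1 / 2) ^ (j0 * CARD('n) + 1))"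
      by (simp add: N_def)
    have energy: "ennreal C * (\<integral>\<^sup>+x. ennreal (norm (v x) powr p x) \<partial>lborel) < ennreal (\<epsilon> / 4)"
    proof -
      have "ennreal C * (\<integral>\<^sup>+x. ennreal (norm (v x) powr p x) \<partial>lborel) < ennreal C * ennreal \<delta>"
        using uv(3) \<open>C > 0\<close> by (intro ennreal_mult_strict_left_mono) auto
      also have "\<dots> \<le> ennreal (C * (\<epsilon> / (4 * C)))"
      proof -
        have "C * \<delta> \<le> C * (\<epsilon> / (4 * C))"
          using \<open>C > 0\<close> by (intro mult_left_mono) (simp_all add: \<delta>_def)
        then show ?thesis
          using \<open>C > 0\<close> \<open>\<delta> > 0\<close> by (subst ennreal_mult[symmetric]) (auto intro: ennreal_leI)
      qed
      finally show ?thesis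
        using \<open>C > 0\<close> by simp
    qed
    show ?thesis
      by (rule log_gauge_content_le[OF uv(1) small \<open>j0 \<ge> 1\<close> _ p(1) sup(1), of "4 * c", OF _ _ _ _ _ _ _ U])
        (use sup(2) j0 energy log_holder_oscillation[OF c] \<open>j0 \<ge> 1\<close> in \<open>auto simp: N_def C_def\<close>)
  qed
  note bound = this
  have "gen_hausdorff_content (log_gauge p) \<eta> E \<le> 0"
    by (rule ennreal_le_epsilon) (simp only: add_0 bound)
  then show "gen_hausdorff_content (log_gauge p) \<eta> E = 0"
    by simp
qed

end
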